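(* Let $R$ be a commutative semiperfect ring and let $f: A\to B$ be a homomorphism of finitely generated $R$-modules. Then $f$ is represented by monomorphisms if and only if $H^{-1}(C(f)^\bullet)=0$. If this is the case, the following hold. (1) There is a perfect exact sequence $$\theta_f:\quad 0\to A \xrightarrow{\binom{f}{\epsilon}} B\oplus F_A^1 \xrightarrow{(c_f\ \pi)} \underline{\mathrm{Cok}}\,\underline{f}\to 0 .$$ (2) For any exact sequence of the form $$\sigma:\quad 0\to A\xrightarrow{\binom{f}{q}} B\oplus P'\xrightarrow{(g\ p)} C\to 0$$ with some projective module $P'$, there is a commutative diagram $$\begin{array}{ccccccccc} 0&\to& A&\xrightarrow{\binom{f}{\epsilon}}& B\oplus F_A^1&\xrightarrow{(c_f\ \pi)}&\underline{\mathrm{Cok}}\,\underline{f}&\to&0\\ &&\downarrow{\scriptstyle\tilde\alpha}&&\downarrow{\scriptstyle\tilde\beta}&&\downarrow{\scriptstyle\tilde\gamma}&&\\ 0&\to& A&\xrightarrow{\binom{f}{q}}& B\oplus P'&\xrightarrow{(g\ p)}& C&\to&0 \end{array}$$ (from $\theta_f$ to $\sigma$) in which $\tilde\alpha$ and $\tilde\beta$ are stable isomorphisms. (3) For $\sigma$ and the map $\tilde\gamma$ as in (2), there is an exact sequence $$0\to Q'\to \underline{\mathrm{Cok}}\,\underline{f}\oplus Q\xrightarrow{(\tilde\gamma\ \star)} C\to 0$$ with some projective modules $Q$ and $Q'$ and some map $\star:Q\to C$. (4) If $\sigma$ as in (2) is also perfectly exact, then $\sigma$ is isomorphic to $\theta_f$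 up to direct sum of trivial complexes.
   Context: A commutative ring is semiperfect if every finitely generated module has a projective cover (equivalently, it is a finite direct sum of local rings). All modules are finitely generated over $R$; $\mathrm{mod}\,R$ is their category; $(-)^*=\mathrm{Hom}_R(-,R)$. Stable category: $\underline{\mathrm{mod}}\,R$ has the same objects as $\mathrm{mod}\,R$, and morphisms are homomorphisms modulo those factoring through a projective module; $\underline{f}$ is the class of $f$. A homomorphism $f$ is a stable isomorphism if $\underline f$ is an isomorphism in $\underline{\mathrm{mod}}\,R$; $M\stackrel{st}{\cong}N$ means isomorphic in $\underline{\mathrm{mod}}\,R$. Represented by monomorphisms: $f:A\to B$ is represented by monomorphisms if there are an injective homomorphism $f':A'\to B'$ in $\mathrm{mod}\,R$ and stable isomorphisms $\alpha:A\to A'$, $\beta:B\to B'$ with $\underline{\beta\circ f}=\underline{f'\circ\alpha}$. An exact sequence $0\to A\to B\to C\to0$ is perfect (perfectly exact) if its dual $0\to C^*\to B^*\to A^*\to 0$ is also exact. A trivial complex is a split exact sequence of projective modules. Standard resolutions: for each module $A$ there is a complex $F_A^\bullet$ (cohomological indexing, differentials $d^n:F_A^n\to F_A^{n+1}$) of finitely generated projectives, unique up to homotopy equivalence, such that $H^i(F_A^\bullet)=0$ for $i<0$, $\mathrm{Ker}((d^{j-1})^* )/\mathrm{Im}((d^{j})^* )=0$ for $j\ge0$, and $\mathrm{Coker}(d^{-1})\stackrel{st}{\cong}A$. It may be chosen so that $\mathrm{Coker}(d^{-1})=A$; then $d^0$ induces the map $\epsilon:A\to F_A^1$. A homomorphism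 $f:A\to B$ induces a chain map $f^\bullet:F_A^\bullet\to F_B^\bullet$, unique up to homotopy, whose induced map on $\mathrm{Coker}(d^{-1})$ is $f$ in $\underline{\mathrm{mod}}\,R$. $C(f)^\bullet$ is the mapping cone, $C(f)^n=F_A^{n+1}\oplus F_B^n$. The pseudo-cokernel is $\underline{\mathrm{Cok}}\,\underline f=\mathrm{Coker}(d_{C(f)}^{-1}:C(f)^{-1}\to C(f)^0)$, well defined up to stable isomorphism; the symbol also denotes any module in this stable class. In $\theta_f$ it is represented by the cokernel of $\binom{f}{\epsilon}:A\to B\oplus F_A^1$, and $(c_f\ \pi)$ is the canonical projection. *)

theory Defs
  imports "HOL-Algebra.Module" "HOL-Algebra.AbelCoset"
begin

section \<open>Finitely generated modules over a commutative ring\<close>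

text \<open>
  Homomorphisms are functions that are constrained on the carrier of their domain only; accordingly,
  equality of homomorphisms is always stated on that carrier.
\<close>

definition mod_hom ::
  "('a, 'm) ring_scheme \<Rightarrow> ('a, 'b) module \<Rightarrow> ('a, 'c) module \<Rightarrow> ('b \<Rightarrow> 'c) set" where
  "mod_hom R M N = {h \<in> carrier M \<rightarrow> carrier N.
     (\<forall>x\<in>carrier M. \<forall>y\<in>carrier M. h (x \<oplus>\<^bsub>M\<^esub> y) = h x \<oplus>\<^bsub>N\<^esub> h y) \<and>
     (\<forall>r\<in>carrier R. \<forall>x\<in>carrier M. h (r \<odot>\<^bsub>M\<^esub> x) = r \<odot>\<^bsub>N\<^esub> h x)}"

definition mod_iso ::
  "('a, 'm) ring_scheme \<Rightarrow> ('a, 'b) module \<Rightarrow> ('a, 'c) module \<Rightarrow> ('b \<Rightarrow> 'c) set" where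
  "mod_iso R M N = {h \<in> mod_hom R M N. bij_betw h (carrier M) (carrier N)}"

definition fg_module :: "('a, 'm) ring_scheme \<Rightarrow> ('a, 'b) module \<Rightarrow> bool" where
  "fg_module R M \<longleftrightarrow> module R M \<and>
     (\<exists>S. finite S \<and> S \<subseteq> carrier M \<and>
        (\<forall>x\<in>carrier M. \<exists>c\<in>S \<rightarrow> carrier R. x = (\<Oplus>\<^bsub>M\<^esub>s\<in>S. c s \<odot>\<^bsub>M\<^esub> s)))"

definition zero_module :: "('a, 'b) module \<Rightarrow> bool" where
  "zero_module M \<longleftrightarrow> carrier M = {\<zero>\<^bsub>M\<^esub>}"

text \<open>
  HOL cannot quantify over types inside a formula.  Whenever a definition quantifies over all
  finitely generated \<open>R\<close>-modules, the quantifier ranges over the modules whose elements are sets of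
  lists over the ring.  Lemma \<open>fg_module_universe\<close> below shows that every finitely generated module
  is isomorphic to one of these.
\<close>

type_synonym 'a umod = "('a, 'a list set) module"

lemma fg_module_universe:
  fixes M :: "('a, 'b) module"
  assumes "fg_module R M"
  shows "\<exists>(N :: 'a umod) h. fg_module R N \<and> h \<in> mod_iso R M N"
proof -
  interpret M: module R M using assms by (simp add: fg_module_def)
  obtain S where S: "finite S" "S \<subseteq> carrier M"
    and gen: "\<And>x. x \<in> carrier M \<Longrightarrow> \<exists>c\<in>S \<rightarrow> carrier R. x = (\<Oplus>\<^bsub>M\<^esub>s\<in>S. c s \<odot>\<^bsub>M\<^esub> s)"
    using assms by (auto simp: fg_module_def)
  obtain xs where xs: "set xs = S" using finite_list[OF S(1)] by blast
  obtain c where c: "\<And>x. x \<in> carrier M \<Longrightarrow> c x \<in> S \<rightarrow> carrier R \<and> x = (\<Oplus>\<^bsub>M\<^esub>s\<in>S. c x s \<odot>\<^bsub>M\<^esub> s)"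
    using gen by metis
  define h where "h x = {map (c x) xs}" for x
  have inj: "inj_on h (carrier M)"
  proof (rule inj_onI)
    fix x y assume x: "x \<in> carrier M" and y: "y \<in> carrier M" and e: "h x = h y"
    from e have *: "c x s = c y s" if "s \<in> S" for s using that xs by (auto simp: h_def)
    have "x = (\<Oplus>\<^bsub>M\<^esub>s\<in>S. c x s \<odot>\<^bsub>M\<^esub> s)" using c[OF x] by blast
    also have "\<dots> = (\<Oplus>\<^bsub>M\<^esub>s\<in>S. c y s \<odot>\<^bsub>M\<^esub> s)"
      using c[OF y] S(2) * by (intro M.M.finsum_cong') (auto simp: Pi_iff)
    also have "\<dots> = y" using c[OF y] by simp
    finally show "x = y" .
  qed
  define k where "k = inv_into (carrier M) h"
  have kh [simp]: "k (h x) = x" if "x \<in> carrier M" for x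
    using inj that by (simp add: k_def)
  define N :: "'a umod" where
    "N = \<lparr>carrier = h ` carrier M, mult = undefined, one = undefined, zero = h \<zero>\<^bsub>M\<^esub>,
          add = (\<lambda>X Y. h (k X \<oplus>\<^bsub>M\<^esub> k Y)), smult = (\<lambda>r X. h (r \<odot>\<^bsub>M\<^esub> k X))\<rparr>"
  have mN: "module R N"
  proof (intro moduleI abelian_groupI)
    show "cring R" by (rule M.R.is_cring)
    fix X assume "X \<in> carrier N"
    then obtain x where x: "x \<in> carrier M" "X = h x" by (auto simp: N_def)
    then show "\<exists>Y\<in>carrier N. Y \<oplus>\<^bsub>N\<^esub> X = \<zero>\<^bsub>N\<^esub>"
      by (intro bexI[of _ "h (\<ominus>\<^bsub>M\<^esub> x)"]) (auto simp: N_def M.M.l_neg)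
  qed (auto simp: N_def M.M.a_ac M.smult_l_distr M.smult_r_distr M.smult_assoc1)
  interpret N: module R N by (rule mN)
  have hN: "h \<in> mod_iso R M N"
    using inj by (auto simp: mod_iso_def mod_hom_def bij_betw_def N_def)
  have fs: "h (finsum M g T) = finsum N (\<lambda>a. h (g a)) T"
    if "finite T" "g \<in> T \<rightarrow> carrier M" for g T
    using that
  proof (induct T)
    case empty
    have "h \<zero>\<^bsub>M\<^esub> = \<zero>\<^bsub>N\<^esub>" by (simp add: N_def)
    then show ?case by simp
  next
    case (insert t T)
    then have "(\<lambda>a. h (g a)) \<in> T \<rightarrow> carrier N" "h (g t) \<in> carrier N" by (auto simp: N_def)
    moreover have "finsum M g T \<in> carrier M" using insert by (intro M.M.finsum_closed) auto
    moreover have "h (x \<oplus>\<^bsub>M\<^esub> y) = h x \<oplus>\<^bsub>N\<^esub> h y" if "x \<in> carrier M" "y \<in> carrier M" for x y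
      using that by (simp add: N_def)
    ultimately show ?case using insert by simp
  qed
  have "\<exists>c\<in>h ` S \<rightarrow> carrier R. X = (\<Oplus>\<^bsub>N\<^esub>s\<in>h ` S. c s \<odot>\<^bsub>N\<^esub> s)" if "X \<in> carrier N" for X
  proof -
    from that obtain x where x: "x \<in> carrier M" "X = h x" by (auto simp: N_def)
    have cx: "c x \<in> S \<rightarrow> carrier R" "x = (\<Oplus>\<^bsub>M\<^esub>s\<in>S. c x s \<odot>\<^bsub>M\<^esub> s)" using c[OF x(1)] by blast+
    have cl: "(\<lambda>s. c x s \<odot>\<^bsub>M\<^esub> s) \<in> S \<rightarrow> carrier M" using cx(1) S(2) by (auto simp: Pi_iff)
    have ks: "k (h s) = s" if "s \<in> S" for s using that S(2) by auto
    have "X = (\<Oplus>\<^bsub>N\<^esub>s\<in>S. h (c x s \<odot>\<^bsub>M\<^esub> s))"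
      using fs[OF S(1) cl] cx(2) x(2) by simp
    also have "\<dots> = (\<Oplus>\<^bsub>N\<^esub>s\<in>S. c x (k (h s)) \<odot>\<^bsub>N\<^esub> h s)"
      using cl by (intro N.M.finsum_cong') (auto simp: ks N_def Pi_iff)
    also have "\<dots> = (\<Oplus>\<^bsub>N\<^esub>s\<in>h ` S. c x (k s) \<odot>\<^bsub>N\<^esub> s)"
      using cx(1) S(2) inj_on_subset[OF inj S(2)]
      by (intro N.M.finsum_reindex[symmetric]) (auto simp: ks N_def Pi_iff)
    finally show ?thesis using cx(1) by (intro bexI[of _ "c x \<circ> k"]) (auto simp: ks)
  qed
  then have "fg_module R N"
    unfolding fg_module_def using mN S
    by (intro conjI exI[of _ "h ` S"]) (auto simp: N_def)
  with hN show ?thesis by blast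
qed


subsection \<open>Sums, quotients, cokernels, homology\<close>

definition dsum :: "('a, 'b) module \<Rightarrow> ('a, 'c) module \<Rightarrow> ('a, 'b \<times> 'c) module" where
  "dsum M N =
     \<lparr>carrier = carrier M \<times> carrier N, mult = undefined, one = undefined,
      zero = (\<zero>\<^bsub>M\<^esub>, \<zero>\<^bsub>N\<^esub>),
      add = (\<lambda>(x, y) (x', y'). (x \<oplus>\<^bsub>M\<^esub> x', y \<oplus>\<^bsub>N\<^esub> y')),
      smult = (\<lambda>r (x, y). (r \<odot>\<^bsub>M\<^esub> x, r \<odot>\<^bsub>N\<^esub> y))\<rparr>"

definition col_map :: "('b \<Rightarrow> 'c) \<Rightarrow> ('b \<Rightarrow> 'd) \<Rightarrow> 'b \<Rightarrow> 'c \<times> 'd" where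
  "col_map f g = (\<lambda>x. (f x, g x))"

definition row_map :: "('a, 'd) module \<Rightarrow> ('b \<Rightarrow> 'd) \<Rightarrow> ('c \<Rightarrow> 'd) \<Rightarrow> 'b \<times> 'c \<Rightarrow> 'd" where
  "row_map N g p = (\<lambda>(x, y). g x \<oplus>\<^bsub>N\<^esub> p y)"

definition mod_quot :: "('a, 'b) module \<Rightarrow> 'b set \<Rightarrow> ('a, 'b set) module" where
  "mod_quot M N =
     \<lparr>carrier = a_rcosets\<^bsub>M\<^esub> N, mult = undefined, one = undefined,
      zero = N, add = set_add M,
      smult = (\<lambda>r X. \<Union>x\<in>X. N +>\<^bsub>M\<^esub> (r \<odot>\<^bsub>M\<^esub> x))\<rparr>"

definition coker :: "('a, 'b) module \<Rightarrow> ('b \<Rightarrow> 'c) \<Rightarrow> ('a, 'c) module \<Rightarrow> ('a, 'c set) module" where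
  "coker L h M = mod_quot M (h ` carrier L)"

definition coker_proj :: "('a, 'b) module \<Rightarrow> ('b \<Rightarrow> 'c) \<Rightarrow> ('a, 'c) module \<Rightarrow> 'c \<Rightarrow> 'c set" where
  "coker_proj L h M = (\<lambda>x. (h ` carrier L) +>\<^bsub>M\<^esub> x)"

text \<open>The map induced by \<open>g\<close> from a quotient into \<open>coker L' h' M'\<close> sends a coset \<open>X\<close> to the class of
  \<open>g x\<close>, for any \<open>x \<in> X\<close>.\<close>

definition coker_map ::
  "('a, 'b) module \<Rightarrow> ('b \<Rightarrow> 'c) \<Rightarrow> ('a, 'c) module \<Rightarrow> ('d \<Rightarrow> 'c) \<Rightarrow> 'd set \<Rightarrow> 'c set" where
  "coker_map L' h' M' g = (\<lambda>X. \<Union>x\<in>X. coker_proj L' h' M' (g x))"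

text \<open>\<open>homology L h M g N\<close> is \<open>Ker g / Im h\<close> for \<open>L \<rightarrow> M \<rightarrow> N\<close>.\<close>

definition homology ::
  "('a, 'b) module \<Rightarrow> ('b \<Rightarrow> 'c) \<Rightarrow> ('a, 'c) module \<Rightarrow> ('c \<Rightarrow> 'd) \<Rightarrow> ('a, 'd) module \<Rightarrow>
   ('a, 'c set) module" where
  "homology L h M g N = mod_quot (M\<lparr>carrier := a_kernel M N g\<rparr>) (h ` carrier L)"


subsection \<open>The dual\<close>

definition dual :: "('a, 'm) ring_scheme \<Rightarrow> ('a, 'b) module \<Rightarrow> ('a, 'b \<Rightarrow> 'a) module" where
  "dual R M =
     \<lparr>carrier = mod_hom R M \<lparr>carrier = carrier R, mult = mult R, one = \<one>\<^bsub>R\<^esub>, zero = \<zero>\<^bsub>R\<^esub>,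
                            add = add R, smult = mult R\<rparr> \<inter> extensional (carrier M),
      mult = undefined, one = undefined,
      zero = (\<lambda>x\<in>carrier M. \<zero>\<^bsub>R\<^esub>),
      add = (\<lambda>u v. \<lambda>x\<in>carrier M. u x \<oplus>\<^bsub>R\<^esub> v x),
      smult = (\<lambda>r u. \<lambda>x\<in>carrier M. r \<otimes>\<^bsub>R\<^esub> u x)\<rparr>"

text \<open>For \<open>h : M \<rightarrow> N\<close>, the map \<open>dual_map M h\<close> is the dual \<open>N\<^sup>* \<rightarrow> M\<^sup>*\<close>.\<close>

definition dual_map :: "('a, 'b) module \<Rightarrow> ('b \<Rightarrow> 'c) \<Rightarrow> ('c \<Rightarrow> 'a) \<Rightarrow> 'b \<Rightarrow> 'a" where
  "dual_map M h = (\<lambda>u. \<lambda>x\<in>carrier M. u (h x))"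


subsection \<open>Projective modules and semiperfect rings\<close>

text \<open>Finite generation is part of \<open>projective\<close>, since all modules are finitely generated.\<close>

definition projective :: "('a, 'm) ring_scheme \<Rightarrow> ('a, 'b) module \<Rightarrow> bool" where
  "projective R P \<longleftrightarrow> fg_module R P \<and>
     (\<forall>(M :: 'a umod) (N :: 'a umod) g h.
        fg_module R M \<and> fg_module R N \<and>
        g \<in> mod_hom R M N \<and> g ` carrier M = carrier N \<and> h \<in> mod_hom R P N \<longrightarrow>
        (\<exists>k\<in>mod_hom R P M. \<forall>x\<in>carrier P. g (k x) = h x))"

definition projective_cover ::
  "('a, 'm) ring_scheme \<Rightarrow> ('a, 'b) module \<Rightarrow> ('a, 'c) module \<Rightarrow> ('b \<Rightarrow> 'c) \<Rightarrow> bool" where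
  "projective_cover R P M p \<longleftrightarrow>
     projective R P \<and> p \<in> mod_hom R P M \<and> p ` carrier P = carrier M \<and>
     (\<forall>N. submodule N R P \<and> N <+>\<^bsub>P\<^esub> a_kernel P M p = carrier P \<longrightarrow> N = carrier P)"

definition semiperfect :: "('a, 'm) ring_scheme \<Rightarrow> bool" where
  "semiperfect R \<longleftrightarrow>
     (\<forall>M :: 'a umod. fg_module R M \<longrightarrow> (\<exists>(P :: 'a umod) p. projective_cover R P M p))"


section \<open>The stable category\<close>

text \<open>\<open>stably_eq R M N f g\<close>: the classes of \<open>f, g : M \<rightarrow> N\<close> in the stable category coincide.\<close>

definition stably_eq ::
  "('a, 'm) ring_scheme \<Rightarrow> ('a, 'b) module \<Rightarrow> ('a, 'c) module \<Rightarrow> ('b \<Rightarrow> 'c) \<Rightarrow> ('b \<Rightarrow> 'c) \<Rightarrow> bool" where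
  "stably_eq R M N f g \<longleftrightarrow>
     (\<exists>(P :: 'a umod) u v. projective R P \<and> u \<in> mod_hom R M P \<and> v \<in> mod_hom R P N \<and>
        (\<forall>x\<in>carrier M. f x \<ominus>\<^bsub>N\<^esub> g x = v (u x)))"

definition stable_iso ::
  "('a, 'm) ring_scheme \<Rightarrow> ('a, 'b) module \<Rightarrow> ('a, 'c) module \<Rightarrow> ('b \<Rightarrow> 'c) \<Rightarrow> bool" where
  "stable_iso R M N f \<longleftrightarrow> f \<in> mod_hom R M N \<and>
     (\<exists>g\<in>mod_hom R N M. stably_eq R M M (g \<circ> f) id \<and> stably_eq R N N (f \<circ> g) id)"

definition stably_isomorphic ::
  "('a, 'm) ring_scheme \<Rightarrow> ('a, 'b) module \<Rightarrow> ('a, 'c) module \<Rightarrow> bool" where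
  "stably_isomorphic R M N \<longleftrightarrow> (\<exists>f. stable_iso R M N f)"

definition represented_by_monos ::
  "('a, 'm) ring_scheme \<Rightarrow> ('a, 'b) module \<Rightarrow> ('a, 'c) module \<Rightarrow> ('b \<Rightarrow> 'c) \<Rightarrow> bool" where
  "represented_by_monos R A B f \<longleftrightarrow>
     (\<exists>(A' :: 'a umod) (B' :: 'a umod) f' \<alpha> \<beta>.
        fg_module R A' \<and> fg_module R B' \<and>
        f' \<in> mod_hom R A' B' \<and> inj_on f' (carrier A') \<and>
        stable_iso R A A' \<alpha> \<and> stable_iso R B B' \<beta> \<and>
        stably_eq R A B' (\<beta> \<circ> f) (f' \<circ> \<alpha>))"


section \<open>Short exact sequences\<close>

definition short_exact ::
  "('a, 'm) ring_scheme \<Rightarrow> ('a, 'b) module \<Rightarrow> ('b \<Rightarrow> 'c) \<Rightarrow> ('a, 'c) module \<Rightarrow> ('c \<Rightarrow> 'd) \<Rightarrow>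
   ('a, 'd) module \<Rightarrow> bool" where
  "short_exact R A i B p C \<longleftrightarrow>
     module R A \<and> module R B \<and> module R C \<and> i \<in> mod_hom R A B \<and> p \<in> mod_hom R B C \<and>
     inj_on i (carrier A) \<and> i ` carrier A = a_kernel B C p \<and> p ` carrier B = carrier C"

definition perfect_exact ::
  "('a, 'm) ring_scheme \<Rightarrow> ('a, 'b) module \<Rightarrow> ('b \<Rightarrow> 'c) \<Rightarrow> ('a, 'c) module \<Rightarrow> ('c \<Rightarrow> 'd) \<Rightarrow>
   ('a, 'd) module \<Rightarrow> bool" where
  "perfect_exact R A i B p C \<longleftrightarrow>
     short_exact R A i B p C \<and>
     short_exact R (dual R C) (dual_map B p) (dual R B) (dual_map A i) (dual R A)"

definition trivial_sequence ::
  "('a, 'm) ring_scheme \<Rightarrow> ('a, 'b) module \<Rightarrow> ('b \<Rightarrow> 'c) \<Rightarrow> ('a, 'c) module \<Rightarrow> ('c \<Rightarrow> 'd) \<Rightarrow>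
   ('a, 'd) module \<Rightarrow> bool" where
  "trivial_sequence R P i Q p S \<longleftrightarrow>
     projective R P \<and> projective R Q \<and> projective R S \<and> short_exact R P i Q p S \<and>
     (\<exists>r\<in>mod_hom R Q P. \<forall>x\<in>carrier P. r (i x) = x)"

definition sequence_hom where
  "sequence_hom R A i B p C A' i' B' p' C' \<alpha> \<beta> \<gamma> \<longleftrightarrow>
     \<alpha> \<in> mod_hom R A A' \<and> \<beta> \<in> mod_hom R B B' \<and> \<gamma> \<in> mod_hom R C C' \<and>
     (\<forall>x\<in>carrier A. \<beta> (i x) = i' (\<alpha> x)) \<and> (\<forall>y\<in>carrier B. \<gamma> (p y) = p' (\<beta> y))"

definition isomorphic_sequences where
  "isomorphic_sequences R A i B p C A' i' B' p' C' \<longleftrightarrow>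
     (\<exists>\<alpha>\<in>mod_iso R A A'. \<exists>\<beta>\<in>mod_iso R B B'. \<exists>\<gamma>\<in>mod_iso R C C'.
        sequence_hom R A i B p C A' i' B' p' C' \<alpha> \<beta> \<gamma>)"

definition isomorphic_upto_trivial where
  "isomorphic_upto_trivial R A i B p C A' i' B' p' C' \<longleftrightarrow>
     (\<exists>(P :: 'a umod) j (Q :: 'a umod) q (S :: 'a umod)
       (P' :: 'a umod) j' (Q' :: 'a umod) q' (S' :: 'a umod).
        trivial_sequence R P j Q q S \<and> trivial_sequence R P' j' Q' q' S' \<and>
        isomorphic_sequences R
          (dsum A P) (map_prod i j) (dsum B Q) (map_prod p q) (dsum C S)
          (dsum A' P') (map_prod i' j') (dsum B' Q') (map_prod p' q') (dsum C' S'))"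
  for R :: "('a, 'm) ring_scheme"


section \<open>Complexes and standard resolutions\<close>

definition is_complex ::
  "('a, 'm) ring_scheme \<Rightarrow> (int \<Rightarrow> ('a, 'b) module) \<Rightarrow> (int \<Rightarrow> 'b \<Rightarrow> 'b) \<Rightarrow> bool" where
  "is_complex R F d \<longleftrightarrow>
     (\<forall>n. module R (F n) \<and> d n \<in> mod_hom R (F n) (F (n + 1)) \<and>
        (\<forall>x\<in>carrier (F n). d (n + 1) (d n x) = \<zero>\<^bsub>F (n + 2)\<^esub>))"

definition cohomology ::
  "(int \<Rightarrow> ('a, 'b) module) \<Rightarrow> (int \<Rightarrow> 'b \<Rightarrow> 'b) \<Rightarrow> int \<Rightarrow> ('a, 'b set) module" where
  "cohomology F d n = homology (F (n - 1)) (d (n - 1)) (F n) (d n) (F (n + 1))"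

text \<open>\<open>Ker (d\<^sup>n\<^sup>-\<^sup>1)\<^sup>* / Im (d\<^sup>n)\<^sup>*\<close>, a subquotient of \<open>(F\<^sup>n)\<^sup>*\<close>.\<close>

definition dual_cohomology ::
  "('a, 'm) ring_scheme \<Rightarrow> (int \<Rightarrow> ('a, 'b) module) \<Rightarrow> (int \<Rightarrow> 'b \<Rightarrow> 'b) \<Rightarrow> int \<Rightarrow>
   ('a, ('b \<Rightarrow> 'a) set) module" where
  "dual_cohomology R F d n =
     homology (dual R (F (n + 1))) (dual_map (F n) (d n)) (dual R (F n))
       (dual_map (F (n - 1)) (d (n - 1))) (dual R (F (n - 1)))"

definition coker_at :: "(int \<Rightarrow> ('a, 'b) module) \<Rightarrow> (int \<Rightarrow> 'b \<Rightarrow> 'b) \<Rightarrow> int \<Rightarrow> ('a, 'b set) module" where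
  "coker_at F d n = coker (F n) (d n) (F (n + 1))"

text \<open>
  \<open>\<phi>\<close> witnesses that the cokernel of \<open>d\<^sup>-\<^sup>1\<close> is stably isomorphic to \<open>A\<close>; the normalisation
  \<open>Coker d\<^sup>-\<^sup>1 = A\<close> amounts to \<open>\<phi>\<close> being an isomorphism.
\<close>

definition standard_resolution ::
  "('a, 'm) ring_scheme \<Rightarrow> ('a, 'b) module \<Rightarrow> (int \<Rightarrow> ('a, 'c) module) \<Rightarrow> (int \<Rightarrow> 'c \<Rightarrow> 'c) \<Rightarrow>
   ('c set \<Rightarrow> 'b) \<Rightarrow> bool" where
  "standard_resolution R A F d \<phi> \<longleftrightarrow>
     is_complex R F d \<and> (\<forall>n. projective R (F n)) \<and>
     (\<forall>n<0. zero_module (cohomology F d n)) \<and>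
     (\<forall>n\<ge>0. zero_module (dual_cohomology R F d n)) \<and>
     stable_iso R (coker_at F d (-1)) A \<phi>"

text \<open>The map \<open>A \<rightarrow> F\<^sup>1\<close> induced by \<open>d\<^sup>0\<close> when \<open>\<phi>\<close> identifies \<open>Coker d\<^sup>-\<^sup>1\<close> with \<open>A\<close>.\<close>

definition induced_by_d0 ::
  "('a, 'm) ring_scheme \<Rightarrow> ('a, 'b) module \<Rightarrow> (int \<Rightarrow> ('a, 'c) module) \<Rightarrow> (int \<Rightarrow> 'c \<Rightarrow> 'c) \<Rightarrow>
   ('c set \<Rightarrow> 'b) \<Rightarrow> ('b \<Rightarrow> 'c) \<Rightarrow> bool" where
  "induced_by_d0 R A F d \<phi> \<epsilon> \<longleftrightarrow>
     \<epsilon> \<in> mod_hom R A (F 1) \<and>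
     (\<forall>x\<in>carrier (F 0). \<epsilon> (\<phi> (coker_proj (F (-1)) (d (-1)) (F 0) x)) = d 0 x)"

definition chain_map ::
  "('a, 'm) ring_scheme \<Rightarrow> (int \<Rightarrow> ('a, 'b) module) \<Rightarrow> (int \<Rightarrow> 'b \<Rightarrow> 'b) \<Rightarrow>
   (int \<Rightarrow> ('a, 'c) module) \<Rightarrow> (int \<Rightarrow> 'c \<Rightarrow> 'c) \<Rightarrow> (int \<Rightarrow> 'b \<Rightarrow> 'c) \<Rightarrow> bool" where
  "chain_map R F d G e h \<longleftrightarrow>
     (\<forall>n. h n \<in> mod_hom R (F n) (G n) \<and>
        (\<forall>x\<in>carrier (F n). e n (h n x) = h (n + 1) (d n x)))"

text \<open>The chain map \<open>h\<close> induces the stable class of \<open>f : A \<rightarrow> B\<close> on the cokernels of \<open>d\<^sup>-\<^sup>1\<close>, under the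
  stable identifications \<open>\<phi>\<close> and \<open>\<psi>\<close>.\<close>

definition induced_chain_map where
  "induced_chain_map R A F d \<phi> B G e \<psi> f h \<longleftrightarrow>
     chain_map R F d G e h \<and>
     stably_eq R (coker_at F d (-1)) B (\<psi> \<circ> coker_map (G (-1)) (e (-1)) (G 0) (h 0)) (f \<circ> \<phi>)"

definition cone ::
  "(int \<Rightarrow> ('a, 'b) module) \<Rightarrow> (int \<Rightarrow> ('a, 'c) module) \<Rightarrow> int \<Rightarrow> ('a, 'b \<times> 'c) module" where
  "cone F G n = dsum (F (n + 1)) (G n)"

definition cone_diff ::
  "(int \<Rightarrow> ('a, 'b) module) \<Rightarrow> (int \<Rightarrow> 'b \<Rightarrow> 'b) \<Rightarrow> (int \<Rightarrow> ('a, 'c) module) \<Rightarrow> (int \<Rightarrow> 'c \<Rightarrow> 'c) \<Rightarrow>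
   (int \<Rightarrow> 'b \<Rightarrow> 'c) \<Rightarrow> int \<Rightarrow> 'b \<times> 'c \<Rightarrow> 'b \<times> 'c" where
  "cone_diff F d G e h n =
     (\<lambda>(x, y). (\<ominus>\<^bsub>F (n + 2)\<^esub> d (n + 1) x, h (n + 1) x \<oplus>\<^bsub>G (n + 1)\<^esub> e n y))"

end

theory Submission
  imports Defs
begin

text \<open>
  Vanishing of the dual cohomology at \<open>0\<close> means that every map from \<open>A\<close> to a projective module factors
  through \<open>\<epsilon> : A \<rightarrow> F\<^sup>1\<close>, so \<open>Ker \<epsilon>\<close> is the set of elements killed by all such maps.  On this set stably
  equal homomorphisms coincide, whence \<open>f\<close> is represented by monomorphisms iff \<open>Ker f \<inter> Ker \<epsilon> = 0\<close>, and
  that intersection, computed on \<open>Coker d\<^sup>-\<^sup>1\<close>, is \<open>H\<^sup>-\<^sup>1\<close> of the cone because \<open>H\<^sup>-\<^sup>1(F\<^sub>B) = 0\<close>.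

  For (1), a stable isomorphism \<open>\<psi> : X \<rightarrow> Y\<close> completes to an isomorphism \<open>X \<oplus> P \<cong> Y \<oplus> K\<close> with \<open>P\<close> and
  \<open>K\<close> projective, and factoring through \<open>\<epsilon>\<close> makes it compatible with the two presentations of the
  pseudo-cokernel.  In (2) one writes \<open>q = t \<epsilon>\<close> and takes \<open>\<alpha> = id\<close>, \<open>\<beta> = id \<oplus> t\<close>.  For (3), adding projectives
  turns \<open>\<alpha>, \<beta>\<close> into split surjections with projective kernels \<open>K\<^sub>1, K\<^sub>2\<close>; perfectness of \<open>\<theta>\<^sub>f\<close> splits
  \<open>K\<^sub>1 \<rightarrow> K\<^sub>2\<close>, so the kernel of \<open>(\<gamma> s)\<close> is projective.  For (4), both \<open>\<epsilon>\<close> and \<open>q\<close> extend along the other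
  sequence, and two shears of \<open>B \<oplus> P' \<oplus> F\<^sup>1\<close> exchange them.
\<close>

section \<open>Homomorphisms and direct sums\<close>

text \<open>A resolution identifies the cokernel of \<open>d (-1)\<close> with A only up to stable
  isomorphism, so without the normalisation there is no map induced by \<open>d 0\<close> on A
  itself. The criterion is therefore expressed by a subset of A defined from A alone: homomorphisms
  preserve it, and stable isomorphisms restrict to mutually inverse bijections on it, so the
  condition travels between A and the cokernel, where the cone is computed. The dual cohomology
  speaks of functionals alone. Finite generation upgrades this to arbitrary projective targets, and
  the resulting extension property lets projectives behave like injectives relative to the maps at
  hand: an error term that factors through a projective is rewritten as a map out of the middle
  module, and a diagram commuting up to projectives is corrected to commute strictly. Projectivity
  is tested against modules of the universe type, and the stable notions quantify over projectives
  of that type; hence the repeated passage to isomorphic copies.\<close>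

lemma (in abelian_group) a_inv_zero: "\<ominus> \<zero> = \<zero>"
  by (simp add: minus_equality)

text \<open>The library sets up the method \<open>algebra\<close> for rings only; this extends it to abelian groups.\<close>

lemmas (in abelian_group) abelian_group_simprules
  [algebra abelian_group "zero G" "add G" "a_inv G" "a_minus G"] =
  a_closed zero_closed a_inv_closed minus_closed a_assoc l_zero l_neg a_comm a_lcomm minus_eq
  r_zero r_neg r_neg2 r_neg1 minus_add minus_minus a_inv_zero

lemma (in abelian_group) minus_zero_right: "x \<in> carrier G \<Longrightarrow> x \<ominus> \<zero> = x"
  by algebra

lemma mod_homI:
  assumes "\<And>x. x \<in> carrier M \<Longrightarrow> h x \<in> carrier N"
    and "\<And>x y. x \<in> carrier M \<Longrightarrow> y \<in> carrier M \<Longrightarrow> h (x \<oplus>\<^bsub>M\<^esub> y) = h x \<oplus>\<^bsub>N\<^esub> h y"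
    and "\<And>r x. r \<in> carrier R \<Longrightarrow> x \<in> carrier M \<Longrightarrow> h (r \<odot>\<^bsub>M\<^esub> x) = r \<odot>\<^bsub>N\<^esub> h x"
  shows "h \<in> mod_hom R M N"
  using assms by (auto simp: mod_hom_def)

lemma mod_hom_closed: "h \<in> mod_hom R M N \<Longrightarrow> x \<in> carrier M \<Longrightarrow> h x \<in> carrier N"
  by (auto simp: mod_hom_def)

lemma mod_hom_add:
  "h \<in> mod_hom R M N \<Longrightarrow> x \<in> carrier M \<Longrightarrow> y \<in> carrier M \<Longrightarrow> h (x \<oplus>\<^bsub>M\<^esub> y) = h x \<oplus>\<^bsub>N\<^esub> h y"
  by (auto simp: mod_hom_def)

lemma mod_hom_smult:
  "h \<in> mod_hom R M N \<Longrightarrow> r \<in> carrier R \<Longrightarrow> x \<in> carrier M \<Longrightarrow> h (r \<odot>\<^bsub>M\<^esub> x) = r \<odot>\<^bsub>N\<^esub> h x"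
  by (auto simp: mod_hom_def)

lemma module_abelian_group: "module R M \<Longrightarrow> abelian_group M"
  by (simp add: module_def)

lemma (in abelian_group) minus_eq_zero_iff:
  "x \<in> carrier G \<Longrightarrow> y \<in> carrier G \<Longrightarrow> x \<ominus> y = \<zero> \<longleftrightarrow> x = y"
  by (metis a_minus_def add.inv_closed add.inv_equality add.inv_inv r_neg)

lemma mod_hom_zero:
  assumes "module R M" "module R N" "h \<in> mod_hom R M N"
  shows "h \<zero>\<^bsub>M\<^esub> = \<zero>\<^bsub>N\<^esub>"
proof -
  interpret M: module R M by fact
  interpret N: module R N by fact
  have "h \<zero>\<^bsub>M\<^esub> \<oplus>\<^bsub>N\<^esub> h \<zero>\<^bsub>M\<^esub> = h \<zero>\<^bsub>M\<^esub>"
    using mod_hom_add[OF assms(3), of "\<zero>\<^bsub>M\<^esub>" "\<zero>\<^bsub>M\<^esub>"] by simp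
  then show ?thesis using mod_hom_closed[OF assms(3), of "\<zero>\<^bsub>M\<^esub>"]
    by (simp add: N.add.r_cancel_one')
qed

lemma mod_hom_a_inv:
  assumes "module R M" "module R N" "h \<in> mod_hom R M N" "x \<in> carrier M"
  shows "h (\<ominus>\<^bsub>M\<^esub> x) = \<ominus>\<^bsub>N\<^esub> h x"
proof -
  interpret M: module R M by fact
  interpret N: module R N by fact
  have "h (\<ominus>\<^bsub>M\<^esub> x) \<oplus>\<^bsub>N\<^esub> h x = \<zero>\<^bsub>N\<^esub>"
    using mod_hom_add[OF assms(3), of "\<ominus>\<^bsub>M\<^esub> x" x] assms
    by (simp add: M.l_neg mod_hom_zero)
  then show ?thesis using mod_hom_closed[OF assms(3)] assms(4)
    by (metis M.M.a_inv_closed N.M.minus_equality)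
qed

lemma mod_hom_minus:
  assumes "module R M" "module R N" "h \<in> mod_hom R M N" "x \<in> carrier M" "y \<in> carrier M"
  shows "h (x \<ominus>\<^bsub>M\<^esub> y) = h x \<ominus>\<^bsub>N\<^esub> h y"
  using assms module_abelian_group[OF assms(1)]
  by (simp add: a_minus_def mod_hom_add mod_hom_a_inv abelian_group.a_inv_closed)

lemma mod_hom_simps:
  assumes "module R M" "module R N" "h \<in> mod_hom R M N"
  shows "x \<in> carrier M \<Longrightarrow> h x \<in> carrier N"
    and "h \<zero>\<^bsub>M\<^esub> = \<zero>\<^bsub>N\<^esub>"
    and "x \<in> carrier M \<Longrightarrow> y \<in> carrier M \<Longrightarrow> h (x \<oplus>\<^bsub>M\<^esub> y) = h x \<oplus>\<^bsub>N\<^esub> h y"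
    and "x \<in> carrier M \<Longrightarrow> h (\<ominus>\<^bsub>M\<^esub> x) = \<ominus>\<^bsub>N\<^esub> h x"
    and "x \<in> carrier M \<Longrightarrow> y \<in> carrier M \<Longrightarrow> h (x \<ominus>\<^bsub>M\<^esub> y) = h x \<ominus>\<^bsub>N\<^esub> h y"
    and "r \<in> carrier R \<Longrightarrow> x \<in> carrier M \<Longrightarrow> h (r \<odot>\<^bsub>M\<^esub> x) = r \<odot>\<^bsub>N\<^esub> h x"
  using assms
  by (simp_all add: mod_hom_closed mod_hom_zero mod_hom_add mod_hom_a_inv mod_hom_minus mod_hom_smult)

lemmas mod_hom_basic = mod_hom_closed mod_hom_add mod_hom_smult

lemma mod_hom_id: "id \<in> mod_hom R M M"
  by (simp add: mod_hom_def)

lemma mod_hom_comp: "g \<in> mod_hom R N L \<Longrightarrow> h \<in> mod_hom R M N \<Longrightarrow> g \<circ> h \<in> mod_hom R M L"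
  by (auto simp: mod_hom_def Pi_iff)

lemma mod_hom_compose: "h \<in> mod_hom R M N \<Longrightarrow> g \<in> mod_hom R N L \<Longrightarrow> (\<lambda>x. g (h x)) \<in> mod_hom R M L"
  by (auto simp: mod_hom_def Pi_iff)

lemma mod_hom_plus:
  assumes "module R N" "g \<in> mod_hom R M N" "h \<in> mod_hom R M N"
  shows "(\<lambda>x. g x \<oplus>\<^bsub>N\<^esub> h x) \<in> mod_hom R M N"
proof -
  interpret N: module R N by fact
  show ?thesis
    by (rule mod_homI) (simp_all add: mod_hom_basic[OF assms(2)] mod_hom_basic[OF assms(3)] N.smult_r_distr N.a_ac)
qed

lemma mod_hom_uminus:
  assumes "module R N" "h \<in> mod_hom R M N"
  shows "(\<lambda>x. \<ominus>\<^bsub>N\<^esub> h x) \<in> mod_hom R M N"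
proof -
  interpret N: module R N by fact
  show ?thesis
    by (rule mod_homI) (simp_all add: mod_hom_basic[OF assms(2)] N.smult_r_minus N.minus_add)
qed

lemma mod_hom_diff:
  assumes "module R N" "g \<in> mod_hom R M N" "h \<in> mod_hom R M N"
  shows "(\<lambda>x. g x \<ominus>\<^bsub>N\<^esub> h x) \<in> mod_hom R M N"
  unfolding a_minus_def by (intro mod_hom_plus mod_hom_uminus assms)

lemma mod_hom_zero_map: "module R N \<Longrightarrow> (\<lambda>x. \<zero>\<^bsub>N\<^esub>) \<in> mod_hom R M N"
proof -
  assume "module R N"
  then interpret N: module R N .
  show ?thesis by (rule mod_homI) auto
qed

lemma carrier_dsum [simp]: "carrier (dsum M N) = carrier M \<times> carrier N"
  and zero_dsum [simp]: "\<zero>\<^bsub>dsum M N\<^esub> = (\<zero>\<^bsub>M\<^esub>, \<zero>\<^bsub>N\<^esub>)"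
  and add_dsum [simp]: "(x, y) \<oplus>\<^bsub>dsum M N\<^esub> (x', y') = (x \<oplus>\<^bsub>M\<^esub> x', y \<oplus>\<^bsub>N\<^esub> y')"
  and smult_dsum [simp]: "r \<odot>\<^bsub>dsum M N\<^esub> (x, y) = (r \<odot>\<^bsub>M\<^esub> x, r \<odot>\<^bsub>N\<^esub> y)"
  by (simp_all add: dsum_def)

lemma module_dsum:
  assumes "module R M" "module R N"
  shows "module R (dsum M N)"
proof -
  interpret M: module R M by fact
  interpret N: module R N by fact
  show ?thesis
  proof (intro moduleI abelian_groupI)
    show "cring R" by (rule M.R.is_cring)
    fix x assume "x \<in> carrier (dsum M N)"
    then show "\<exists>y\<in>carrier (dsum M N). y \<oplus>\<^bsub>dsum M N\<^esub> x = \<zero>\<^bsub>dsum M N\<^esub>"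
      by (intro bexI[of _ "(\<ominus>\<^bsub>M\<^esub> fst x, \<ominus>\<^bsub>N\<^esub> snd x)"]) (auto simp: M.l_neg N.M.l_neg)
  qed (auto simp: M.a_ac N.M.a_ac M.smult_l_distr M.smult_r_distr M.smult_assoc1
      N.smult_l_distr N.smult_r_distr N.smult_assoc1)
qed

lemma a_inv_dsum:
  assumes "module R M" "module R N" "x \<in> carrier M" "y \<in> carrier N"
  shows "\<ominus>\<^bsub>dsum M N\<^esub> (x, y) = (\<ominus>\<^bsub>M\<^esub> x, \<ominus>\<^bsub>N\<^esub> y)"
proof -
  interpret M: module R M by fact
  interpret N: module R N by fact
  interpret D: module R "dsum M N" by (rule module_dsum[OF assms(1,2)])
  show ?thesis
    using assms by (intro D.minus_equality) (auto simp: M.l_neg N.M.l_neg)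
qed

lemma minus_dsum:
  assumes "module R M" "module R N" "x \<in> carrier M" "y \<in> carrier N" "x' \<in> carrier M" "y' \<in> carrier N"
  shows "(x, y) \<ominus>\<^bsub>dsum M N\<^esub> (x', y') = (x \<ominus>\<^bsub>M\<^esub> x', y \<ominus>\<^bsub>N\<^esub> y')"
  using assms by (simp add: a_minus_def a_inv_dsum[OF assms(1,2)])

lemma mod_hom_fst: "fst \<in> mod_hom R (dsum M N) M"
  and mod_hom_snd: "snd \<in> mod_hom R (dsum M N) N"
  by (auto simp: mod_hom_def)

lemma mod_hom_Pair:
  "g \<in> mod_hom R L M \<Longrightarrow> h \<in> mod_hom R L N \<Longrightarrow> (\<lambda>x. (g x, h x)) \<in> mod_hom R L (dsum M N)"
  by (auto simp: mod_hom_def)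

lemma mod_hom_Pair_zero: "module R N \<Longrightarrow> (\<lambda>x. (x, \<zero>\<^bsub>N\<^esub>)) \<in> mod_hom R M (dsum M N)"
  by (intro mod_hom_Pair mod_hom_zero_map mod_hom_id[unfolded id_def])

lemma mod_hom_zero_Pair: "module R M \<Longrightarrow> (\<lambda>y. (\<zero>\<^bsub>M\<^esub>, y)) \<in> mod_hom R N (dsum M N)"
  by (intro mod_hom_Pair mod_hom_zero_map mod_hom_id[unfolded id_def])

lemma mod_hom_col_map:
  "g \<in> mod_hom R L M \<Longrightarrow> h \<in> mod_hom R L N \<Longrightarrow> col_map g h \<in> mod_hom R L (dsum M N)"
  unfolding col_map_def by (rule mod_hom_Pair)

lemma mod_hom_row_map:
  assumes "module R L" "g \<in> mod_hom R M L" "h \<in> mod_hom R N L"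
  shows "row_map L g h \<in> mod_hom R (dsum M N) L"
proof -
  have "(\<lambda>x. g (fst x) \<oplus>\<^bsub>L\<^esub> h (snd x)) \<in> mod_hom R (dsum M N) L"
    by (intro mod_hom_plus assms mod_hom_compose[OF mod_hom_fst] mod_hom_compose[OF mod_hom_snd])
  then show ?thesis by (simp add: row_map_def case_prod_beta')
qed

lemma mod_hom_cong:
  assumes "g \<in> mod_hom R M N" "module R M" "\<And>x. x \<in> carrier M \<Longrightarrow> h x = g x"
  shows "h \<in> mod_hom R M N"
proof -
  interpret M: module R M by fact
  show ?thesis using assms by (auto simp: mod_hom_def)
qed

lemma submodule_kernel:
  assumes "module R M" "module R N" "h \<in> mod_hom R M N"
  shows "submodule (a_kernel M N h) R M"
proof -
  interpret M: module R M by fact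
  interpret N: module R N by fact
  show ?thesis
    by (rule M.submoduleI)
      (auto simp: a_kernel_def' mod_hom_simps[OF assms])
qed

lemma submodule_image:
  assumes "module R M" "module R N" "h \<in> mod_hom R M N"
  shows "submodule (h ` carrier M) R N"
proof -
  interpret M: module R M by fact
  interpret N: module R N by fact
  show ?thesis
  proof (rule N.submoduleI)
    show "\<zero>\<^bsub>N\<^esub> \<in> h ` carrier M"
      by (rule image_eqI[of _ _ "\<zero>\<^bsub>M\<^esub>"]) (simp_all add: mod_hom_zero[OF assms])
  next
    fix a assume "a \<in> h ` carrier M"
    then obtain x where "x \<in> carrier M" "a = h x" by blast
    then show "\<ominus>\<^bsub>N\<^esub> a \<in> h ` carrier M"
      by (intro image_eqI[of _ _ "\<ominus>\<^bsub>M\<^esub> x"]) (simp_all add: mod_hom_a_inv[OF assms])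
  next
    fix a b assume "a \<in> h ` carrier M" "b \<in> h ` carrier M"
    then obtain x y where "x \<in> carrier M" "a = h x" "y \<in> carrier M" "b = h y" by blast
    then show "a \<oplus>\<^bsub>N\<^esub> b \<in> h ` carrier M"
      by (intro image_eqI[of _ _ "x \<oplus>\<^bsub>M\<^esub> y"]) (simp_all add: mod_hom_add[OF assms(3)])
  next
    fix r a assume "r \<in> carrier R" "a \<in> h ` carrier M"
    then obtain x where "x \<in> carrier M" "a = h x" by blast
    with \<open>r \<in> carrier R\<close> show "r \<odot>\<^bsub>N\<^esub> a \<in> h ` carrier M"
      by (intro image_eqI[of _ _ "r \<odot>\<^bsub>M\<^esub> x"]) (simp_all add: mod_hom_smult[OF assms(3)])
  qed (auto simp: mod_hom_closed[OF assms(3)])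
qed

text \<open>Preimages under \<open>p\<close> are chosen arbitrarily; two choices differ by an
  element of the kernel of \<open>p\<close>, which \<open>g\<close> kills. This is the source of
  induced maps out of cokernels and of inverses of bijective homomorphisms.\<close>

lemma mod_hom_factor_surj:
  assumes "module R B" "module R C" "module R X"
    and p: "p \<in> mod_hom R B C" "p ` carrier B = carrier C"
    and g: "g \<in> mod_hom R B X" "\<And>x. x \<in> carrier B \<Longrightarrow> p x = \<zero>\<^bsub>C\<^esub> \<Longrightarrow> g x = \<zero>\<^bsub>X\<^esub>"
  obtains \<gamma> where "\<gamma> \<in> mod_hom R C X" "\<And>x. x \<in> carrier B \<Longrightarrow> \<gamma> (p x) = g x"
proof -
  interpret B: module R B by fact
  interpret C: module R C by fact
  interpret X: module R X by fact
  note gs = mod_hom_simps[OF assms(1,3) g(1)] and ps = mod_hom_simps[OF assms(1,2) p(1)]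
  define \<gamma> where "\<gamma> c = g (inv_into (carrier B) p c)" for c
  have eq: "\<gamma> (p x) = g x" if x: "x \<in> carrier B" for x
  proof -
    let ?y = "inv_into (carrier B) p (p x)"
    have y: "?y \<in> carrier B" "p ?y = p x" using x by (simp_all add: inv_into_into f_inv_into_f)
    then have "p (?y \<ominus>\<^bsub>B\<^esub> x) = \<zero>\<^bsub>C\<^esub>"
      using x by (simp add: ps a_minus_def C.M.r_neg)
    then have "g ?y \<ominus>\<^bsub>X\<^esub> g x = \<zero>\<^bsub>X\<^esub>" using g(2)[of "?y \<ominus>\<^bsub>B\<^esub> x"] x y by (simp add: gs)
    then show ?thesis using x y by (simp add: \<gamma>_def gs X.M.minus_eq_zero_iff)
  qed
  have "\<gamma> \<in> mod_hom R C X"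
  proof (rule mod_homI)
    fix c assume "c \<in> carrier C"
    then obtain x where "x \<in> carrier B" "c = p x" using p(2) by auto
    then show "\<gamma> c \<in> carrier X" by (simp add: eq gs)
  next
    fix c d assume "c \<in> carrier C" "d \<in> carrier C"
    then obtain x y where "x \<in> carrier B" "c = p x" "y \<in> carrier B" "d = p y"
      unfolding p(2)[symmetric] by blast
    then show "\<gamma> (c \<oplus>\<^bsub>C\<^esub> d) = \<gamma> c \<oplus>\<^bsub>X\<^esub> \<gamma> d"
      using eq[of "x \<oplus>\<^bsub>B\<^esub> y"] by (simp add: eq gs ps)
  next
    fix r c assume "r \<in> carrier R" "c \<in> carrier C"
    then obtain x where "x \<in> carrier B" "c = p x" using p(2) by auto
    then show "\<gamma> (r \<odot>\<^bsub>C\<^esub> c) = r \<odot>\<^bsub>X\<^esub> \<gamma> c" 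
      using \<open>r \<in> carrier R\<close> eq[of "r \<odot>\<^bsub>B\<^esub> x"] by (simp add: eq gs ps)
  qed
  then show thesis using eq by (rule that)
qed


section \<open>Finitely generated and projective modules\<close>

lemma mod_isoI:
  assumes "h \<in> mod_hom R M N" "k \<in> mod_hom R N M"
    and "\<And>x. x \<in> carrier M \<Longrightarrow> k (h x) = x" "\<And>y. y \<in> carrier N \<Longrightarrow> h (k y) = y"
  shows "h \<in> mod_iso R M N"
  using assms mod_hom_closed[OF assms(1)] mod_hom_closed[OF assms(2)]
  by (auto simp: mod_iso_def intro!: bij_betw_byWitness[where f' = k])

text \<open>The inverse is the factorisation of the identity through \<open>h\<close>, which is
  surjective with trivial kernel; its linearity then comes for free.\<close>

lemma mod_isoE:
  assumes "h \<in> mod_iso R M N" "module R M" "module R N"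
  obtains k where "h \<in> mod_hom R M N" "k \<in> mod_hom R N M" "\<And>x. x \<in> carrier M \<Longrightarrow> k (h x) = x"
    "\<And>y. y \<in> carrier N \<Longrightarrow> h (k y) = y"
proof -
  interpret M: module R M by fact
  interpret N: module R N by fact
  have h: "h \<in> mod_hom R M N" "h ` carrier M = carrier N" and inj: "inj_on h (carrier M)"
    using assms(1) by (auto simp: mod_iso_def bij_betw_def)
  have "id x = \<zero>\<^bsub>M\<^esub>" if x: "x \<in> carrier M" "h x = \<zero>\<^bsub>N\<^esub>" for x
    using inj_onD[OF inj, of x "\<zero>\<^bsub>M\<^esub>"] x by (simp add: mod_hom_zero[OF assms(2,3) h(1)])
  then obtain k where k: "k \<in> mod_hom R N M" "\<And>x. x \<in> carrier M \<Longrightarrow> k (h x) = id x"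
    using mod_hom_factor_surj[OF assms(2,3,2) h mod_hom_id] by blast
  show thesis
  proof (rule that[OF h(1) k(1)])
    fix y assume "y \<in> carrier N"
    then obtain x where "x \<in> carrier M" "y = h x" using h(2) by auto
    then show "h (k y) = y" using k(2) by simp
  qed (simp add: k(2))
qed

lemma submodule_zero: "submodule K R M \<Longrightarrow> \<zero>\<^bsub>M\<^esub> \<in> K"
  by (metis submodule.axioms(1) subgroup.one_closed monoid.simps(2))

lemma fg_moduleD: "fg_module R M \<Longrightarrow> module R M"
  by (simp add: fg_module_def)

text \<open>The linear combinations of \<open>S\<close> form a submodule containing
  \<open>S\<close>, so minimality forces them to exhaust \<open>M\<close>. In terms of submodules,
  finite generation passes to images and sums by taking preimages, without manipulating
  coefficients.\<close>

lemma fg_moduleI: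
  assumes "module R M" "finite S" "S \<subseteq> carrier M"
    and min: "\<And>K. submodule K R M \<Longrightarrow> S \<subseteq> K \<Longrightarrow> carrier M \<subseteq> K"
  shows "fg_module R M"
proof -
  interpret M: module R M by fact
  define K where "K = {x. \<exists>c\<in>S \<rightarrow> carrier R. x = (\<Oplus>\<^bsub>M\<^esub>s\<in>S. c s \<odot>\<^bsub>M\<^esub> s)}"
  have cl: "(\<lambda>s. c s \<odot>\<^bsub>M\<^esub> s) \<in> S \<rightarrow> carrier M" if "c \<in> S \<rightarrow> carrier R" for c
    using that assms(3) by (auto simp: Pi_iff)
  have "submodule K R M"
  proof (rule M.submoduleI)
    show "K \<subseteq> carrier M" unfolding K_def using M.M.finsum_closed[OF cl] by blast
    have "(\<Oplus>\<^bsub>M\<^esub>s\<in>S. \<zero>\<^bsub>R\<^esub> \<odot>\<^bsub>M\<^esub> s) = (\<Oplus>\<^bsub>M\<^esub>s\<in>S. \<zero>\<^bsub>M\<^esub>)"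
      using assms(3) by (intro M.M.finsum_cong') auto
    then show "\<zero>\<^bsub>M\<^esub> \<in> K" unfolding K_def
      by (intro CollectI bexI[of _ "\<lambda>_. \<zero>\<^bsub>R\<^esub>"]) (simp_all add: M.M.finsum_zero)
  next
    fix a b assume "a \<in> K" "b \<in> K"
    then obtain c d where c: "c \<in> S \<rightarrow> carrier R" "a = (\<Oplus>\<^bsub>M\<^esub>s\<in>S. c s \<odot>\<^bsub>M\<^esub> s)"
      and d: "d \<in> S \<rightarrow> carrier R" "b = (\<Oplus>\<^bsub>M\<^esub>s\<in>S. d s \<odot>\<^bsub>M\<^esub> s)" unfolding K_def by blast
    have "a \<oplus>\<^bsub>M\<^esub> b = (\<Oplus>\<^bsub>M\<^esub>s\<in>S. c s \<odot>\<^bsub>M\<^esub> s \<oplus>\<^bsub>M\<^esub> d s \<odot>\<^bsub>M\<^esub> s)"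
      using M.M.finsum_addf[OF cl[OF c(1)] cl[OF d(1)]] c d by simp
    also have "\<dots> = (\<Oplus>\<^bsub>M\<^esub>s\<in>S. (c s \<oplus>\<^bsub>R\<^esub> d s) \<odot>\<^bsub>M\<^esub> s)"
      using c d assms(3) by (intro M.M.finsum_cong') (auto simp: Pi_iff M.smult_l_distr subset_iff)
    finally show "a \<oplus>\<^bsub>M\<^esub> b \<in> K" unfolding K_def using c(1) d(1)
      by (intro CollectI bexI[of _ "\<lambda>s. c s \<oplus>\<^bsub>R\<^esub> d s"]) auto
  next
    fix r a assume r: "r \<in> carrier R" and "a \<in> K"
    then obtain c where c: "c \<in> S \<rightarrow> carrier R" "a = (\<Oplus>\<^bsub>M\<^esub>s\<in>S. c s \<odot>\<^bsub>M\<^esub> s)" unfolding K_def by blast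
    have "r \<odot>\<^bsub>M\<^esub> a = (\<Oplus>\<^bsub>M\<^esub>s\<in>S. r \<odot>\<^bsub>M\<^esub> (c s \<odot>\<^bsub>M\<^esub> s))"
      using M.finsum_smult_ldistr[OF assms(2) r cl[OF c(1)]] c by simp
    also have "\<dots> = (\<Oplus>\<^bsub>M\<^esub>s\<in>S. (r \<otimes>\<^bsub>R\<^esub> c s) \<odot>\<^bsub>M\<^esub> s)"
      using c r assms(3) by (intro M.M.finsum_cong') (auto simp: Pi_iff M.smult_assoc1 subset_iff)
    finally show rK: "r \<odot>\<^bsub>M\<^esub> a \<in> K" unfolding K_def using c(1) r
      by (intro CollectI bexI[of _ "\<lambda>s. r \<otimes>\<^bsub>R\<^esub> c s"]) auto
  next
    fix a assume "a \<in> K"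
    then obtain c where c: "c \<in> S \<rightarrow> carrier R" "a = (\<Oplus>\<^bsub>M\<^esub>s\<in>S. c s \<odot>\<^bsub>M\<^esub> s)" unfolding K_def by blast
    then have a: "a \<in> carrier M" using M.M.finsum_closed[OF cl] by simp
    have "\<ominus>\<^bsub>M\<^esub> a = (\<ominus>\<^bsub>R\<^esub> \<one>\<^bsub>R\<^esub>) \<odot>\<^bsub>M\<^esub> a" using a by (simp add: M.smult_l_minus)
    also have "\<dots> = (\<Oplus>\<^bsub>M\<^esub>s\<in>S. (\<ominus>\<^bsub>R\<^esub> \<one>\<^bsub>R\<^esub>) \<odot>\<^bsub>M\<^esub> (c s \<odot>\<^bsub>M\<^esub> s))"
      using M.finsum_smult_ldistr[OF assms(2) _ cl[OF c(1)]] c by simp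
    also have "\<dots> = (\<Oplus>\<^bsub>M\<^esub>s\<in>S. (\<ominus>\<^bsub>R\<^esub> c s) \<odot>\<^bsub>M\<^esub> s)"
      using c assms(3) by (intro M.M.finsum_cong')
        (auto simp: Pi_iff subset_iff M.smult_l_minus)
    finally show "\<ominus>\<^bsub>M\<^esub> a \<in> K" unfolding K_def using c(1)
      by (intro CollectI bexI[of _ "\<lambda>s. \<ominus>\<^bsub>R\<^esub> c s"]) auto
  qed
  moreover have "S \<subseteq> K"
  proof
    fix t assume t: "t \<in> S"
    have "(\<Oplus>\<^bsub>M\<^esub>s\<in>S. (if t = s then \<one>\<^bsub>R\<^esub> else \<zero>\<^bsub>R\<^esub>) \<odot>\<^bsub>M\<^esub> s) = (\<Oplus>\<^bsub>M\<^esub>s\<in>S. if t = s then s else \<zero>\<^bsub>M\<^esub>)"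
      using assms(3) by (intro M.M.finsum_cong') auto
    also have "\<dots> = t" using t assms(2,3) by (intro M.M.finsum_singleton) auto
    finally show "t \<in> K" unfolding K_def
      by (intro CollectI bexI[of _ "\<lambda>s. if t = s then \<one>\<^bsub>R\<^esub> else \<zero>\<^bsub>R\<^esub>"]) auto
  qed
  ultimately have "carrier M \<subseteq> K" by (rule min)
  then show ?thesis unfolding fg_module_def K_def using assms(1-3) by blast
qed

lemma fg_moduleE:
  assumes "fg_module R M"
  obtains S where "finite S" "S \<subseteq> carrier M"
    "\<And>K. submodule K R M \<Longrightarrow> S \<subseteq> K \<Longrightarrow> carrier M \<subseteq> K"
proof -
  interpret M: module R M using assms by (rule fg_moduleD)
  obtain S where S: "finite S" "S \<subseteq> carrier M"
    and gen: "\<And>x. x \<in> carrier M \<Longrightarrow> \<exists>c\<in>S \<rightarrow> carrier R. x = (\<Oplus>\<^bsub>M\<^esub>s\<in>S. c s \<odot>\<^bsub>M\<^esub> s)"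
    using assms by (auto simp: fg_module_def)
  show thesis
  proof (rule that[OF S])
    fix K assume K: "submodule K R M" "S \<subseteq> K"
    note KE = M.submoduleE[OF K(1)]
    have z: "\<zero>\<^bsub>M\<^esub> \<in> K" by (rule submodule_zero[OF K(1)])
    have *: "(\<Oplus>\<^bsub>M\<^esub>s\<in>T. c s \<odot>\<^bsub>M\<^esub> s) \<in> K" if "finite T" "T \<subseteq> S" "c \<in> S \<rightarrow> carrier R" for T c
      using that
    proof (induct T)
      case empty
      then show ?case using z by simp
    next
      case (insert t T)
      then have "(\<lambda>s. c s \<odot>\<^bsub>M\<^esub> s) \<in> T \<rightarrow> carrier M" "c t \<in> carrier R" "t \<in> carrier M" "t \<in> K"
        using K(2) S(2) by (auto simp: Pi_iff subset_iff)
      with insert show ?case by (simp add: KE)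
    qed
    show "carrier M \<subseteq> K" using gen *[OF S(1) order_refl] by fastforce
  qed
qed

lemma submodule_preimage:
  assumes "module R M" "module R N" "h \<in> mod_hom R M N" "submodule K R N"
  shows "submodule {x \<in> carrier M. h x \<in> K} R M"
proof -
  interpret M: module R M by fact
  interpret N: module R N by fact
  have z: "\<zero>\<^bsub>N\<^esub> \<in> K" by (rule submodule_zero[OF assms(4)])
  show ?thesis
    by (rule M.submoduleI)
      (auto simp: mod_hom_simps[OF assms(1-3)] N.submoduleE[OF assms(4)] z)
qed

text \<open>The preimage of a submodule containing the images of the generators contains the
  generators, hence is all of \<open>M\<close>.\<close>

lemma fg_module_surj:
  assumes "fg_module R M" "module R N" "h \<in> mod_hom R M N" "carrier N \<subseteq> h ` carrier M"
  shows "fg_module R N"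
proof -
  have M: "module R M" using assms(1) by (rule fg_moduleD)
  obtain S where S: "finite S" "S \<subseteq> carrier M"
    and gen: "\<And>K. submodule K R M \<Longrightarrow> S \<subseteq> K \<Longrightarrow> carrier M \<subseteq> K"
    using fg_moduleE[OF assms(1)] by metis
  show ?thesis
  proof (rule fg_moduleI[of _ _ "h ` S"])
    fix K assume K: "submodule K R N" "h ` S \<subseteq> K"
    have "carrier M \<subseteq> {x \<in> carrier M. h x \<in> K}"
      using K S(2) by (intro gen submodule_preimage[OF M assms(2,3)]) auto
    then show "carrier N \<subseteq> K" using assms(4) by blast
  qed (use S assms(2) mod_hom_closed[OF assms(3)] in auto)
qed

lemma fg_module_dsum:
  assumes "fg_module R M" "fg_module R N"
  shows "fg_module R (dsum M N)"
proof -
  have M: "module R M" and N: "module R N" using assms by (simp_all add: fg_moduleD)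
  interpret M: module R M by fact
  interpret N: module R N by fact
  interpret D: module R "dsum M N" by (rule module_dsum[OF M N])
  obtain S where S: "finite S" "S \<subseteq> carrier M"
    and gen: "\<And>K. submodule K R M \<Longrightarrow> S \<subseteq> K \<Longrightarrow> carrier M \<subseteq> K"
    using fg_moduleE[OF assms(1)] by metis
  obtain T where T: "finite T" "T \<subseteq> carrier N"
    and gen': "\<And>K. submodule K R N \<Longrightarrow> T \<subseteq> K \<Longrightarrow> carrier N \<subseteq> K"
    using fg_moduleE[OF assms(2)] by metis
  show ?thesis
  proof (rule fg_moduleI[of _ _ "(\<lambda>x. (x, \<zero>\<^bsub>N\<^esub>)) ` S \<union> (\<lambda>y. (\<zero>\<^bsub>M\<^esub>, y)) ` T"])
    fix K assume K: "submodule K R (dsum M N)"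
      "(\<lambda>x. (x, \<zero>\<^bsub>N\<^esub>)) ` S \<union> (\<lambda>y. (\<zero>\<^bsub>M\<^esub>, y)) ` T \<subseteq> K"
    have a: "carrier M \<subseteq> {x \<in> carrier M. (x, \<zero>\<^bsub>N\<^esub>) \<in> K}"
      using K S(2)
      by (intro gen submodule_preimage[OF M module_dsum[OF M N] mod_hom_Pair_zero[OF N]]) auto
    have b: "carrier N \<subseteq> {y \<in> carrier N. (\<zero>\<^bsub>M\<^esub>, y) \<in> K}"
      using K T(2)
      by (intro gen' submodule_preimage[OF N module_dsum[OF M N] mod_hom_zero_Pair[OF M]]) auto
    show "carrier (dsum M N) \<subseteq> K"
    proof
      fix z assume "z \<in> carrier (dsum M N)"
      then obtain x y where z: "z = (x, y)" "x \<in> carrier M" "y \<in> carrier N" by auto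
      then have "(x, \<zero>\<^bsub>N\<^esub>) \<oplus>\<^bsub>dsum M N\<^esub> (\<zero>\<^bsub>M\<^esub>, y) \<in> K" using a b D.submoduleE(5)[OF K(1)] by blast
      then show "z \<in> K" using z by simp
    qed
  qed (use S T module_dsum[OF M N] in auto)
qed

text \<open>This is the record that occurs inside \<open>dual\<close>. Naming it makes elements of
  the dual homomorphisms into \<open>self_module R\<close>, so that the general facts on
  homomorphisms apply to functionals.\<close>

definition self_module :: "('a, 'm) ring_scheme \<Rightarrow> ('a, 'a) module" where
  "self_module R = \<lparr>carrier = carrier R, mult = mult R, one = \<one>\<^bsub>R\<^esub>, zero = \<zero>\<^bsub>R\<^esub>,
                    add = add R, smult = mult R\<rparr>"

lemma self_module_simps [simp]:
  "carrier (self_module R) = carrier R" "\<zero>\<^bsub>self_module R\<^esub> = \<zero>\<^bsub>R\<^esub>"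
  "x \<oplus>\<^bsub>self_module R\<^esub> y = x \<oplus>\<^bsub>R\<^esub> y" "r \<odot>\<^bsub>self_module R\<^esub> x = r \<otimes>\<^bsub>R\<^esub> x"
  by (simp_all add: self_module_def)

lemma module_self_module:
  assumes "cring R"
  shows "module R (self_module R)"
proof -
  interpret cring R by fact
  show ?thesis
  proof (intro moduleI abelian_groupI)
    fix x assume "x \<in> carrier (self_module R)"
    then show "\<exists>y\<in>carrier (self_module R). y \<oplus>\<^bsub>self_module R\<^esub> x = \<zero>\<^bsub>self_module R\<^esub>"
      by (intro bexI[of _ "\<ominus>\<^bsub>R\<^esub> x"]) (auto simp: l_neg)
  qed (auto simp: is_cring a_ac m_ac l_distr r_distr)
qed

lemma fg_module_self_module:
  assumes "cring R"
  shows "fg_module R (self_module R)"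
proof -
  interpret cring R by fact
  interpret S: module R "self_module R" by (rule module_self_module[OF assms])
  show ?thesis
  proof (rule fg_moduleI[of _ _ "{\<one>\<^bsub>R\<^esub>}"])
    fix K assume K: "submodule K R (self_module R)" "{\<one>\<^bsub>R\<^esub>} \<subseteq> K"
    then show "carrier (self_module R) \<subseteq> K"
      using S.submoduleE(4)[OF K(1), of _ "\<one>\<^bsub>R\<^esub>"] by auto
  qed (auto intro: module_self_module assms)
qed

lemma fg_module_zero_module:
  assumes "module R M" "zero_module M"
  shows "fg_module R M"
proof -
  have "carrier M = {\<zero>\<^bsub>M\<^esub>}" using assms(2) unfolding zero_module_def .
  then have "finite (carrier M)" by (metis finite.emptyI finite_insert)
  then show ?thesis by (intro fg_moduleI[of _ _ "carrier M"] assms order_refl)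
qed

text \<open>Stable equality and trivial sequences ask for projectives of the universe type even when
  nothing has to be factored; this module is the witness then.\<close>

definition zero_umod :: "'a umod" where
  "zero_umod = \<lparr>carrier = {{}}, mult = undefined, one = undefined, zero = {},
                add = (\<lambda>_ _. {}), smult = (\<lambda>_ _. {})\<rparr>"

lemma zero_umod_simps [simp]:
  "carrier zero_umod = {{}}" "\<zero>\<^bsub>zero_umod\<^esub> = {}"
  "X \<oplus>\<^bsub>zero_umod\<^esub> Y = {}" "r \<odot>\<^bsub>zero_umod\<^esub> X = {}"
  by (simp_all add: zero_umod_def)

lemma zero_module_zero_umod: "zero_module zero_umod"
  by (simp add: zero_module_def)

lemma module_zero_umod: "cring R \<Longrightarrow> module R zero_umod"
  by (intro moduleI abelian_groupI) auto

section \<open>Projective modules: retracts, sums and copies in the universe type\<close>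

lemma projective_fg: "projective R P \<Longrightarrow> fg_module R P"
  by (simp add: projective_def)

lemma projective_module: "projective R P \<Longrightarrow> module R P"
  by (simp add: projective_def fg_moduleD)

lemma projectiveE:
  fixes M N :: "'a umod" and R :: "('a, 'm) ring_scheme"
  assumes "projective R P" "fg_module R M" "fg_module R N" "g \<in> mod_hom R M N"
    "g ` carrier M = carrier N" "h \<in> mod_hom R P N"
  obtains k where "k \<in> mod_hom R P M" "\<And>x. x \<in> carrier P \<Longrightarrow> g (k x) = h x"
proof -
  have "\<exists>k\<in>mod_hom R P M. \<forall>x\<in>carrier P. g (k x) = h x"
    using assms(1) unfolding projective_def by (elim conjE allE[of _ M] allE[of _ N] allE[of _ g] allE[of _ h] impE) (intro conjI assms)
  then show thesis using that by blast
qed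

text \<open>A lifting problem for \<open>K\<close> is pulled back along \<open>r\<close> to
  \<open>P\<close>; its solution there is restricted along \<open>i\<close>.\<close>

lemma projective_retract:
  fixes R :: "('a, 'm) ring_scheme"
  assumes P: "projective R P" and "module R K" and i: "i \<in> mod_hom R K P" and r: "r \<in> mod_hom R P K"
    and ri: "\<And>x. x \<in> carrier K \<Longrightarrow> r (i x) = x"
  shows "projective R K"
  unfolding projective_def
proof (intro conjI allI impI)
  have "carrier K \<subseteq> r ` carrier P"
    using ri mod_hom_closed[OF i] by (metis image_eqI subsetI)
  then show "fg_module R K" using fg_module_surj[OF projective_fg[OF P] assms(2) r] by simp
  fix M N :: "'a umod" and g h
  assume *: "fg_module R M \<and> fg_module R N \<and>
       g \<in> mod_hom R M N \<and> g ` carrier M = carrier N \<and> h \<in> mod_hom R K N"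
  then obtain k where k: "k \<in> mod_hom R P M" "\<And>x. x \<in> carrier P \<Longrightarrow> g (k x) = h (r x)"
    using projectiveE[OF P, of M N g "\<lambda>x. h (r x)"] mod_hom_compose[OF r] by metis
  show "\<exists>k\<in>mod_hom R K M. \<forall>x\<in>carrier K. g (k x) = h x"
    using k(2) mod_hom_closed[OF i] ri by (intro bexI[OF _ mod_hom_compose[OF i k(1)]]) auto
qed

lemma projective_dsum:
  fixes R :: "('a, 'm) ring_scheme"
  assumes P: "projective R P" and Q: "projective R Q"
  shows "projective R (dsum P Q)"
  unfolding projective_def
proof (intro conjI allI impI)
  show "fg_module R (dsum P Q)" using assms by (simp add: fg_module_dsum projective_fg)
  have mP: "module R P" and mQ: "module R Q" using assms by (simp_all add: projective_module)
  interpret P: module R P by fact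
  interpret Q: module R Q by fact
  fix M N :: "'a umod" and g h
  assume *: "fg_module R M \<and> fg_module R N \<and>
       g \<in> mod_hom R M N \<and> g ` carrier M = carrier N \<and> h \<in> mod_hom R (dsum P Q) N"
  then have g: "g \<in> mod_hom R M N" and h: "h \<in> mod_hom R (dsum P Q) N"
    and mM: "module R M" and mN: "module R N" by (simp_all add: fg_moduleD)
  obtain k where k: "k \<in> mod_hom R P M" "\<And>x. x \<in> carrier P \<Longrightarrow> g (k x) = h (x, \<zero>\<^bsub>Q\<^esub>)"
    using projectiveE[OF P, of M N g "\<lambda>x. h (x, \<zero>\<^bsub>Q\<^esub>)"] * mod_hom_compose[OF mod_hom_Pair_zero[OF mQ] h]
    by metis
  obtain l where l: "l \<in> mod_hom R Q M" "\<And>x. x \<in> carrier Q \<Longrightarrow> g (l x) = h (\<zero>\<^bsub>P\<^esub>, x)"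
    using projectiveE[OF Q, of M N g "\<lambda>x. h (\<zero>\<^bsub>P\<^esub>, x)"] * mod_hom_compose[OF mod_hom_zero_Pair[OF mP] h]
    by metis
  have "g (row_map M k l z) = h z" if "z \<in> carrier (dsum P Q)" for z
  proof -
    from that obtain x y where z: "z = (x, y)" "x \<in> carrier P" "y \<in> carrier Q" by auto
    then have "g (row_map M k l z) = h (x, \<zero>\<^bsub>Q\<^esub>) \<oplus>\<^bsub>N\<^esub> h (\<zero>\<^bsub>P\<^esub>, y)"
      by (simp add: row_map_def mod_hom_add[OF g] mod_hom_closed[OF k(1)] mod_hom_closed[OF l(1)] k l)
    also have "\<dots> = h ((x, \<zero>\<^bsub>Q\<^esub>) \<oplus>\<^bsub>dsum P Q\<^esub> (\<zero>\<^bsub>P\<^esub>, y))"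
      using z by (intro mod_hom_add[OF h, symmetric]) auto
    finally show ?thesis using z by simp
  qed
  then show "\<exists>k\<in>mod_hom R (dsum P Q) M. \<forall>x\<in>carrier (dsum P Q). g (k x) = h x"
    using mod_hom_row_map[OF mM k(1) l(1)] by blast
qed

lemma projective_zero_umod: "cring R \<Longrightarrow> projective R (zero_umod :: 'a umod)"
  for R :: "('a, 'm) ring_scheme"
  unfolding projective_def
proof (intro conjI allI impI)
  assume R: "cring R"
  show "fg_module R (zero_umod :: 'a umod)"
    by (rule fg_module_zero_module[OF module_zero_umod[OF R] zero_module_zero_umod])
  fix M N :: "'a umod" and g h
  assume *: "fg_module R M \<and> fg_module R N \<and>
       g \<in> mod_hom R M N \<and> g ` carrier M = carrier N \<and> h \<in> mod_hom R (zero_umod :: 'a umod) N"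
  then have mM: "module R M" and mN: "module R N" by (simp_all add: fg_moduleD)
  have "h {} = \<zero>\<^bsub>N\<^esub>" using mod_hom_zero[OF module_zero_umod[OF R] mN] * by auto
  then show "\<exists>k\<in>mod_hom R zero_umod M. \<forall>x\<in>carrier zero_umod. g (k x) = h x"
    using * by (intro bexI[OF _ mod_hom_zero_map[OF mM]]) (simp add: mod_hom_zero[OF mM mN])
qed

lemma fg_module_umodE:
  fixes R :: "('a, 'm) ring_scheme"
  assumes "fg_module R M"
  obtains N :: "'a umod" and h k where "fg_module R N" "h \<in> mod_hom R M N" "k \<in> mod_hom R N M"
    "\<And>x. x \<in> carrier M \<Longrightarrow> k (h x) = x" "\<And>y. y \<in> carrier N \<Longrightarrow> h (k y) = y"
proof -
  obtain N :: "'a umod" and h where N: "fg_module R N" and h: "h \<in> mod_iso R M N"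
    using fg_module_universe[OF assms] by blast
  obtain k where "h \<in> mod_hom R M N" "k \<in> mod_hom R N M"
    "\<And>x. x \<in> carrier M \<Longrightarrow> k (h x) = x" "\<And>y. y \<in> carrier N \<Longrightarrow> h (k y) = y"
    using mod_isoE[OF h fg_moduleD[OF assms] fg_moduleD[OF N]] by metis
  then show thesis by (rule that[OF N])
qed

text \<open>Lets projectives of any element type, such as sums and kernels, serve where a definition
  quantifies over \<open>'a umod\<close>. The copy is projective because it is a retract of
  \<open>P\<close>.\<close>

lemma projective_umodE:
  fixes R :: "('a, 'm) ring_scheme"
  assumes "projective R P"
  obtains Q :: "'a umod" and h k where "projective R Q" "h \<in> mod_hom R P Q" "k \<in> mod_hom R Q P"
    "\<And>x. x \<in> carrier P \<Longrightarrow> k (h x) = x" "\<And>y. y \<in> carrier Q \<Longrightarrow> h (k y) = y"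
proof -
  obtain Q :: "'a umod" and h k where Q: "fg_module R Q" "h \<in> mod_hom R P Q" "k \<in> mod_hom R Q P"
    "\<And>x. x \<in> carrier P \<Longrightarrow> k (h x) = x" "\<And>y. y \<in> carrier Q \<Longrightarrow> h (k y) = y"
    using fg_module_umodE[OF projective_fg[OF assms]] by metis
  have "projective R Q" by (rule projective_retract[OF assms fg_moduleD[OF Q(1)] Q(3,2,5)])
  then show thesis using Q(2-) by (rule that)
qed

text \<open>The identity of \<open>P\<close> cannot be lifted directly, since lifting is granted
  only for targets in the universe type. The map lifted instead is the isomorphism \<open>h\<close>
  onto a copy \<open>Q\<close>, through \<open>h \<circ> g\<close>; afterwards \<open>h\<close> is
  cancelled.\<close>

lemma projective_split:
  fixes M :: "'a umod" and R :: "('a, 'm) ring_scheme"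
  assumes P: "projective R P" and M: "fg_module R M" and g: "g \<in> mod_hom R M P"
    and surj: "g ` carrier M = carrier P"
  obtains s where "s \<in> mod_hom R P M" "\<And>x. x \<in> carrier P \<Longrightarrow> g (s x) = x"
proof -
  obtain Q :: "'a umod" and h k where Q: "projective R Q" "h \<in> mod_hom R P Q" "k \<in> mod_hom R Q P"
    "\<And>x. x \<in> carrier P \<Longrightarrow> k (h x) = x" "\<And>y. y \<in> carrier Q \<Longrightarrow> h (k y) = y"
    using projective_umodE[OF P] by blast
  have "h ` carrier P = carrier Q"
  proof
    show "carrier Q \<subseteq> h ` carrier P"
      using mod_hom_closed[OF Q(3)] Q(5) by (metis image_eqI subsetI)
  qed (use mod_hom_closed[OF Q(2)] in auto)
  then have surj': "(\<lambda>x. h (g x)) ` carrier M = carrier Q"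
    unfolding surj[symmetric] by (simp add: image_image)
  obtain s where s: "s \<in> mod_hom R P M" "\<And>x. x \<in> carrier P \<Longrightarrow> h (g (s x)) = h x"
    by (rule projectiveE[OF P M projective_fg[OF Q(1)] mod_hom_compose[OF g Q(2)] surj' Q(2)]) blast
  show thesis
  proof (rule that[OF s(1)])
    fix x assume "x \<in> carrier P"
    then show "g (s x) = x"
      using s(2) Q(4) mod_hom_closed[OF s(1)] mod_hom_closed[OF g] by metis
  qed
qed


section \<open>Extending maps into projective modules; stable isomorphisms\<close>

text \<open>Surjectivity of the restriction from the dual of \<open>M\<close> to the dual of
  \<open>A\<close>, written with plain homomorphisms instead of the extensional representatives that
  \<open>dual\<close> uses.\<close>

definition extends_functionals ::
  "('a, 'm) ring_scheme \<Rightarrow> ('a, 'b) module \<Rightarrow> ('b \<Rightarrow> 'c) \<Rightarrow> ('a, 'c) module \<Rightarrow> bool" where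
  "extends_functionals R A i M \<longleftrightarrow>
     (\<forall>u\<in>mod_hom R A (self_module R). \<exists>w\<in>mod_hom R M (self_module R). \<forall>x\<in>carrier A. w (i x) = u x)"

text \<open>A projective module is a retract of a module built from copies of the ring, and extendability
  is inherited step by step in such a construction.\<close>

lemma extends_functionals_projective:
  fixes R :: "('a, 'm) ring_scheme"
  assumes ext: "extends_functionals R A i M" and A: "module R A" and M: "module R M"
    and P: "projective R P" and u: "u \<in> mod_hom R A P" and i: "i \<in> mod_hom R A M"
  obtains w where "w \<in> mod_hom R M P" "\<And>x. x \<in> carrier A \<Longrightarrow> w (i x) = u x"
proof -
  have mP: "module R P" using P by (rule projective_module)
  interpret P: module R P by fact
  have R: "cring R" by (rule P.R.is_cring)
  note selfR = module_self_module[OF R]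
  define X where "X N \<longleftrightarrow> (\<forall>u\<in>mod_hom R A N. \<exists>w\<in>mod_hom R M N. \<forall>x\<in>carrier A. w (i x) = u x)"
    for N :: "'a umod"
  obtain S where S: "finite S" "S \<subseteq> carrier P"
    and gen: "\<And>K. submodule K R P \<Longrightarrow> S \<subseteq> K \<Longrightarrow> carrier P \<subseteq> K"
    using fg_moduleE[OF projective_fg[OF P]] by metis
  \<comment> \<open>\<open>N\<close> is a copy in the universe of a finite power of the ring whose
    image in \<open>P\<close> contains \<open>T\<close>; each step of the induction adds one copy of
    the ring, with its unit sent to the new generator. A map into a sum extends as soon as its
    components do, so \<open>X\<close> is preserved.\<close>
  have "\<exists>(N :: 'a umod) g. fg_module R N \<and> g \<in> mod_hom R N P \<and> T \<subseteq> g ` carrier N \<and> X N"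
    if "finite T" "T \<subseteq> carrier P" for T
    using that
  proof (induct T)
    case empty
    have "X zero_umod" unfolding X_def
      using mod_hom_closed[where N = "zero_umod :: 'a umod"] mod_hom_zero_map[OF module_zero_umod[OF R]]
      by fastforce
    then show ?case
      using projective_fg[OF projective_zero_umod[OF R]] mod_hom_zero_map[OF mP] by blast
  next
    case (insert t T)
    then obtain N :: "'a umod" and g where N: "fg_module R N" "X N"
      and g: "g \<in> mod_hom R N P" "T \<subseteq> g ` carrier N" by blast
    have t: "t \<in> carrier P" using insert by auto
    have mN: "module R N" using N(1) by (rule fg_moduleD)
    interpret N: module R N by fact
    let ?D = "dsum (self_module R) N"
    obtain N' :: "'a umod" and h k where N': "fg_module R N'" and h: "h \<in> mod_hom R ?D N'"
      and k: "k \<in> mod_hom R N' ?D"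
      and kh: "\<And>x. x \<in> carrier ?D \<Longrightarrow> k (h x) = x" and hk: "\<And>y. y \<in> carrier N' \<Longrightarrow> h (k y) = y"
      using fg_module_umodE[OF fg_module_dsum[OF fg_module_self_module[OF R] N(1)]] by metis
    have mult_t: "(\<lambda>r. r \<odot>\<^bsub>P\<^esub> t) \<in> mod_hom R (self_module R) P"
      using t by (intro mod_homI) (simp_all add: P.smult_l_distr P.smult_assoc1)
    let ?row = "row_map P (\<lambda>r. r \<odot>\<^bsub>P\<^esub> t) g"
    have row: "?row \<in> mod_hom R ?D P" by (rule mod_hom_row_map[OF mP mult_t g(1)])
    have "insert t T \<subseteq> (\<lambda>y. ?row (k y)) ` carrier N'"
    proof
      fix s assume "s \<in> insert t T"
      then obtain z where z: "z \<in> carrier ?D" "?row z = s"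
      proof
        assume "s = t"
        then show thesis using t
          by (intro that[of "(\<one>\<^bsub>R\<^esub>, \<zero>\<^bsub>N\<^esub>)"]) (simp_all add: row_map_def mod_hom_zero[OF mN mP g(1)])
      next
        assume "s \<in> T"
        then obtain y where "y \<in> carrier N" "s = g y" using g(2) by blast
        then show thesis using t mod_hom_closed[OF g(1)]
          by (intro that[of "(\<zero>\<^bsub>R\<^esub>, y)"]) (simp_all add: row_map_def)
      qed
      then show "s \<in> (\<lambda>y. ?row (k y)) ` carrier N'"
        using kh mod_hom_closed[OF h] by (intro image_eqI[of _ _ "h z"]) auto
    qed
    moreover have "X N'" unfolding X_def
    proof
      fix u assume u: "u \<in> mod_hom R A N'"
      have "(\<lambda>x. fst (k (u x))) \<in> mod_hom R A (self_module R)"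
        by (intro mod_hom_compose[OF u mod_hom_compose[OF k mod_hom_fst]])
      from bspec[OF ext[unfolded extends_functionals_def] this]
      obtain w1 where w1: "w1 \<in> mod_hom R M (self_module R)"
        "\<And>x. x \<in> carrier A \<Longrightarrow> w1 (i x) = fst (k (u x))" by blast
      have "(\<lambda>x. snd (k (u x))) \<in> mod_hom R A N"
        by (intro mod_hom_compose[OF u mod_hom_compose[OF k mod_hom_snd]])
      from bspec[OF N(2)[unfolded X_def] this]
      obtain w2 where w2: "w2 \<in> mod_hom R M N"
        "\<And>x. x \<in> carrier A \<Longrightarrow> w2 (i x) = snd (k (u x))" by blast
      show "\<exists>w\<in>mod_hom R M N'. \<forall>x\<in>carrier A. w (i x) = u x"
        using mod_hom_closed[OF u]
        by (intro bexI[OF _ mod_hom_compose[OF mod_hom_Pair[OF w1(1) w2(1)] h]]) (auto simp: w1 w2 hk)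
    qed
    ultimately show ?case using N' mod_hom_compose[OF k row] by blast
  qed
  then obtain N :: "'a umod" and g where N: "fg_module R N" "X N"
    and g: "g \<in> mod_hom R N P" "S \<subseteq> g ` carrier N" using S by blast
  have "carrier P \<subseteq> g ` carrier N"
    by (rule gen[OF submodule_image[OF fg_moduleD[OF N(1)] mP g(1)] g(2)])
  then have surj: "g ` carrier N = carrier P" using mod_hom_closed[OF g(1)] by blast
  \<comment> \<open>The map \<open>u\<close> is moved into \<open>N\<close> by the section
    \<open>s\<close>, extended there, and brought back by \<open>g\<close>.\<close>
  obtain s where s: "s \<in> mod_hom R P N" "\<And>x. x \<in> carrier P \<Longrightarrow> g (s x) = x"
    by (rule projective_split[OF P N(1) g(1) surj]) blast
  obtain w where w: "w \<in> mod_hom R M N" "\<And>x. x \<in> carrier A \<Longrightarrow> w (i x) = s (u x)"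
    using bspec[OF N(2)[unfolded X_def] mod_hom_compose[OF u s(1)]] by blast
  show thesis
    using mod_hom_closed[OF u] by (intro that[OF mod_hom_compose[OF w(1) g(1)]]) (simp add: w s)
qed

text \<open>The kernel keeps the element type and the operations of \<open>M\<close>, so that its
  inclusion is \<open>id\<close>.\<close>

definition kernel_module :: "('a, 'b) module \<Rightarrow> ('a, 'c) module \<Rightarrow> ('b \<Rightarrow> 'c) \<Rightarrow> ('a, 'b) module" where
  "kernel_module M N h = M\<lparr>carrier := a_kernel M N h\<rparr>"

lemma kernel_module_simps [simp]:
  "carrier (kernel_module M N h) = {x \<in> carrier M. h x = \<zero>\<^bsub>N\<^esub>}"
  "\<zero>\<^bsub>kernel_module M N h\<^esub> = \<zero>\<^bsub>M\<^esub>" "x \<oplus>\<^bsub>kernel_module M N h\<^esub> y = x \<oplus>\<^bsub>M\<^esub> y"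
  "r \<odot>\<^bsub>kernel_module M N h\<^esub> x = r \<odot>\<^bsub>M\<^esub> x"
  by (auto simp: kernel_module_def a_kernel_def')

lemma module_kernel_module:
  assumes "module R M" "module R N" "h \<in> mod_hom R M N"
  shows "module R (kernel_module M N h)"
  unfolding kernel_module_def
  by (rule submodule.submodule_is_module[OF submodule_kernel[OF assms] assms(1)])

lemma mod_hom_kernel_module_incl: "id \<in> mod_hom R (kernel_module M N h) M"
  by (rule mod_homI) auto

lemma mod_hom_kernel_moduleI:
  assumes "g \<in> mod_hom R L M" "\<And>x. x \<in> carrier L \<Longrightarrow> h (g x) = \<zero>\<^bsub>N\<^esub>"
  shows "g \<in> mod_hom R L (kernel_module M N h)"
  using assms by (auto simp: mod_hom_def)

text \<open>This is the projection onto the kernel of \<open>\<rho>\<close> along the image of the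
  section \<open>\<sigma>\<close>.\<close>

lemma split_surj_kernel_retraction:
  assumes Z: "module R Z" and Y: "module R Y" and \<rho>: "\<rho> \<in> mod_hom R Z Y" and \<sigma>: "\<sigma> \<in> mod_hom R Y Z"
    and \<rho>\<sigma>: "\<And>y. y \<in> carrier Y \<Longrightarrow> \<rho> (\<sigma> y) = y"
  shows "(\<lambda>z. z \<ominus>\<^bsub>Z\<^esub> \<sigma> (\<rho> z)) \<in> mod_hom R Z (kernel_module Z Y \<rho>)"
    and "\<And>z. z \<in> carrier (kernel_module Z Y \<rho>) \<Longrightarrow> z \<ominus>\<^bsub>Z\<^esub> \<sigma> (\<rho> z) = z"
proof -
  interpret Z: module R Z by fact
  interpret Y: module R Y by fact
  show "(\<lambda>z. z \<ominus>\<^bsub>Z\<^esub> \<sigma> (\<rho> z)) \<in> mod_hom R Z (kernel_module Z Y \<rho>)"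
  proof (rule mod_hom_kernel_moduleI)
    show "(\<lambda>z. z \<ominus>\<^bsub>Z\<^esub> \<sigma> (\<rho> z)) \<in> mod_hom R Z Z"
      by (rule mod_hom_diff[OF Z mod_hom_id[unfolded id_def] mod_hom_compose[OF \<rho> \<sigma>]])
    show "\<rho> (z \<ominus>\<^bsub>Z\<^esub> \<sigma> (\<rho> z)) = \<zero>\<^bsub>Y\<^esub>" if "z \<in> carrier Z" for z
      using that by (simp add: mod_hom_simps[OF Z Y \<rho>] mod_hom_simps[OF Y Z \<sigma>] \<rho>\<sigma> Y.M.minus_eq_zero_iff)
  qed
  show "z \<ominus>\<^bsub>Z\<^esub> \<sigma> (\<rho> z) = z" if "z \<in> carrier (kernel_module Z Y \<rho>)" for z
    using that by (simp add: mod_hom_simps[OF Y Z \<sigma>] a_minus_def)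
qed

text \<open>The factorisation may go through a projective of any element type; it is rerouted
  through a copy in the universe, as the definition demands.\<close>

lemma stably_eqI:
  fixes R :: "('a, 'm) ring_scheme"
  assumes P: "projective R P" and u: "u \<in> mod_hom R M P" and v: "v \<in> mod_hom R P N"
    and eq: "\<And>x. x \<in> carrier M \<Longrightarrow> f x \<ominus>\<^bsub>N\<^esub> g x = v (u x)"
  shows "stably_eq R M N f g"
proof -
  obtain Q :: "'a umod" and h k where Q: "projective R Q" "h \<in> mod_hom R P Q" "k \<in> mod_hom R Q P"
    "\<And>x. x \<in> carrier P \<Longrightarrow> k (h x) = x" "\<And>y. y \<in> carrier Q \<Longrightarrow> h (k y) = y"
    using projective_umodE[OF P] by blast
  show ?thesis unfolding stably_eq_def
    using mod_hom_closed[OF u] eq Q(4)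
    by (intro exI[of _ Q] exI[of _ "\<lambda>x. h (u x)"] exI[of _ "\<lambda>y. v (k y)"] conjI
        Q(1) mod_hom_compose[OF u Q(2)] mod_hom_compose[OF Q(3) v]) simp
qed

text \<open>Both composites are given as the identity plus a term through a projective, the shape in
  which they arise from explicit formulas.\<close>

lemma stable_isoI:
  fixes R :: "('a, 'm) ring_scheme"
  assumes M: "module R M" and N: "module R N"
    and f: "f \<in> mod_hom R M N" and g: "g \<in> mod_hom R N M"
    and P: "projective R P" "u \<in> mod_hom R M P" "v \<in> mod_hom R P M"
    and Q: "projective R Q" "s \<in> mod_hom R N Q" "t \<in> mod_hom R Q N"
    and gf: "\<And>x. x \<in> carrier M \<Longrightarrow> g (f x) = x \<oplus>\<^bsub>M\<^esub> v (u x)"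
    and fg: "\<And>y. y \<in> carrier N \<Longrightarrow> f (g y) = y \<oplus>\<^bsub>N\<^esub> t (s y)"
  shows "stable_iso R M N f"
proof -
  interpret M: module R M by fact
  interpret N: module R N by fact
  have "stably_eq R M M (g \<circ> f) id"
    by (rule stably_eqI[OF P]) (simp add: gf mod_hom_closed[OF P(2)] mod_hom_closed[OF P(3)]
      a_minus_def M.a_ac M.r_neg M.r_neg1 M.r_neg2)
  moreover have "stably_eq R N N (f \<circ> g) id"
    by (rule stably_eqI[OF Q]) (simp add: fg mod_hom_closed[OF Q(2)] mod_hom_closed[OF Q(3)]
      a_minus_def N.M.a_ac N.M.r_neg N.M.r_neg1 N.M.r_neg2)
  ultimately show ?thesis using f g by (auto simp: stable_iso_def)
qed

lemma (in abelian_group) minus_eq_imp_eq_plus: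
  "x \<in> carrier G \<Longrightarrow> y \<in> carrier G \<Longrightarrow> x \<ominus> y = z \<Longrightarrow> x = y \<oplus> z"
  by (metis a_minus_def a_comm a_inv_closed minus_closed r_neg2)

lemma (in abelian_group) plus_eq_imp_eq_minus:
  assumes "x \<in> carrier G" "y \<in> carrier G" "x \<oplus> y = z"
  shows "y = z \<ominus> x"
  using assms(1,2) unfolding assms(3)[symmetric] by (simp add: a_minus_def a_comm[of x y] a_assoc r_neg)

lemma stable_isoE:
  fixes R :: "('a, 'm) ring_scheme"
  assumes iso: "stable_iso R M N f" and M: "module R M" and N: "module R N"
  obtains g and P :: "'a umod" and u v and Q :: "'a umod" and s t where
    "f \<in> mod_hom R M N" "g \<in> mod_hom R N M"
    "projective R P" "u \<in> mod_hom R M P" "v \<in> mod_hom R P M"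
    "projective R Q" "s \<in> mod_hom R N Q" "t \<in> mod_hom R Q N"
    "\<And>x. x \<in> carrier M \<Longrightarrow> g (f x) = x \<oplus>\<^bsub>M\<^esub> v (u x)"
    "\<And>y. y \<in> carrier N \<Longrightarrow> f (g y) = y \<oplus>\<^bsub>N\<^esub> t (s y)"
proof -
  interpret M: module R M by fact
  interpret N: module R N by fact
  obtain g where f: "f \<in> mod_hom R M N" and g: "g \<in> mod_hom R N M"
    and gf: "stably_eq R M M (g \<circ> f) id" and fg: "stably_eq R N N (f \<circ> g) id"
    using iso by (auto simp: stable_iso_def)
  obtain P :: "'a umod" and u v where P: "projective R P" "u \<in> mod_hom R M P" "v \<in> mod_hom R P M"
    "\<And>x. x \<in> carrier M \<Longrightarrow> g (f x) \<ominus>\<^bsub>M\<^esub> x = v (u x)" using gf by (auto simp: stably_eq_def)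
  obtain Q :: "'a umod" and s t where Q: "projective R Q" "s \<in> mod_hom R N Q" "t \<in> mod_hom R Q N"
    "\<And>x. x \<in> carrier N \<Longrightarrow> f (g x) \<ominus>\<^bsub>N\<^esub> x = t (s x)" using fg by (auto simp: stably_eq_def)
  note cl = mod_hom_closed[OF f] mod_hom_closed[OF g]
  show thesis
    by (rule that[OF f g P(1-3) Q(1-3)])
      (use P(4) Q(4) cl in \<open>auto intro: M.minus_eq_imp_eq_plus N.M.minus_eq_imp_eq_plus\<close>)
qed

lemma stable_iso_id: "cring R \<Longrightarrow> module R M \<Longrightarrow> stable_iso R M M id"
  for R :: "('a, 'm) ring_scheme"
proof -
  assume R: "cring R" and M: "module R M"
  interpret M: module R M by fact
  note Z = projective_zero_umod[OF R] mod_hom_zero_map[OF module_zero_umod[OF R]] mod_hom_zero_map[OF M]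
  show ?thesis
    by (rule stable_isoI[OF M M mod_hom_id mod_hom_id Z Z]) auto
qed

lemma stable_iso_of_mod_iso:
  fixes R :: "('a, 'm) ring_scheme"
  assumes "module R M" "module R N" "f \<in> mod_iso R M N"
  shows "stable_iso R M N f"
proof -
  interpret M: module R M by fact
  interpret N: module R N by fact
  obtain k where k: "f \<in> mod_hom R M N" "k \<in> mod_hom R N M" "\<And>x. x \<in> carrier M \<Longrightarrow> k (f x) = x"
    "\<And>y. y \<in> carrier N \<Longrightarrow> f (k y) = y" by (rule mod_isoE[OF assms(3,1,2)]) blast
  note Z = projective_zero_umod[OF M.R.is_cring] mod_hom_zero_map[OF module_zero_umod[OF M.R.is_cring]]
  show ?thesis
    by (rule stable_isoI[OF assms(1,2) k(1,2) Z mod_hom_zero_map[OF assms(1)]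
       Z mod_hom_zero_map[OF assms(2)]])
     (simp_all add: k)
qed

text \<open>Adding \<open>w : P \<rightarrow> Y\<close> turns the stable isomorphism \<open>\<psi>\<close> into a split surjection \<open>X \<oplus> P \<rightarrow> Y\<close>.
  Its kernel is projective because the identity of the kernel factors through \<open>Q \<oplus> P\<close>.\<close>

lemma projective_stable_iso_kernel:
  fixes R :: "('a, 'm) ring_scheme"
  assumes X: "module R X" and Y: "module R Y" and P: "projective R P" and Q: "projective R Q"
    and \<psi>: "\<psi> \<in> mod_hom R X Y" and \<chi>: "\<chi> \<in> mod_hom R Y X"
    and w: "w \<in> mod_hom R P Y" and u: "u \<in> mod_hom R Y P"
    and s: "s \<in> mod_hom R Q X" and t: "t \<in> mod_hom R X Q"
    and sec: "\<And>y. y \<in> carrier Y \<Longrightarrow> \<psi> (\<chi> y) \<oplus>\<^bsub>Y\<^esub> w (u y) = y"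
    and st: "\<And>x. x \<in> carrier X \<Longrightarrow> \<chi> (\<psi> x) = x \<oplus>\<^bsub>X\<^esub> s (t x)"
  shows "projective R (kernel_module (dsum X P) Y (row_map Y \<psi> w))"
proof -
  have mP: "module R P" and mQ: "module R Q" using P Q by (simp_all add: projective_module)
  have D: "module R (dsum X P)" by (rule module_dsum[OF X mP])
  interpret X: module R X by fact
  interpret Y: module R Y by fact
  interpret P: module R P by fact
  let ?\<rho> = "row_map Y \<psi> w" and ?\<sigma> = "\<lambda>y. (\<chi> y, u y)"
  note \<rho> = mod_hom_row_map[OF Y \<psi> w] and \<sigma> = mod_hom_Pair[OF \<chi> u]
  note simps = mod_hom_simps[OF X Y \<psi>] mod_hom_simps[OF Y X \<chi>] mod_hom_simps[OF mP Y w]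
    mod_hom_simps[OF Y mP u] mod_hom_simps[OF mQ X s] mod_hom_simps[OF X mQ t]
  have \<rho>\<sigma>: "?\<rho> (?\<sigma> y) = y" if "y \<in> carrier Y" for y using sec[OF that] by (simp add: row_map_def)
  let ?e = "\<lambda>z. z \<ominus>\<^bsub>dsum X P\<^esub> ?\<sigma> (?\<rho> z)"
  note e = split_surj_kernel_retraction[OF D Y \<rho> \<sigma> \<rho>\<sigma>]
  \<comment> \<open>For z = (x, p) in the kernel, \<open>st\<close> gives \<open>?b (?a z)\<close> =
    z - \<open>?\<sigma> (\<psi> x)\<close>. The projection \<open>?e\<close> kills the image of
    \<open>?\<sigma>\<close> and fixes z, so the identity of the kernel factors through
    \<open>dsum Q P\<close>.\<close>
  let ?a = "\<lambda>z. (t (fst z), snd z \<ominus>\<^bsub>P\<^esub> u (\<psi> (fst z)))"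
  let ?b = "\<lambda>z. (\<ominus>\<^bsub>X\<^esub> s (fst z), snd z)"
  have a: "?a \<in> mod_hom R (dsum X P) (dsum Q P)"
    by (intro mod_hom_Pair mod_hom_diff mP mod_hom_compose[OF mod_hom_fst t] mod_hom_snd
        mod_hom_compose[OF mod_hom_fst mod_hom_compose[OF \<psi> u]])
  have b: "?b \<in> mod_hom R (dsum Q P) (dsum X P)"
    by (intro mod_hom_Pair mod_hom_uminus X mod_hom_compose[OF mod_hom_fst s] mod_hom_snd)
  have "?e (?b (?a z)) = z" if zK: "z \<in> carrier (kernel_module (dsum X P) Y ?\<rho>)" for z
  proof -
    obtain x p where z: "z = (x, p)" "x \<in> carrier X" "p \<in> carrier P"
      and 0: "\<psi> x \<oplus>\<^bsub>Y\<^esub> w p = \<zero>\<^bsub>Y\<^esub>" using zK by (cases z) (auto simp: row_map_def)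
    have tx: "s (t x) = \<chi> (\<psi> x) \<ominus>\<^bsub>X\<^esub> x"
      using z by (simp add: st simps a_minus_def X.a_ac X.r_neg X.r_neg1 X.r_neg2)
    have wu: "w (u (\<psi> x)) = \<psi> x \<ominus>\<^bsub>Y\<^esub> \<psi> (\<chi> (\<psi> x))"
      using z by (intro Y.M.plus_eq_imp_eq_minus) (simp_all add: simps sec)
    have wp: "w p = \<ominus>\<^bsub>Y\<^esub> \<psi> x"
      using Y.M.plus_eq_imp_eq_minus[OF _ _ 0] z by (simp add: simps a_minus_def)
    have "?\<rho> (?b (?a z)) = \<ominus>\<^bsub>Y\<^esub> \<psi> x"
      using z by (simp add: row_map_def simps tx wu wp)
        (simp add: simps a_minus_def Y.M.minus_add Y.M.a_ac Y.M.r_neg Y.M.r_neg1 Y.M.r_neg2)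
    then have "?e (?b (?a z)) = (\<ominus>\<^bsub>X\<^esub> s (t x) \<ominus>\<^bsub>X\<^esub> (\<ominus>\<^bsub>X\<^esub> \<chi> (\<psi> x)), p \<ominus>\<^bsub>P\<^esub> u (\<psi> x) \<ominus>\<^bsub>P\<^esub> (\<ominus>\<^bsub>P\<^esub> u (\<psi> x)))"
      using z by (simp add: minus_dsum[OF X mP] simps)
    also have "\<dots> = (x, p)"
      using z by (simp add: tx simps a_minus_def X.minus_add X.a_ac X.r_neg X.r_neg1 X.r_neg2
        P.minus_add P.M.a_ac P.M.l_neg P.M.r_neg P.M.r_neg1 P.M.r_neg2)
    finally show ?thesis using z by simp
  qed
  then show ?thesis
    by (intro projective_retract[OF projective_dsum[OF Q P] module_kernel_module[OF D Y \<rho>]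
        mod_hom_compose[OF mod_hom_kernel_module_incl[unfolded id_def] a] mod_hom_compose[OF b e(1)]]) simp
qed


section \<open>Cokernels, homology and duals\<close>

lemma coset_mem_iff:
  assumes "module R M" "x \<in> carrier M" "N \<subseteq> carrier M"
  shows "y \<in> N +>\<^bsub>M\<^esub> x \<longleftrightarrow> y \<in> carrier M \<and> y \<ominus>\<^bsub>M\<^esub> x \<in> N"
proof -
  interpret M: module R M by fact
  have "y = (y \<ominus>\<^bsub>M\<^esub> x) \<oplus>\<^bsub>M\<^esub> x" if "y \<in> carrier M"
    using that assms(2) by (simp add: a_minus_def M.a_assoc M.l_neg)
  moreover have "(n \<oplus>\<^bsub>M\<^esub> x) \<ominus>\<^bsub>M\<^esub> x = n" if "n \<in> N" for n
    using that assms by (simp add: a_minus_def M.a_assoc M.r_neg subset_iff)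
  ultimately show ?thesis using assms(2,3) by (auto simp: a_r_coset_def' subset_iff)
qed

lemma coset_eq_iff:
  assumes M: "module R M" and N: "submodule N R M" and x: "x \<in> carrier M" and y: "y \<in> carrier M"
  shows "N +>\<^bsub>M\<^esub> x = N +>\<^bsub>M\<^esub> y \<longleftrightarrow> x \<ominus>\<^bsub>M\<^esub> y \<in> N"
proof -
  interpret M: module R M by fact
  note NE = M.submoduleE[OF N]
  have z: "\<zero>\<^bsub>M\<^esub> \<in> N" by (rule submodule_zero[OF N])
  note mem = coset_mem_iff[OF M _ NE(1)]
  show ?thesis
  proof
    assume "N +>\<^bsub>M\<^esub> x = N +>\<^bsub>M\<^esub> y"
    moreover have "x \<in> N +>\<^bsub>M\<^esub> x" using x z by (simp add: mem a_minus_def M.r_neg)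
    ultimately show "x \<ominus>\<^bsub>M\<^esub> y \<in> N" using y by (simp add: mem)
  next
    assume d: "x \<ominus>\<^bsub>M\<^esub> y \<in> N"
    have 1: "a \<ominus>\<^bsub>M\<^esub> y = (a \<ominus>\<^bsub>M\<^esub> x) \<oplus>\<^bsub>M\<^esub> (x \<ominus>\<^bsub>M\<^esub> y)" if "a \<in> carrier M" for a
      using that x y by (simp add: a_minus_def M.a_assoc M.r_neg1)
    have 2: "a \<ominus>\<^bsub>M\<^esub> x = (a \<ominus>\<^bsub>M\<^esub> y) \<oplus>\<^bsub>M\<^esub> \<ominus>\<^bsub>M\<^esub> (x \<ominus>\<^bsub>M\<^esub> y)" if "a \<in> carrier M" for a
      using that x y by algebra
    have "a \<ominus>\<^bsub>M\<^esub> x \<in> N \<longleftrightarrow> a \<ominus>\<^bsub>M\<^esub> y \<in> N" if "a \<in> carrier M" for a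
      using NE(5)[OF _ d, of "a \<ominus>\<^bsub>M\<^esub> x"] NE(5)[OF _ NE(3)[OF d], of "a \<ominus>\<^bsub>M\<^esub> y"] that
      by (auto simp flip: 1 2)
    then show "N +>\<^bsub>M\<^esub> x = N +>\<^bsub>M\<^esub> y"
      using x y by (simp add: set_eq_iff mem cong: conj_cong)
  qed
qed

lemma carrier_mod_quot: "carrier (mod_quot M N) = (\<lambda>x. N +>\<^bsub>M\<^esub> x) ` carrier M"
  by (auto simp: mod_quot_def A_RCOSETS_def')

text \<open>Scalar multiplication on \<open>mod_quot\<close> is a union of cosets taken over all
  representatives. The cosets in this family coincide and the family is nonempty, so the union is
  the expected single coset.\<close>

lemma mod_quot_ops:
  assumes M: "module R M" and N: "submodule N R M"
  shows "\<zero>\<^bsub>mod_quot M N\<^esub> = N +>\<^bsub>M\<^esub> \<zero>\<^bsub>M\<^esub>"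
    and "x \<in> carrier M \<Longrightarrow> y \<in> carrier M \<Longrightarrow>
      (N +>\<^bsub>M\<^esub> x) \<oplus>\<^bsub>mod_quot M N\<^esub> (N +>\<^bsub>M\<^esub> y) = N +>\<^bsub>M\<^esub> (x \<oplus>\<^bsub>M\<^esub> y)"
    and "r \<in> carrier R \<Longrightarrow> x \<in> carrier M \<Longrightarrow>
      r \<odot>\<^bsub>mod_quot M N\<^esub> (N +>\<^bsub>M\<^esub> x) = N +>\<^bsub>M\<^esub> (r \<odot>\<^bsub>M\<^esub> x)"
proof -
  interpret M: module R M by fact
  note NE = M.submoduleE[OF N]
  have z: "\<zero>\<^bsub>M\<^esub> \<in> N" by (rule submodule_zero[OF N])
  note mem = coset_mem_iff[OF M _ NE(1)]
  show "\<zero>\<^bsub>mod_quot M N\<^esub> = N +>\<^bsub>M\<^esub> \<zero>\<^bsub>M\<^esub>"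
    using NE(1) by (simp add: mod_quot_def M.a_coset_add_zero)
  show "(N +>\<^bsub>M\<^esub> x) \<oplus>\<^bsub>mod_quot M N\<^esub> (N +>\<^bsub>M\<^esub> y) = N +>\<^bsub>M\<^esub> (x \<oplus>\<^bsub>M\<^esub> y)"
    if "x \<in> carrier M" "y \<in> carrier M"
  proof -
    have "abelian_subgroup N M"
      by (rule abelian_subgroupI3)
        (use N in \<open>auto intro: additive_subgroupI submodule.axioms(1) M.abelian_group_axioms\<close>)
    then show ?thesis using that by (simp add: mod_quot_def abelian_subgroup.a_rcos_sum)
  qed
  show "r \<odot>\<^bsub>mod_quot M N\<^esub> (N +>\<^bsub>M\<^esub> x) = N +>\<^bsub>M\<^esub> (r \<odot>\<^bsub>M\<^esub> x)"
    if r: "r \<in> carrier R" and x: "x \<in> carrier M"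
  proof -
    have eq: "N +>\<^bsub>M\<^esub> (r \<odot>\<^bsub>M\<^esub> a) = N +>\<^bsub>M\<^esub> (r \<odot>\<^bsub>M\<^esub> x)" if "a \<in> N +>\<^bsub>M\<^esub> x" for a
    proof -
      have a: "a \<in> carrier M" "a \<ominus>\<^bsub>M\<^esub> x \<in> N" using that x by (auto simp: mem)
      then have "r \<odot>\<^bsub>M\<^esub> a \<ominus>\<^bsub>M\<^esub> r \<odot>\<^bsub>M\<^esub> x \<in> N"
        using NE(4)[OF r a(2)] r x by (simp add: a_minus_def M.smult_r_distr M.smult_r_minus)
      then show ?thesis using a(1) r x by (simp add: coset_eq_iff[OF M N])
    qed
    have "x \<in> N +>\<^bsub>M\<^esub> x" using x z by (simp add: mem a_minus_def M.r_neg)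
    then have "N +>\<^bsub>M\<^esub> x \<noteq> {}" by blast
    then have "(\<Union>a\<in>N +>\<^bsub>M\<^esub> x. N +>\<^bsub>M\<^esub> (r \<odot>\<^bsub>M\<^esub> a)) = N +>\<^bsub>M\<^esub> (r \<odot>\<^bsub>M\<^esub> x)"
      by (rule SUP_eq_const) (rule eq)
    then show ?thesis by (simp add: mod_quot_def)
  qed
qed

lemma module_mod_quot:
  assumes M: "module R M" and N: "submodule N R M"
  shows "module R (mod_quot M N)"
proof -
  interpret M: module R M by fact
  note ops = mod_quot_ops[OF assms]
  show ?thesis
  proof (intro moduleI abelian_groupI)
    show "cring R" by (rule M.R.is_cring)
    fix X assume "X \<in> carrier (mod_quot M N)"
    then obtain x where "x \<in> carrier M" "X = N +>\<^bsub>M\<^esub> x" by (auto simp: carrier_mod_quot)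
    then show "\<exists>Y\<in>carrier (mod_quot M N). Y \<oplus>\<^bsub>mod_quot M N\<^esub> X = \<zero>\<^bsub>mod_quot M N\<^esub>"
      by (intro bexI[of _ "N +>\<^bsub>M\<^esub> (\<ominus>\<^bsub>M\<^esub> x)"]) (auto simp: ops carrier_mod_quot M.l_neg)
  qed (auto simp: carrier_mod_quot ops M.a_ac M.smult_l_distr M.smult_r_distr M.smult_assoc1)
qed

lemma mod_hom_mod_quot_proj:
  assumes "module R M" "submodule N R M"
  shows "(\<lambda>x. N +>\<^bsub>M\<^esub> x) \<in> mod_hom R M (mod_quot M N)"
  by (rule mod_homI) (simp_all add: carrier_mod_quot mod_quot_ops[OF assms])

lemma module_coker:
  assumes "module R L" "module R M" "h \<in> mod_hom R L M"
  shows "module R (coker L h M)"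
  unfolding coker_def by (rule module_mod_quot[OF assms(2) submodule_image[OF assms]])

lemma mod_hom_coker_proj:
  assumes "module R L" "module R M" "h \<in> mod_hom R L M"
  shows "coker_proj L h M \<in> mod_hom R M (coker L h M)"
  unfolding coker_def coker_proj_def
  by (rule mod_hom_mod_quot_proj[OF assms(2) submodule_image[OF assms]])

lemma coker_proj_surj: "coker_proj L h M ` carrier M = carrier (coker L h M)"
  by (simp add: coker_def coker_proj_def carrier_mod_quot)

lemma coker_proj_eq_iff:
  assumes "module R L" "module R M" "h \<in> mod_hom R L M" "x \<in> carrier M" "y \<in> carrier M"
  shows "coker_proj L h M x = coker_proj L h M y \<longleftrightarrow> x \<ominus>\<^bsub>M\<^esub> y \<in> h ` carrier L"
  using coset_eq_iff[OF assms(2) submodule_image[OF assms(1-3)] assms(4,5)]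
  by (simp add: coker_proj_def)

lemma coker_proj_eq_zero_iff:
  assumes "module R L" "module R M" "h \<in> mod_hom R L M" "x \<in> carrier M"
  shows "coker_proj L h M x = \<zero>\<^bsub>coker L h M\<^esub> \<longleftrightarrow> x \<in> h ` carrier L"
proof -
  interpret M: module R M by fact
  have "\<zero>\<^bsub>coker L h M\<^esub> = coker_proj L h M \<zero>\<^bsub>M\<^esub>"
    using mod_hom_zero[OF assms(2) module_coker[OF assms(1-3)] mod_hom_coker_proj[OF assms(1-3)]] by simp
  then show ?thesis using assms(4) by (simp add: coker_proj_eq_iff[OF assms(1-3)] M.M.minus_zero_right)
qed

text \<open>The union defining \<open>coker_map\<close> runs over a nonempty family of equal cosets,
  because \<open>g\<close> carries the image of \<open>h\<close> into that of
  \<open>h'\<close>.\<close>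

lemma coker_map_coker_proj:
  assumes L: "module R L" "module R M" "h \<in> mod_hom R L M"
    and L': "module R L'" "module R M'" "h' \<in> mod_hom R L' M'"
    and g: "g \<in> mod_hom R M M'" and k: "\<And>x. x \<in> carrier L \<Longrightarrow> g (h x) \<in> h' ` carrier L'"
    and x: "x \<in> carrier M"
  shows "coker_map L' h' M' g (coker_proj L h M x) = coker_proj L' h' M' (g x)"
proof -
  interpret M: module R M by fact
  note sub = submodule_image[OF L]
  note mem = coset_mem_iff[OF L(2) x M.submoduleE(1)[OF sub]]
  have eq: "coker_proj L' h' M' (g y) = coker_proj L' h' M' (g x)" if "y \<in> coker_proj L h M x" for y
  proof -
    have y: "y \<in> carrier M" "y \<ominus>\<^bsub>M\<^esub> x \<in> h ` carrier L" using that mem by (auto simp: coker_proj_def)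
    then have "g (y \<ominus>\<^bsub>M\<^esub> x) \<in> h' ` carrier L'" using k by auto
    then show ?thesis
      using x y by (simp add: coker_proj_eq_iff[OF L'] mod_hom_simps[OF L(2) L'(2) g])
  qed
  have "x \<in> coker_proj L h M x"
    using x mem submodule_zero[OF sub] by (simp add: coker_proj_def a_minus_def M.r_neg)
  then have "coker_proj L h M x \<noteq> {}" by blast
  then show ?thesis unfolding coker_map_def by (rule SUP_eq_const) (rule eq)
qed

text \<open>Cosets inside the kernel are computed with the addition of \<open>M\<close>, so the
  quotient is trivial exactly when the coset of each kernel element is the image of \<open>h\<close>
  itself.\<close>

lemma zero_module_homology_iff:
  assumes L: "module R L" and M: "module R M" and N: "module R N"
    and h: "h \<in> mod_hom R L M" and g: "g \<in> mod_hom R M N"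
  shows "zero_module (homology L h M g N) \<longleftrightarrow>
    (\<forall>x\<in>carrier M. g x = \<zero>\<^bsub>N\<^esub> \<longrightarrow> x \<in> h ` carrier L)"
proof -
  interpret M: module R M by fact
  let ?I = "h ` carrier L"
  note sub = submodule_image[OF L M h]
  have I: "?I \<subseteq> carrier M" by (rule M.submoduleE(1)[OF sub])
  let ?K = "{x \<in> carrier M. g x = \<zero>\<^bsub>N\<^esub>}"
  have "carrier (homology L h M g N) = (\<lambda>x. ?I +>\<^bsub>M\<^esub> x) ` ?K"
    by (auto simp: homology_def carrier_mod_quot a_kernel_def' a_r_coset_def')
  moreover have "\<zero>\<^bsub>homology L h M g N\<^esub> = ?I" by (simp add: homology_def mod_quot_def)
  moreover have "?K \<noteq> {}" using mod_hom_zero[OF M N g] M.zero_closed by blast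
  then have "(\<lambda>x. ?I +>\<^bsub>M\<^esub> x) ` ?K = {?I} \<longleftrightarrow> (\<forall>x\<in>?K. ?I +>\<^bsub>M\<^esub> x = ?I)" by blast
  moreover have "?I +>\<^bsub>M\<^esub> x = ?I \<longleftrightarrow> x \<in> ?I" if "x \<in> carrier M" for x
    using coset_eq_iff[OF M sub that M.zero_closed] that I
    by (simp add: M.a_coset_add_zero M.M.minus_zero_right)
  ultimately show ?thesis unfolding zero_module_def by simp blast
qed

section \<open>Duals and perfect exactness\<close>

lemma carrier_dual: "carrier (dual R M) = mod_hom R M (self_module R) \<inter> extensional (carrier M)"
  by (simp add: dual_def self_module_def)

lemma restrict_mem_dual:
  assumes "module R M" "u \<in> mod_hom R M (self_module R)"
  shows "(\<lambda>x\<in>carrier M. u x) \<in> carrier (dual R M)"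
  using mod_hom_cong[OF assms(2,1), of "\<lambda>x\<in>carrier M. u x"] by (simp add: carrier_dual)

lemma module_dual:
  assumes M: "module R M"
  shows "module R (dual R M)"
proof -
  interpret M: module R M by fact
  note selfR = module_self_module[OF M.R.is_cring]
  interpret S: module R "self_module R" by (rule selfR)
  have ops: "\<zero>\<^bsub>dual R M\<^esub> = (\<lambda>x\<in>carrier M. \<zero>\<^bsub>R\<^esub>)" "add (dual R M) = (\<lambda>u v. \<lambda>x\<in>carrier M. u x \<oplus>\<^bsub>R\<^esub> v x)"
    "smult (dual R M) = (\<lambda>r u. \<lambda>x\<in>carrier M. r \<otimes>\<^bsub>R\<^esub> u x)" by (simp_all add: dual_def)
  have cl: "u x \<in> carrier R" if "u \<in> carrier (dual R M)" "x \<in> carrier M" for u x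
    using that mod_hom_closed[of u R M "self_module R"] by (simp add: carrier_dual)
  have hom: "u \<in> mod_hom R M (self_module R)" if "u \<in> carrier (dual R M)" for u
    using that by (simp add: carrier_dual)
  have eqI: "u = v" if "u \<in> extensional (carrier M)" "v \<in> extensional (carrier M)"
    "\<And>x. x \<in> carrier M \<Longrightarrow> u x = v x" for u v
    using that by (rule extensionalityI)
  have ext: "u \<in> extensional (carrier M)" if "u \<in> carrier (dual R M)" for u
    using that by (simp add: carrier_dual)
  show ?thesis
  proof (intro moduleI abelian_groupI)
    show "cring R" by (rule M.R.is_cring)
    show "\<zero>\<^bsub>dual R M\<^esub> \<in> carrier (dual R M)"
      unfolding ops using restrict_mem_dual[OF M mod_hom_zero_map[OF selfR]] by simp
    fix u assume u: "u \<in> carrier (dual R M)"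
    have neg: "(\<lambda>x\<in>carrier M. \<ominus>\<^bsub>self_module R\<^esub> u x) \<in> carrier (dual R M)"
      by (rule restrict_mem_dual[OF M mod_hom_uminus[OF selfR hom[OF u]]])
    have "\<ominus>\<^bsub>self_module R\<^esub> r \<oplus>\<^bsub>R\<^esub> r = \<zero>\<^bsub>R\<^esub>" if "r \<in> carrier R" for r
      using S.M.l_neg[of r] that by simp
    then show "\<exists>v\<in>carrier (dual R M). v \<oplus>\<^bsub>dual R M\<^esub> u = \<zero>\<^bsub>dual R M\<^esub>"
      unfolding ops by (intro bexI[OF _ neg]) (auto simp: fun_eq_iff cl u)
    show "\<zero>\<^bsub>dual R M\<^esub> \<oplus>\<^bsub>dual R M\<^esub> u = u" "\<one>\<^bsub>R\<^esub> \<odot>\<^bsub>dual R M\<^esub> u = u"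
      unfolding ops using u by (auto intro!: eqI simp: cl ext)
    fix v assume v: "v \<in> carrier (dual R M)"
    show "u \<oplus>\<^bsub>dual R M\<^esub> v \<in> carrier (dual R M)"
      unfolding ops using restrict_mem_dual[OF M mod_hom_plus[OF selfR hom[OF u] hom[OF v]]] by simp
    show "u \<oplus>\<^bsub>dual R M\<^esub> v = v \<oplus>\<^bsub>dual R M\<^esub> u"
      unfolding ops using u v by (auto simp: fun_eq_iff cl M.R.a_comm)
    fix w assume w: "w \<in> carrier (dual R M)"
    show "u \<oplus>\<^bsub>dual R M\<^esub> v \<oplus>\<^bsub>dual R M\<^esub> w = u \<oplus>\<^bsub>dual R M\<^esub> (v \<oplus>\<^bsub>dual R M\<^esub> w)"
      unfolding ops using u v w by (auto simp: fun_eq_iff cl M.R.a_assoc)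
  next
    fix r u assume r: "r \<in> carrier R" and u: "u \<in> carrier (dual R M)"
    have "(\<lambda>x. r \<odot>\<^bsub>self_module R\<^esub> u x) \<in> mod_hom R M (self_module R)"
      using r by (intro mod_homI) (simp_all add: mod_hom_basic[OF hom[OF u], simplified] cl[OF u]
        M.R.r_distr M.R.m_lcomm)
    from restrict_mem_dual[OF M this] show "r \<odot>\<^bsub>dual R M\<^esub> u \<in> carrier (dual R M)"
      unfolding ops by simp
    fix v assume v: "v \<in> carrier (dual R M)"
    show "r \<odot>\<^bsub>dual R M\<^esub> (u \<oplus>\<^bsub>dual R M\<^esub> v) = r \<odot>\<^bsub>dual R M\<^esub> u \<oplus>\<^bsub>dual R M\<^esub> r \<odot>\<^bsub>dual R M\<^esub> v"
      unfolding ops using r u v by (auto simp: fun_eq_iff cl M.R.r_distr)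
  next
    fix r s u assume "r \<in> carrier R" "s \<in> carrier R" and u: "u \<in> carrier (dual R M)"
    then show "(r \<oplus>\<^bsub>R\<^esub> s) \<odot>\<^bsub>dual R M\<^esub> u = r \<odot>\<^bsub>dual R M\<^esub> u \<oplus>\<^bsub>dual R M\<^esub> s \<odot>\<^bsub>dual R M\<^esub> u"
      "(r \<otimes>\<^bsub>R\<^esub> s) \<odot>\<^bsub>dual R M\<^esub> u = r \<odot>\<^bsub>dual R M\<^esub> (s \<odot>\<^bsub>dual R M\<^esub> u)"
      unfolding ops by (auto simp: fun_eq_iff cl[OF u] M.R.l_distr M.R.m_assoc)
  qed
qed

lemma mod_hom_dual_map:
  assumes M: "module R M" and N: "module R N" and h: "h \<in> mod_hom R M N"
  shows "dual_map M h \<in> mod_hom R (dual R N) (dual R M)"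
proof (rule mod_homI)
  fix u assume u: "u \<in> carrier (dual R N)"
  show "dual_map M h u \<in> carrier (dual R M)"
    unfolding dual_map_def
    using u by (intro restrict_mem_dual[OF M] mod_hom_compose[OF h]) (simp add: carrier_dual)
  show "dual_map M h (u \<oplus>\<^bsub>dual R N\<^esub> v) = dual_map M h u \<oplus>\<^bsub>dual R M\<^esub> dual_map M h v" for v
    by (auto simp: dual_map_def dual_def fun_eq_iff mod_hom_closed[OF h])
  show "dual_map M h (r \<odot>\<^bsub>dual R N\<^esub> u) = r \<odot>\<^bsub>dual R M\<^esub> dual_map M h u" for r
    by (auto simp: dual_map_def dual_def fun_eq_iff mod_hom_closed[OF h])
qed

text \<open>Dualising is left exact by itself: surjectivity of \<open>p\<close> makes its dual
  injective, and functionals vanishing on the image of \<open>i\<close> factor through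
  \<open>p\<close>. What remains is surjectivity of the dual of \<open>i\<close>, which is
  \<open>ext\<close>.\<close>

lemma perfect_exactI:
  assumes se: "short_exact R A i B p C" and ext: "extends_functionals R A i B"
  shows "perfect_exact R A i B p C"
proof -
  have A: "module R A" and B: "module R B" and C: "module R C"
    and i: "i \<in> mod_hom R A B" and p: "p \<in> mod_hom R B C" and im: "i ` carrier A = a_kernel B C p"
    and surj: "p ` carrier B = carrier C" using se by (auto simp: short_exact_def)
  interpret C: module R C by fact
  note selfR = module_self_module[OF C.R.is_cring]
  have pi: "p (i x) = \<zero>\<^bsub>C\<^esub>" if "x \<in> carrier A" for x using im that by (auto simp: a_kernel_def')
  have pcl: "p x \<in> carrier C" if "x \<in> carrier B" for x by (rule mod_hom_closed[OF p that])
  have icl: "i x \<in> carrier B" if "x \<in> carrier A" for x by (rule mod_hom_closed[OF i that])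
  have "short_exact R (dual R C) (dual_map B p) (dual R B) (dual_map A i) (dual R A)"
    unfolding short_exact_def
  proof (intro conjI module_dual mod_hom_dual_map A B C i p)
    show "inj_on (dual_map B p) (carrier (dual R C))"
    proof (rule inj_onI)
      fix u v assume uv: "u \<in> carrier (dual R C)" "v \<in> carrier (dual R C)" "dual_map B p u = dual_map B p v"
      have "u (p x) = v (p x)" if "x \<in> carrier B" for x
        using fun_cong[OF uv(3), of x] that by (simp add: dual_map_def)
      then have "u y = v y" if "y \<in> carrier C" for y using that surj by (metis imageE)
      then show "u = v" using uv(1,2) by (intro extensionalityI[of _ "carrier C"]) (auto simp: carrier_dual)
    qed
    show "dual_map B p ` carrier (dual R C) = a_kernel (dual R B) (dual R A) (dual_map A i)"
    proof (intro equalityI subsetI)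
      fix w assume "w \<in> dual_map B p ` carrier (dual R C)"
      then obtain u where u: "u \<in> carrier (dual R C)" "w = dual_map B p u" by blast
      then have "u \<zero>\<^bsub>C\<^esub> = \<zero>\<^bsub>R\<^esub>" using mod_hom_zero[OF C selfR, of u] by (simp add: carrier_dual)
      then have "dual_map A i w = \<zero>\<^bsub>dual R A\<^esub>"
        by (auto simp: u(2) dual_map_def dual_def fun_eq_iff pi icl)
      moreover have "w \<in> carrier (dual R B)"
        unfolding u(2) by (rule mod_hom_closed[OF mod_hom_dual_map[OF B C p] u(1)])
      ultimately show "w \<in> a_kernel (dual R B) (dual R A) (dual_map A i)" by (simp add: a_kernel_def')
    next
      fix w assume w: "w \<in> a_kernel (dual R B) (dual R A) (dual_map A i)"
      then have whom: "w \<in> mod_hom R B (self_module R)" and wext: "w \<in> extensional (carrier B)"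
        and 0: "dual_map A i w = \<zero>\<^bsub>dual R A\<^esub>" by (auto simp: a_kernel_def' carrier_dual)
      have wi: "w (i a) = \<zero>\<^bsub>R\<^esub>" if "a \<in> carrier A" for a
        using fun_cong[OF 0, of a] that by (simp add: dual_map_def dual_def)
      have "w x = \<zero>\<^bsub>self_module R\<^esub>" if "x \<in> carrier B" "p x = \<zero>\<^bsub>C\<^esub>" for x
      proof -
        have "x \<in> i ` carrier A" unfolding im using that by (simp add: a_kernel_def')
        then show ?thesis using wi by auto
      qed
      then obtain u where u: "u \<in> mod_hom R C (self_module R)" "\<And>x. x \<in> carrier B \<Longrightarrow> u (p x) = w x"
        using mod_hom_factor_surj[OF B C selfR p surj whom] by metis
      have "w = dual_map B p (\<lambda>x\<in>carrier C. u x)"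
        using wext by (intro extensionalityI[of _ "carrier B"]) (auto simp: dual_map_def pcl u(2))
      then show "w \<in> dual_map B p ` carrier (dual R C)" using restrict_mem_dual[OF C u(1)] by blast
    qed
    show "dual_map A i ` carrier (dual R B) = carrier (dual R A)"
    proof (intro equalityI subsetI)
      fix u assume u: "u \<in> carrier (dual R A)"
      then obtain w where w: "w \<in> mod_hom R B (self_module R)" "\<And>x. x \<in> carrier A \<Longrightarrow> w (i x) = u x"
        using ext unfolding extends_functionals_def carrier_dual by blast
      have "u = dual_map A i (\<lambda>x\<in>carrier B. w x)"
        using u by (intro extensionalityI[of _ "carrier A"]) (auto simp: carrier_dual dual_map_def icl w(2))
      then show "u \<in> dual_map A i ` carrier (dual R B)" using restrict_mem_dual[OF B w(1)] by blast
    qed (use mod_hom_closed[OF mod_hom_dual_map[OF A B i]] in blast)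
  qed
  with se show ?thesis by (simp add: perfect_exact_def)
qed

lemma perfect_exact_extends_functionals:
  assumes "perfect_exact R A i B p C"
  shows "extends_functionals R A i B"
  unfolding extends_functionals_def
proof
  fix u assume u: "u \<in> mod_hom R A (self_module R)"
  have A: "module R A" using assms by (simp add: perfect_exact_def short_exact_def)
  have "(\<lambda>x\<in>carrier A. u x) \<in> dual_map A i ` carrier (dual R B)"
    using assms restrict_mem_dual[OF A u] by (simp add: perfect_exact_def short_exact_def)
  then obtain w where w: "w \<in> carrier (dual R B)" "(\<lambda>x\<in>carrier A. u x) = dual_map A i w" by blast
  have "w (i x) = u x" if "x \<in> carrier A" for x
    using fun_cong[OF w(2), of x] that by (simp add: dual_map_def)
  then show "\<exists>w\<in>mod_hom R B (self_module R). \<forall>x\<in>carrier A. w (i x) = u x"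
    using w(1) by (auto simp: carrier_dual)
qed


section \<open>Comparing exact sequences\<close>

text \<open>Since \<open>b\<close> matches the kernels of the two projections, both \<open>b\<close>
  and its inverse descend to the quotients, and the descended maps are inverse to each
  other.\<close>

lemma mod_iso_on_quotients:
  assumes B: "module R B" and B': "module R B'" and C: "module R C" and C': "module R C'"
    and p: "p \<in> mod_hom R B C" "p ` carrier B = carrier C"
    and p': "p' \<in> mod_hom R B' C'" "p' ` carrier B' = carrier C'"
    and b: "b \<in> mod_hom R B B'" and b': "b' \<in> mod_hom R B' B"
    and b'b: "\<And>x. x \<in> carrier B \<Longrightarrow> b' (b x) = x" and bb': "\<And>y. y \<in> carrier B' \<Longrightarrow> b (b' y) = y"
    and ker: "\<And>x. x \<in> carrier B \<Longrightarrow> p x = \<zero>\<^bsub>C\<^esub> \<longleftrightarrow> p' (b x) = \<zero>\<^bsub>C'\<^esub>"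
  obtains \<gamma> where "\<gamma> \<in> mod_iso R C C'" "\<And>x. x \<in> carrier B \<Longrightarrow> \<gamma> (p x) = p' (b x)"
proof -
  obtain \<gamma> where \<gamma>: "\<gamma> \<in> mod_hom R C C'" "\<And>x. x \<in> carrier B \<Longrightarrow> \<gamma> (p x) = p' (b x)"
    using mod_hom_factor_surj[OF B C C' p mod_hom_compose[OF b p'(1)]] ker by metis
  have "p (b' y) = \<zero>\<^bsub>C\<^esub>" if "y \<in> carrier B'" "p' y = \<zero>\<^bsub>C'\<^esub>" for y
    using ker[of "b' y"] bb'[OF that(1)] that mod_hom_closed[OF b'] by simp
  then obtain \<delta> where \<delta>: "\<delta> \<in> mod_hom R C' C" "\<And>y. y \<in> carrier B' \<Longrightarrow> \<delta> (p' y) = p (b' y)"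
    using mod_hom_factor_surj[OF B' C' C p' mod_hom_compose[OF b' p(1)]] by metis
  have "\<gamma> \<in> mod_iso R C C'"
  proof (rule mod_isoI[OF \<gamma>(1) \<delta>(1)])
    fix x assume "x \<in> carrier C"
    then obtain z where "z \<in> carrier B" "x = p z" unfolding p(2)[symmetric] by blast
    then show "\<delta> (\<gamma> x) = x" using mod_hom_closed[OF b] by (simp add: \<gamma> \<delta> b'b)
  next
    fix y assume "y \<in> carrier C'"
    then obtain z where "z \<in> carrier B'" "y = p' z" unfolding p'(2)[symmetric] by blast
    then show "\<gamma> (\<delta> y) = y" using mod_hom_closed[OF b'] by (simp add: \<gamma> \<delta> bb')
  qed
  then show thesis using \<gamma>(2) by (rule that)
qed

text \<open>The map is M -> M + P -> N + K -> N, and its stable inverse runs the other way. Omitting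
  the K-component (respectively the P-component) halfway costs a term that factors through that
  projective.\<close>

lemma stably_isomorphic_of_dsum_iso:
  fixes R :: "('a, 'm) ring_scheme"
  assumes M: "module R M" and N: "module R N" and P: "projective R P" and K: "projective R K"
    and iso: "T \<in> mod_iso R (dsum M P) (dsum N K)"
  shows "stably_isomorphic R M N"
proof -
  have mP: "module R P" and mK: "module R K" using P K by (simp_all add: projective_module)
  note MP = module_dsum[OF M mP] and NK = module_dsum[OF N mK]
  obtain T' where X: "T \<in> mod_hom R (dsum M P) (dsum N K)" and X': "T' \<in> mod_hom R (dsum N K) (dsum M P)"
    and X'X: "\<And>x. x \<in> carrier (dsum M P) \<Longrightarrow> T' (T x) = x"
    and XX': "\<And>y. y \<in> carrier (dsum N K) \<Longrightarrow> T (T' y) = y"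
    by (rule mod_isoE[OF iso MP NK]) blast
  \<comment> \<open>With \<open>h (m, 0)\<close> = (n, k) one has (n, 0) = \<open>h (m, 0)\<close> -
    (0, k), hence \<open>h' (n, 0)\<close> = (m, 0) - \<open>h' (0, k)\<close>. The modules are
    generalised, types included, so that the computation serves \<open>T\<close> and its inverse
    alike.\<close>
  have key: "fst (h' (fst (h (m, \<zero>\<^bsub>P\<^esub>)), \<zero>\<^bsub>K\<^esub>)) =
      m \<oplus>\<^bsub>M\<^esub> \<ominus>\<^bsub>M\<^esub> fst (h' (\<zero>\<^bsub>N\<^esub>, snd (h (m, \<zero>\<^bsub>P\<^esub>))))"
    if M: "module R M" and N: "module R N" and mP: "module R P" and mK: "module R K"
    and h: "h \<in> mod_hom R (dsum M P) (dsum N K)" and h': "h' \<in> mod_hom R (dsum N K) (dsum M P)"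
    and h'h: "\<And>x. x \<in> carrier (dsum M P) \<Longrightarrow> h' (h x) = x" and m: "m \<in> carrier M"
    for M :: "('a, 'x) module" and N :: "('a, 'y) module" and P :: "('a, 'z) module"
      and K :: "('a, 'w) module" and h h' m
  proof -
    note MP = module_dsum[OF M mP] and NK = module_dsum[OF N mK]
    interpret M: module R M by fact
    interpret N: module R N by fact
    interpret P: module R P by fact
    interpret K: module R K by fact
    obtain n k where nk: "h (m, \<zero>\<^bsub>P\<^esub>) = (n, k)" by (cases "h (m, \<zero>\<^bsub>P\<^esub>)")
    then have c: "n \<in> carrier N" "k \<in> carrier K"
      using mod_hom_closed[OF h, of "(m, \<zero>\<^bsub>P\<^esub>)"] m by auto
    then have "(n, \<zero>\<^bsub>K\<^esub>) = h (m, \<zero>\<^bsub>P\<^esub>) \<ominus>\<^bsub>dsum N K\<^esub> (\<zero>\<^bsub>N\<^esub>, k)"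
      by (simp add: nk minus_dsum[OF N mK] N.M.minus_zero_right)
        (simp add: a_minus_def K.M.r_neg)
    moreover have "h' (h (m, \<zero>\<^bsub>P\<^esub>) \<ominus>\<^bsub>dsum N K\<^esub> (\<zero>\<^bsub>N\<^esub>, k)) = (m, \<zero>\<^bsub>P\<^esub>) \<ominus>\<^bsub>dsum M P\<^esub> h' (\<zero>\<^bsub>N\<^esub>, k)"
      using c m h'h[of "(m, \<zero>\<^bsub>P\<^esub>)"] by (simp add: mod_hom_minus[OF NK MP h'] nk)
    moreover have "h' (\<zero>\<^bsub>N\<^esub>, k) \<in> carrier (dsum M P)" using c by (intro mod_hom_closed[OF h']) simp
    ultimately show ?thesis
      using m by (simp add: nk mod_hom_minus[OF MP M mod_hom_fst]) (simp add: a_minus_def)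
  qed
  note fst0 = mod_hom_compose[OF mod_hom_compose[OF mod_hom_Pair_zero[OF mP] X] mod_hom_fst]
  note snd0 = mod_hom_compose[OF mod_hom_compose[OF mod_hom_Pair_zero[OF mP] X] mod_hom_snd]
  note fst0' = mod_hom_compose[OF mod_hom_compose[OF mod_hom_Pair_zero[OF mK] X'] mod_hom_fst]
  note snd0' = mod_hom_compose[OF mod_hom_compose[OF mod_hom_Pair_zero[OF mK] X'] mod_hom_snd]
  note v = mod_hom_uminus[OF M mod_hom_compose[OF mod_hom_compose[OF mod_hom_zero_Pair[OF N] X'] mod_hom_fst]]
  note v' = mod_hom_uminus[OF N mod_hom_compose[OF mod_hom_compose[OF mod_hom_zero_Pair[OF M] X] mod_hom_fst]]
  have "stable_iso R M N (\<lambda>m. fst (T (m, \<zero>\<^bsub>P\<^esub>)))"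
    by (rule stable_isoI[OF M N fst0 fst0' K snd0 v P snd0' v'])
      (rule key[OF M N mP mK X X' X'X] key[OF N M mK mP X' X XX'], assumption+)+
  then show ?thesis unfolding stably_isomorphic_def by blast
qed

text \<open>The first component of \<open>\<Phi>\<close> restricts to \<open>\<psi>\<close> on the
  nose and not merely up to projectives; the comparison of the two pseudo-cokernels relies on
  this.\<close>

lemma stable_iso_completion:
  fixes R :: "('a, 'm) ring_scheme"
  assumes iso: "stable_iso R X Y \<psi>" and X: "module R X" and Y: "module R Y"
  obtains P K :: "'a umod" and \<Phi> where "projective R P" "projective R K"
    "\<Phi> \<in> mod_iso R (dsum X P) (dsum Y K)"
    "\<And>x. x \<in> carrier X \<Longrightarrow> fst (\<Phi> (x, \<zero>\<^bsub>P\<^esub>)) = \<psi> x"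
proof -
  obtain \<chi> and Q :: "'a umod" and t s and P :: "'a umod" and u v where
    \<psi>: "\<psi> \<in> mod_hom R X Y" and \<chi>: "\<chi> \<in> mod_hom R Y X"
    and Q: "projective R Q" and t: "t \<in> mod_hom R X Q" and s: "s \<in> mod_hom R Q X"
    and P: "projective R P" and u: "u \<in> mod_hom R Y P" and v: "v \<in> mod_hom R P Y"
    and st: "\<And>x. x \<in> carrier X \<Longrightarrow> \<chi> (\<psi> x) = x \<oplus>\<^bsub>X\<^esub> s (t x)"
    and vu: "\<And>y. y \<in> carrier Y \<Longrightarrow> \<psi> (\<chi> y) = y \<oplus>\<^bsub>Y\<^esub> v (u y)"
    by (rule stable_isoE[OF iso X Y]) blast
  have mP: "module R P" by (rule projective_module[OF P])
  note D = module_dsum[OF X mP]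
  interpret X: module R X by fact
  interpret Y: module R Y by fact
  interpret P: module R P by fact
  interpret D: module R "dsum X P" by fact
  \<comment> \<open>The sign turns \<open>\<psi> \<circ> \<chi>\<close> = id + v u into the
    splitting \<open>\<psi> \<circ> \<chi>\<close> + w u = id.\<close>
  note w = mod_hom_uminus[OF Y v]
  note simps = mod_hom_simps[OF X Y \<psi>] mod_hom_simps[OF Y X \<chi>] mod_hom_simps[OF mP Y v]
    mod_hom_simps[OF Y mP u]
  have sec: "\<psi> (\<chi> y) \<oplus>\<^bsub>Y\<^esub> \<ominus>\<^bsub>Y\<^esub> v (u y) = y" if "y \<in> carrier Y" for y
  proof -
    have "v (u y) \<in> carrier Y" using that by (simp add: simps)
    with that show ?thesis unfolding vu[OF that] by algebra
  qed
  define \<rho> where "\<rho> = row_map Y \<psi> (\<lambda>z. \<ominus>\<^bsub>Y\<^esub> v z)"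
  have \<rho>: "\<rho> \<in> mod_hom R (dsum X P) Y" unfolding \<rho>_def by (rule mod_hom_row_map[OF Y \<psi> w])
  define \<sigma> where "\<sigma> y = (\<chi> y, u y)" for y
  have \<sigma>: "\<sigma> \<in> mod_hom R Y (dsum X P)" unfolding \<sigma>_def by (rule mod_hom_Pair[OF \<chi> u])
  have \<rho>\<sigma>: "\<rho> (\<sigma> y) = y" if "y \<in> carrier Y" for y
    using sec[OF that] by (simp add: \<rho>_def \<sigma>_def row_map_def)
  let ?K = "kernel_module (dsum X P) Y \<rho>"
  have "projective R ?K"
    unfolding \<rho>_def by (rule projective_stable_iso_kernel[OF X Y P Q \<psi> \<chi> w u s t sec st])
  then obtain K :: "'a umod" and h k where K: "projective R K" and h: "h \<in> mod_hom R ?K K"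
    and k: "k \<in> mod_hom R K ?K"
    and kh: "\<And>x. x \<in> carrier ?K \<Longrightarrow> k (h x) = x" and hk: "\<And>y. y \<in> carrier K \<Longrightarrow> h (k y) = y"
    using projective_umodE by metis
  note e = split_surj_kernel_retraction[OF D Y \<rho> \<sigma> \<rho>\<sigma>]
  \<comment> \<open>A split surjection decomposes its source into the target and the kernel;
    \<open>h\<close> and \<open>k\<close> exchange the kernel with its copy \<open>K\<close> in the
    universe.\<close>
  let ?\<Phi> = "\<lambda>z. (\<rho> z, h (z \<ominus>\<^bsub>dsum X P\<^esub> \<sigma> (\<rho> z)))"
  let ?\<Phi>' = "\<lambda>z. \<sigma> (fst z) \<oplus>\<^bsub>dsum X P\<^esub> id (k (snd z))"
  have \<Phi>: "?\<Phi> \<in> mod_hom R (dsum X P) (dsum Y K)"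
    by (rule mod_hom_Pair[OF \<rho> mod_hom_compose[OF e(1) h]])
  have \<Phi>': "?\<Phi>' \<in> mod_hom R (dsum Y K) (dsum X P)"
    by (intro mod_hom_plus[OF D] mod_hom_compose[OF mod_hom_fst \<sigma>]
        mod_hom_compose[OF mod_hom_snd mod_hom_compose[OF k mod_hom_kernel_module_incl]])
  have kcl: "k y \<in> carrier (dsum X P)" "\<rho> (k y) = \<zero>\<^bsub>Y\<^esub>" if "y \<in> carrier K" for y
    using mod_hom_closed[OF k that] by auto
  have "?\<Phi> \<in> mod_iso R (dsum X P) (dsum Y K)"
  proof (rule mod_isoI[OF \<Phi> \<Phi>'])
    fix z assume z: "z \<in> carrier (dsum X P)"
    have c: "\<sigma> (\<rho> z) \<in> carrier (dsum X P)" by (intro mod_hom_closed[OF \<sigma>] mod_hom_closed[OF \<rho>] z)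
    have "\<sigma> (\<rho> z) \<oplus>\<^bsub>dsum X P\<^esub> (z \<ominus>\<^bsub>dsum X P\<^esub> \<sigma> (\<rho> z)) = z" using z c by algebra
    then show "?\<Phi>' (?\<Phi> z) = z" using kh[OF mod_hom_closed[OF e(1) z]] by simp
  next
    fix z assume "z \<in> carrier (dsum Y K)"
    then obtain y x where z: "z = (y, x)" "y \<in> carrier Y" "x \<in> carrier K" by auto
    have c: "\<sigma> y \<in> carrier (dsum X P)" by (rule mod_hom_closed[OF \<sigma> z(2)])
    have 1: "\<rho> (\<sigma> y \<oplus>\<^bsub>dsum X P\<^esub> k x) = y"
      using z c kcl[OF z(3)] by (simp add: mod_hom_add[OF \<rho>] \<rho>\<sigma> del: carrier_dsum)
    have "\<sigma> y \<oplus>\<^bsub>dsum X P\<^esub> k x \<ominus>\<^bsub>dsum X P\<^esub> \<sigma> y = k x"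
      using c kcl(1)[OF z(3)] by algebra
    then show "?\<Phi> (?\<Phi>' z) = z" using z 1 hk by simp
  qed
  moreover have "fst (?\<Phi> (x, \<zero>\<^bsub>P\<^esub>)) = \<psi> x" if "x \<in> carrier X" for x
    using that by (simp add: \<rho>_def row_map_def simps Y.M.a_inv_zero)
  ultimately show thesis by (intro that[OF P K]) auto
qed

text \<open>An endomorphism \<open>r\<close> that vanishes on the kernel of \<open>p\<close> and
  satisfies \<open>p \<circ> r\<close> = \<open>p\<close> is a section of \<open>p\<close> in
  disguise: it factors as \<open>s \<circ> p\<close>, and then \<open>p \<circ> s\<close> is the
  identity.\<close>

lemma projective_quotient_retract:
  fixes R :: "('a, 'm) ring_scheme"
  assumes P: "projective R P" and K: "module R K"
    and p: "p \<in> mod_hom R P K" "p ` carrier P = carrier K"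
    and r: "r \<in> mod_hom R P P" "\<And>x. x \<in> carrier P \<Longrightarrow> p (r x) = p x"
      "\<And>x. x \<in> carrier P \<Longrightarrow> p x = \<zero>\<^bsub>K\<^esub> \<Longrightarrow> r x = \<zero>\<^bsub>P\<^esub>"
  shows "projective R K"
proof -
  note mP = projective_module[OF P]
  obtain s where s: "s \<in> mod_hom R K P" "\<And>x. x \<in> carrier P \<Longrightarrow> s (p x) = r x"
    using mod_hom_factor_surj[OF mP K mP p r(1,3)] by metis
  have "p (s y) = y" if "y \<in> carrier K" for y
  proof -
    obtain x where "x \<in> carrier P" "y = p x" using \<open>y \<in> carrier K\<close> unfolding p(2)[symmetric] by blast
    then show ?thesis by (simp add: s(2) r(2))
  qed
  then show ?thesis by (rule projective_retract[OF P K s(1) p(1)])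
qed


text \<open>The summands added are 0 -> F0 = F0 on one side and 0 -> P0 = P0 on the other, with F0
  and P0 copies of \<open>F\<close> and \<open>P\<close>. Thus \<open>A\<close> acquires a zero
  summand and the isomorphism on the left can be the identity.\<close>

lemma isomorphic_upto_trivial_of_extends:
  fixes R :: "('a, 'm) ring_scheme"
  assumes P: "projective R P" and F: "projective R F" and Bm: "module R B"
    and se: "short_exact R A (col_map f q) (dsum B P) p C"
    and se': "short_exact R A (col_map f \<epsilon>) (dsum B F) p' C'"
    and q: "q \<in> mod_hom R A P" and \<epsilon>: "\<epsilon> \<in> mod_hom R A F"
    and ext: "extends_functionals R A (col_map f q) (dsum B P)"
    and ext': "extends_functionals R A (col_map f \<epsilon>) (dsum B F)"
  shows "isomorphic_upto_trivial R A (col_map f q) (dsum B P) p C A (col_map f \<epsilon>) (dsum B F) p' C'"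
proof -
  let ?D = "dsum B P" and ?D' = "dsum B F"
  have A: "module R A" and C: "module R C" and C': "module R C'" and D: "module R ?D" and D': "module R ?D'"
    and i: "col_map f q \<in> mod_hom R A ?D" and i': "col_map f \<epsilon> \<in> mod_hom R A ?D'"
    and p: "p \<in> mod_hom R ?D C" and p': "p' \<in> mod_hom R ?D' C'"
    and im: "col_map f q ` carrier A = a_kernel ?D C p"
    and im': "col_map f \<epsilon> ` carrier A = a_kernel ?D' C' p'"
    and surj: "p ` carrier ?D = carrier C" and surj': "p' ` carrier ?D' = carrier C'"
    using se se' by (simp_all add: short_exact_def)
  have mP: "module R P" and mF: "module R F" using P F by (simp_all add: projective_module)
  interpret A: module R A by fact
  interpret P: module R P by fact
  interpret F: module R F by fact
  note R = A.R.is_cring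
  \<comment> \<open>Each sequence extends the other one's second component: \<open>V\<close>
    recovers \<open>q\<close> from (f, \<open>\<epsilon>\<close>), and \<open>W\<close> recovers
    \<open>\<epsilon>\<close> from (f, q).\<close>
  obtain V where V: "V \<in> mod_hom R ?D' P" "\<And>x. x \<in> carrier A \<Longrightarrow> V (f x, \<epsilon> x) = q x"
    using extends_functionals_projective[OF ext' A D' P q i'] unfolding col_map_def by blast
  obtain W where W: "W \<in> mod_hom R ?D F" "\<And>x. x \<in> carrier A \<Longrightarrow> W (f x, q x) = \<epsilon> x"
    using extends_functionals_projective[OF ext A D F \<epsilon> i] unfolding col_map_def by blast
  obtain P0 :: "'a umod" and hP kP where P0: "projective R P0" and hP: "hP \<in> mod_hom R P P0"
    and kP: "kP \<in> mod_hom R P0 P" and kh_P: "\<And>x. x \<in> carrier P \<Longrightarrow> kP (hP x) = x"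
    and hk_P: "\<And>y. y \<in> carrier P0 \<Longrightarrow> hP (kP y) = y"
    by (rule projective_umodE[OF P]) blast
  obtain F0 :: "'a umod" and hF kF where F0: "projective R F0" and hF: "hF \<in> mod_hom R F F0"
    and kF: "kF \<in> mod_hom R F0 F" and kh_F: "\<And>x. x \<in> carrier F \<Longrightarrow> kF (hF x) = x"
    and hk_F: "\<And>y. y \<in> carrier F0 \<Longrightarrow> hF (kF y) = y"
    by (rule projective_umodE[OF F]) blast
  have mP0: "module R P0" and mF0: "module R F0" using P0 F0 by (simp_all add: projective_module)
  let ?Z = "zero_umod :: 'a umod"
  have Z: "module R ?Z" by (rule module_zero_umod[OF R])
  interpret P0: module R P0 by fact
  interpret F0: module R F0 by fact
  note simps = mod_hom_simps[OF D' mP V(1)] mod_hom_simps[OF D mF W(1)] mod_hom_simps[OF mP mP0 hP]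
    mod_hom_simps[OF mP0 mP kP] mod_hom_simps[OF mF mF0 hF] mod_hom_simps[OF mF0 mF kF]
    mod_hom_simps[OF A mP q] mod_hom_simps[OF A mF \<epsilon>] kh_P hk_P kh_F hk_F
  have fcl: "f x \<in> carrier B" if "x \<in> carrier A" for x
    using mod_hom_closed[OF i that] by (simp add: col_map_def)
  have trivial: "trivial_sequence R ?Z (\<lambda>_. \<zero>\<^bsub>N\<^esub>) N id N" if N: "projective R N" for N :: "'a umod"
  proof -
    have mN: "module R N" by (rule projective_module[OF N])
    interpret N: module R N by fact
    have "(\<lambda>_. \<zero>\<^bsub>N\<^esub>) ` carrier ?Z = a_kernel N N id" by (auto simp: a_kernel_def')
    then have "short_exact R ?Z (\<lambda>_. \<zero>\<^bsub>N\<^esub>) N id N"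
      unfolding short_exact_def using Z mN mod_hom_zero_map[OF mN] mod_hom_id by auto
    then show ?thesis unfolding trivial_sequence_def
      using N projective_zero_umod[OF R] mod_hom_zero_map[OF Z, of N] by auto
  qed
  \<comment> \<open>The composite of two shears: the first turns \<open>(f, q, 0)\<close> into \<open>(f, q, \<epsilon>)\<close>, the second removes \<open>q\<close>.\<close>
  define W' where "W' = (\<lambda>((x, z), y). kF y \<oplus>\<^bsub>F\<^esub> W (x, z))"
  define b where "b = (\<lambda>((x, z), y). ((x, W' ((x, z), y)), hP (z \<ominus>\<^bsub>P\<^esub> V (x, W' ((x, z), y)))))"
  \<comment> \<open>The inverse undoes the two shears in reverse order: first \<open>V\<close> is
    added back, then \<open>W\<close> is subtracted at the restored point.\<close>
  define V' where "V' = (\<lambda>((x, y), z). kP z \<oplus>\<^bsub>P\<^esub> V (x, y))"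
  define b' where "b' = (\<lambda>((x, y), z). ((x, V' ((x, y), z)), hF (y \<ominus>\<^bsub>F\<^esub> W (x, V' ((x, y), z)))))"
  note DF = module_dsum[OF D mF0] and D'P = module_dsum[OF D' mP0]
  have W': "W' \<in> mod_hom R (dsum ?D F0) F"
  proof -
    have "(\<lambda>z. kF (snd z) \<oplus>\<^bsub>F\<^esub> W (fst z)) \<in> mod_hom R (dsum ?D F0) F"
      by (intro mod_hom_plus[OF mF] mod_hom_compose[OF mod_hom_snd kF] mod_hom_compose[OF mod_hom_fst W(1)])
    then show ?thesis by (simp add: W'_def case_prod_beta')
  qed
  have V': "V' \<in> mod_hom R (dsum ?D' P0) P"
  proof -
    have "(\<lambda>z. kP (snd z) \<oplus>\<^bsub>P\<^esub> V (fst z)) \<in> mod_hom R (dsum ?D' P0) P"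
      by (intro mod_hom_plus[OF mP] mod_hom_compose[OF mod_hom_snd kP] mod_hom_compose[OF mod_hom_fst V(1)])
    then show ?thesis by (simp add: V'_def case_prod_beta')
  qed
  have b: "b \<in> mod_hom R (dsum ?D F0) (dsum ?D' P0)"
  proof -
    note x = mod_hom_Pair[OF mod_hom_compose[OF mod_hom_fst mod_hom_fst] W']
    have "(\<lambda>t. ((fst (fst t), W' t), hP (snd (fst t) \<ominus>\<^bsub>P\<^esub> V (fst (fst t), W' t))))
      \<in> mod_hom R (dsum ?D F0) (dsum ?D' P0)"
      by (intro mod_hom_Pair[OF x] mod_hom_compose[OF _ hP] mod_hom_diff[OF mP]
          mod_hom_compose[OF mod_hom_fst mod_hom_snd] mod_hom_compose[OF x V(1)])
    then show ?thesis by (simp add: b_def case_prod_beta')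
  qed
  have b': "b' \<in> mod_hom R (dsum ?D' P0) (dsum ?D F0)"
  proof -
    note x = mod_hom_Pair[OF mod_hom_compose[OF mod_hom_fst mod_hom_fst] V']
    have "(\<lambda>t. ((fst (fst t), V' t), hF (snd (fst t) \<ominus>\<^bsub>F\<^esub> W (fst (fst t), V' t))))
      \<in> mod_hom R (dsum ?D' P0) (dsum ?D F0)"
      by (intro mod_hom_Pair[OF x] mod_hom_compose[OF _ hF] mod_hom_diff[OF mF]
          mod_hom_compose[OF mod_hom_fst mod_hom_snd] mod_hom_compose[OF x W(1)])
    then show ?thesis by (simp add: b'_def case_prod_beta')
  qed
  have b'b: "b' (b t) = t" if "t \<in> carrier (dsum ?D F0)" for t
  proof -
    from that obtain x z y where t: "t = ((x, z), y)" "x \<in> carrier B" "z \<in> carrier P" "y \<in> carrier F0"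
      by auto
    let ?w = "W' ((x, z), y)"
    have w: "?w \<in> carrier F" using t by (simp add: W'_def simps)
    have v: "V (x, ?w) \<in> carrier P" using t w by (simp add: simps)
    have "z \<ominus>\<^bsub>P\<^esub> V (x, ?w) \<oplus>\<^bsub>P\<^esub> V (x, ?w) = z" using t(3) v by algebra
    moreover have "?w \<ominus>\<^bsub>F\<^esub> W (x, z) = kF y"
    proof -
      have "W (x, z) \<in> carrier F" "kF y \<in> carrier F" using t by (simp_all add: simps)
      then show ?thesis unfolding W'_def prod.case by algebra
    qed
    ultimately show ?thesis using t w v by (simp add: b_def b'_def V'_def simps)
  qed
  have bb': "b (b' t) = t" if "t \<in> carrier (dsum ?D' P0)" for t
  proof -
    from that obtain x z y where t: "t = ((x, y), z)" "x \<in> carrier B" "y \<in> carrier F" "z \<in> carrier P0"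
      by auto
    let ?v = "V' ((x, y), z)"
    have v: "?v \<in> carrier P" using t by (simp add: V'_def simps)
    have w: "W (x, ?v) \<in> carrier F" using t v by (simp add: simps)
    have "y \<ominus>\<^bsub>F\<^esub> W (x, ?v) \<oplus>\<^bsub>F\<^esub> W (x, ?v) = y" using t(3) w by algebra
    moreover have "?v \<ominus>\<^bsub>P\<^esub> V (x, y) = kP z"
    proof -
      have "V (x, y) \<in> carrier P" "kP z \<in> carrier P" using t by (simp_all add: simps)
      then show ?thesis unfolding V'_def prod.case by algebra
    qed
    ultimately show ?thesis using t w v by (simp add: b_def b'_def W'_def simps)
  qed
  \<comment> \<open>At (f x, q x, 0) the new middle coordinate is \<open>W (f x, q x)\<close> =
    \<open>\<epsilon> x\<close>, and the last one becomes \<open>q x - V (f x, \<epsilon> x)\<close>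
    = 0.\<close>
  have bi: "b (col_map f q x, \<zero>\<^bsub>F0\<^esub>) = (col_map f \<epsilon> x, \<zero>\<^bsub>P0\<^esub>)" if "x \<in> carrier A" for x
    using that fcl[OF that]
    by (simp add: b_def W'_def col_map_def simps V(2) W(2) P0.M.minus_eq_zero_iff)
  let ?p = "map_prod p id" and ?p' = "map_prod p' id"
  have map_prod_id: "map_prod g id \<in> mod_hom R (dsum M N) (dsum M' N)" if "g \<in> mod_hom R M M'"
    for g and M :: "('a, 'x) module" and M' :: "('a, 'y) module" and N :: "('a, 'z) module"
  proof -
    have "(\<lambda>z. (g (fst z), snd z)) \<in> mod_hom R (dsum M N) (dsum M' N)"
      by (intro mod_hom_Pair mod_hom_compose[OF mod_hom_fst that] mod_hom_snd)
    then show ?thesis by (simp add: map_prod_def case_prod_beta')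
  qed
  have ker: "?p t = \<zero>\<^bsub>dsum C F0\<^esub> \<longleftrightarrow> t \<in> (\<lambda>x. (col_map f q x, \<zero>\<^bsub>F0\<^esub>)) ` carrier A"
    if "t \<in> carrier (dsum ?D F0)" for t
  proof -
    from that obtain d y where t: "t = (d, y)" and d: "d \<in> carrier ?D"
      by (metis SigmaE carrier_dsum)
    have "p d = \<zero>\<^bsub>C\<^esub> \<longleftrightarrow> d \<in> col_map f q ` carrier A" using d unfolding im by (simp add: a_kernel_def')
    then show ?thesis by (auto simp: t)
  qed
  have ker': "?p' t = \<zero>\<^bsub>dsum C' P0\<^esub> \<longleftrightarrow> t \<in> (\<lambda>x. (col_map f \<epsilon> x, \<zero>\<^bsub>P0\<^esub>)) ` carrier A"
    if "t \<in> carrier (dsum ?D' P0)" for t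
  proof -
    from that obtain d y where t: "t = (d, y)" and d: "d \<in> carrier ?D'"
      by (metis SigmaE carrier_dsum)
    have "p' d = \<zero>\<^bsub>C'\<^esub> \<longleftrightarrow> d \<in> col_map f \<epsilon> ` carrier A" using d unfolding im' by (simp add: a_kernel_def')
    then show ?thesis by (auto simp: t)
  qed
  have icl: "(col_map f q x, \<zero>\<^bsub>F0\<^esub>) \<in> carrier (dsum ?D F0)" if "x \<in> carrier A" for x
    using mod_hom_closed[OF i that] by simp
  \<comment> \<open>Both kernels are copies of \<open>A\<close> in the middle terms, and the
    bijection \<open>b\<close> matches these copies by \<open>bi\<close>.\<close>
  have ker_iff: "?p t = \<zero>\<^bsub>dsum C F0\<^esub> \<longleftrightarrow> ?p' (b t) = \<zero>\<^bsub>dsum C' P0\<^esub>"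
    if t: "t \<in> carrier (dsum ?D F0)" for t
  proof -
    have "b t \<in> (\<lambda>x. (col_map f \<epsilon> x, \<zero>\<^bsub>P0\<^esub>)) ` carrier A \<longleftrightarrow> b t \<in> b ` (\<lambda>x. (col_map f q x, \<zero>\<^bsub>F0\<^esub>)) ` carrier A"
      by (simp add: image_image bi cong: image_cong_simp)
    also have "\<dots> \<longleftrightarrow> t \<in> (\<lambda>x. (col_map f q x, \<zero>\<^bsub>F0\<^esub>)) ` carrier A"
      using b'b[OF t] b'b[OF icl] by (metis (no_types, lifting) image_iff)
    finally show ?thesis using ker[OF t] ker'[OF mod_hom_closed[OF b t]] by simp
  qed
  have surj_p: "?p ` carrier (dsum ?D F0) = carrier (dsum C F0)"
    using surj by (simp add: map_prod_surj_on)
  have surj_p': "?p' ` carrier (dsum ?D' P0) = carrier (dsum C' P0)"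
    using surj' by (simp add: map_prod_surj_on)
  obtain \<gamma> where \<gamma>: "\<gamma> \<in> mod_iso R (dsum C F0) (dsum C' P0)"
    "\<And>t. t \<in> carrier (dsum ?D F0) \<Longrightarrow> \<gamma> (?p t) = ?p' (b t)"
    by (rule mod_iso_on_quotients[OF DF D'P module_dsum[OF C mF0] module_dsum[OF C' mP0]
        map_prod_id[OF p] surj_p map_prod_id[OF p'] surj_p' b b' b'b bb' ker_iff]) blast+
  have "isomorphic_sequences R
      (dsum A ?Z) (map_prod (col_map f q) (\<lambda>_. \<zero>\<^bsub>F0\<^esub>)) (dsum ?D F0) ?p (dsum C F0)
      (dsum A ?Z) (map_prod (col_map f \<epsilon>) (\<lambda>_. \<zero>\<^bsub>P0\<^esub>)) (dsum ?D' P0) ?p' (dsum C' P0)"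
    unfolding isomorphic_sequences_def sequence_hom_def
  proof (intro bexI conjI ballI)
    show "id \<in> mod_iso R (dsum A ?Z) (dsum A ?Z)" by (rule mod_isoI[OF mod_hom_id mod_hom_id]) auto
    show "b \<in> mod_iso R (dsum ?D F0) (dsum ?D' P0)" by (rule mod_isoI[OF b b' b'b bb'])
    show "\<gamma> \<in> mod_iso R (dsum C F0) (dsum C' P0)" by (rule \<gamma>(1))
    then show "\<gamma> \<in> mod_hom R (dsum C F0) (dsum C' P0)" by (simp add: mod_iso_def)
  qed (auto simp: mod_hom_id b bi \<gamma>(2) simp del: map_prod_simp, simp_all add: bi)
  with trivial[OF P0] trivial[OF F0] show ?thesis
    unfolding isomorphic_upto_trivial_def by blast
qed

text \<open>The kernels \<open>K1 \<rightarrow> K2 \<rightarrow> K3\<close> of the three split-up vertical maps form an exact sequence; \<open>K1\<close> and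
  \<open>K2\<close> are projective, and since functionals extend along \<open>i\<close> the map \<open>K1 \<rightarrow> K2\<close> splits.\<close>

lemma projective_kernel_of_sequence_hom:
  fixes R :: "('a, 'm) ring_scheme"
    and A :: "('a, 'b) module" and M :: "('a, 'c) module" and L :: "('a, 'd) module"
  assumes se: "short_exact R A i M c L" and se': "short_exact R A' i' N p C"
    and ext: "extends_functionals R A i M"
    and hom: "sequence_hom R A i M c L A' i' N p C \<alpha> \<beta> \<gamma>"
    and \<alpha>_iso: "stable_iso R A A' \<alpha>" and \<beta>_iso: "stable_iso R M N \<beta>"
  obtains Q Q' :: "'a umod" and s j where "projective R Q" "projective R Q'" "s \<in> mod_hom R Q C"
    "short_exact R Q' j (dsum L Q) (row_map C \<gamma> s) C"
proof -
  have A: "module R A" and M: "module R M" and L: "module R L"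
    and A': "module R A'" and N: "module R N" and C: "module R C"
    and i: "i \<in> mod_hom R A M" and c: "c \<in> mod_hom R M L"
    and i': "i' \<in> mod_hom R A' N" and p: "p \<in> mod_hom R N C"
    and im: "i ` carrier A = a_kernel M L c" and im': "i' ` carrier A' = a_kernel N C p"
    and csurj: "c ` carrier M = carrier L" and psurj: "p ` carrier N = carrier C"
    using se se' by (simp_all add: short_exact_def)
  have \<alpha>: "\<alpha> \<in> mod_hom R A A'" and \<beta>: "\<beta> \<in> mod_hom R M N" and \<gamma>: "\<gamma> \<in> mod_hom R L C"
    and \<beta>i: "\<And>x. x \<in> carrier A \<Longrightarrow> \<beta> (i x) = i' (\<alpha> x)"
    and \<gamma>c: "\<And>y. y \<in> carrier M \<Longrightarrow> \<gamma> (c y) = p (\<beta> y)"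
    using hom unfolding sequence_hom_def by blast+
  interpret A: module R A by fact
  interpret M: module R M by fact
  interpret L: module R L by fact
  interpret A': module R A' by fact
  interpret N: module R N by fact
  interpret C: module R C by fact
  note selfR = module_self_module[OF A.R.is_cring]
  obtain \<alpha>' and Q1 :: "'a umod" and t1 s1 and P1 :: "'a umod" and u1 v1 where
    \<alpha>': "\<alpha>' \<in> mod_hom R A' A"
    and Q1: "projective R Q1" and t1: "t1 \<in> mod_hom R A Q1" and s1: "s1 \<in> mod_hom R Q1 A"
    and P1: "projective R P1" and u1: "u1 \<in> mod_hom R A' P1" and v1: "v1 \<in> mod_hom R P1 A'"
    and st1: "\<And>x. x \<in> carrier A \<Longrightarrow> \<alpha>' (\<alpha> x) = x \<oplus>\<^bsub>A\<^esub> s1 (t1 x)"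
    and vu1: "\<And>y. y \<in> carrier A' \<Longrightarrow> \<alpha> (\<alpha>' y) = y \<oplus>\<^bsub>A'\<^esub> v1 (u1 y)"
    by (rule stable_isoE[OF \<alpha>_iso A A']) blast
  obtain \<beta>' and Q2 :: "'a umod" and t2 s2 and P2 :: "'a umod" and u2 v2 where
    \<beta>': "\<beta>' \<in> mod_hom R N M"
    and Q2: "projective R Q2" and t2: "t2 \<in> mod_hom R M Q2" and s2: "s2 \<in> mod_hom R Q2 M"
    and P2: "projective R P2" and u2: "u2 \<in> mod_hom R N P2" and v2: "v2 \<in> mod_hom R P2 N"
    and st2: "\<And>x. x \<in> carrier M \<Longrightarrow> \<beta>' (\<beta> x) = x \<oplus>\<^bsub>M\<^esub> s2 (t2 x)"
    and vu2: "\<And>y. y \<in> carrier N \<Longrightarrow> \<beta> (\<beta>' y) = y \<oplus>\<^bsub>N\<^esub> v2 (u2 y)"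
    by (rule stable_isoE[OF \<beta>_iso M N]) blast
  have mP1: "module R P1" and mP2: "module R P2" using P1 P2 by (simp_all add: projective_module)
  interpret P1: module R P1 by fact
  interpret P2: module R P2 by fact
  \<comment> \<open>As with single stable isomorphisms, the sign makes
    \<open>\<alpha> \<circ> \<alpha>'\<close> + w1 u1 the identity, and likewise for
    \<open>\<beta>\<close>.\<close>
  define w1 where "w1 z = \<ominus>\<^bsub>A'\<^esub> v1 z" for z
  define w2 where "w2 z = \<ominus>\<^bsub>N\<^esub> v2 z" for z
  have w1: "w1 \<in> mod_hom R P1 A'" unfolding w1_def by (rule mod_hom_uminus[OF A' v1])
  have w2: "w2 \<in> mod_hom R P2 N" unfolding w2_def by (rule mod_hom_uminus[OF N v2])
  have sec1: "\<alpha> (\<alpha>' y) \<oplus>\<^bsub>A'\<^esub> w1 (u1 y) = y" if "y \<in> carrier A'" for y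
  proof -
    have "v1 (u1 y) \<in> carrier A'" by (intro mod_hom_closed[OF v1] mod_hom_closed[OF u1] that)
    with that show ?thesis unfolding vu1[OF that] w1_def by algebra
  qed
  have sec2: "\<beta> (\<beta>' y) \<oplus>\<^bsub>N\<^esub> w2 (u2 y) = y" if "y \<in> carrier N" for y
  proof -
    have "v2 (u2 y) \<in> carrier N" by (intro mod_hom_closed[OF v2] mod_hom_closed[OF u2] that)
    with that show ?thesis unfolding vu2[OF that] w2_def by algebra
  qed
  note simps = mod_hom_simps[OF A M i] mod_hom_simps[OF M L c] mod_hom_simps[OF A' N i']
    mod_hom_simps[OF N C p] mod_hom_simps[OF A A' \<alpha>] mod_hom_simps[OF M N \<beta>] mod_hom_simps[OF L C \<gamma>]
    mod_hom_simps[OF mP1 A' w1] mod_hom_simps[OF mP2 N w2] mod_hom_simps[OF A' A \<alpha>'] mod_hom_simps[OF N M \<beta>']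
    mod_hom_simps[OF A' mP1 u1] mod_hom_simps[OF N mP2 u2]
  have ci: "c (i x) = \<zero>\<^bsub>L\<^esub>" if "x \<in> carrier A" for x using im that by (auto simp: a_kernel_def')
  have pi: "p (i' x) = \<zero>\<^bsub>C\<^esub>" if "x \<in> carrier A'" for x using im' that by (auto simp: a_kernel_def')

  \<comment> \<open>The upper row is enlarged by the split sequence P1 -> P1 + P2 -> P2, and the
    vertical maps \<open>\<rho>1\<close>, \<open>\<rho>2\<close>, \<open>\<rho>3\<close> become
    surjective. On P1 the middle map has to be \<open>i' \<circ> w1\<close> for the left square to
    commute, and on P2 the right map has to be \<open>p \<circ> w2\<close>.\<close>
  define Z1 where "Z1 = dsum A P1"
  define \<rho>1 where "\<rho>1 = row_map A' \<alpha> w1"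
  define P12 where "P12 = dsum P1 P2"
  define w where "w = row_map N (\<lambda>z. i' (w1 z)) w2"
  define Z2 where "Z2 = dsum M P12"
  define \<rho>2 where "\<rho>2 = row_map N \<beta> w"
  define Z3 where "Z3 = dsum L P2"
  define \<rho>3 where "\<rho>3 = row_map C \<gamma> (\<lambda>z. p (w2 z))"
  have pP12: "projective R P12" unfolding P12_def by (rule projective_dsum[OF P1 P2])
  then have mP12: "module R P12" by (rule projective_module)
  have w: "w \<in> mod_hom R P12 N"
    unfolding w_def P12_def by (rule mod_hom_row_map[OF N mod_hom_compose[OF w1 i'] w2])
  have mZ1: "module R Z1" unfolding Z1_def by (rule module_dsum[OF A mP1])
  have mZ2: "module R Z2" unfolding Z2_def by (rule module_dsum[OF M mP12])
  have mZ3: "module R Z3" unfolding Z3_def by (rule module_dsum[OF L mP2])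
  interpret Z2: module R Z2 by fact
  interpret Z3: module R Z3 by fact
  have \<rho>1: "\<rho>1 \<in> mod_hom R Z1 A'" unfolding \<rho>1_def Z1_def by (rule mod_hom_row_map[OF A' \<alpha> w1])
  have \<rho>2: "\<rho>2 \<in> mod_hom R Z2 N" unfolding \<rho>2_def Z2_def by (rule mod_hom_row_map[OF N \<beta> w])
  have \<rho>3: "\<rho>3 \<in> mod_hom R Z3 C"
    unfolding \<rho>3_def Z3_def by (rule mod_hom_row_map[OF C \<gamma> mod_hom_compose[OF w2 p]])
  define K1 where "K1 = kernel_module Z1 A' \<rho>1"
  define K2 where "K2 = kernel_module Z2 N \<rho>2"
  define K3 where "K3 = kernel_module Z3 C \<rho>3"
  have K1: "projective R K1" unfolding K1_def Z1_def \<rho>1_def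
    by (rule projective_stable_iso_kernel[OF A A' P1 Q1 \<alpha> \<alpha>' w1 u1 s1 t1 sec1 st1])
  \<comment> \<open>The section of \<open>\<rho>2\<close> has zero component in P1:
    \<open>\<beta>\<close> and \<open>w2\<close> already split it, while the summand P1 of
    \<open>Z2\<close> is there to receive \<open>I\<close>.\<close>
  have K2: "projective R K2" unfolding K2_def Z2_def \<rho>2_def
  proof (rule projective_stable_iso_kernel[OF M N pP12 Q2 \<beta> \<beta>' w _ s2 t2 _ st2])
    show "(\<lambda>y. (\<zero>\<^bsub>P1\<^esub>, u2 y)) \<in> mod_hom R N P12"
      unfolding P12_def by (rule mod_hom_Pair[OF mod_hom_zero_map[OF mP1] u2])
    show "\<beta> (\<beta>' y) \<oplus>\<^bsub>N\<^esub> w (\<zero>\<^bsub>P1\<^esub>, u2 y) = y" if "y \<in> carrier N" for y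
      using that sec2[OF that] by (simp add: w_def row_map_def simps)
  qed
  have mK1: "module R K1" and mK2: "module R K2" using K1 K2 by (simp_all add: projective_module)
  have mK3: "module R K3" unfolding K3_def by (rule module_kernel_module[OF mZ3 C \<rho>3])
  define I :: "'b \<times> 'a list set \<Rightarrow> 'c \<times> 'a list set \<times> 'a list set" where "I = (\<lambda>z. (i (fst z), (snd z, \<zero>\<^bsub>P2\<^esub>)))"
  have I: "I \<in> mod_hom R Z1 Z2" unfolding I_def Z1_def Z2_def P12_def
    by (intro mod_hom_Pair mod_hom_compose[OF mod_hom_fst i] mod_hom_snd mod_hom_zero_map mP2)
  have extI: "extends_functionals R Z1 I Z2"
    unfolding extends_functionals_def
  proof
    fix \<phi> assume \<phi>: "\<phi> \<in> mod_hom R Z1 (self_module R)"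
    note \<phi>' = \<phi>[unfolded Z1_def]
    obtain \<psi> where \<psi>: "\<psi> \<in> mod_hom R M (self_module R)" "\<And>x. x \<in> carrier A \<Longrightarrow> \<psi> (i x) = \<phi> (x, \<zero>\<^bsub>P1\<^esub>)"
      using bspec[OF ext[unfolded extends_functionals_def] mod_hom_compose[OF mod_hom_Pair_zero[OF mP1] \<phi>']]
      by blast
    \<comment> \<open>The functional is extended from \<open>A\<close> to \<open>M\<close> by
      \<open>ext\<close>, kept on P1 and taken to be zero on P2.\<close>
    let ?w = "\<lambda>z. \<psi> (fst z) \<oplus>\<^bsub>self_module R\<^esub> \<phi> (\<zero>\<^bsub>A\<^esub>, fst (snd z))"
    have whom: "?w \<in> mod_hom R Z2 (self_module R)" unfolding Z2_def P12_def
      by (intro mod_hom_plus[OF selfR] mod_hom_compose[OF mod_hom_fst \<psi>(1)]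
          mod_hom_compose[OF mod_hom_compose[OF mod_hom_snd mod_hom_fst]
            mod_hom_compose[OF mod_hom_zero_Pair[OF A] \<phi>']])
    have "?w (I z) = \<phi> z" if zZ: "z \<in> carrier Z1" for z
    proof -
      obtain x y where z: "z = (x, y)" "x \<in> carrier A" "y \<in> carrier P1"
        using zZ by (auto simp: Z1_def)
      then show ?thesis
        using mod_hom_add[OF \<phi>', of "(x, \<zero>\<^bsub>P1\<^esub>)" "(\<zero>\<^bsub>A\<^esub>, y)"] by (simp add: I_def \<psi>(2))
    qed
    then show "\<exists>w\<in>mod_hom R Z2 (self_module R). \<forall>x\<in>carrier Z1. w (I x) = \<phi> x"
      by (intro bexI[OF _ whom] ballI)
  qed
  define \<sigma>1 where "\<sigma>1 y = (\<alpha>' y, u1 y)" for y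
  have \<sigma>1: "\<sigma>1 \<in> mod_hom R A' Z1" unfolding \<sigma>1_def Z1_def by (rule mod_hom_Pair[OF \<alpha>' u1])
  have \<rho>\<sigma>1: "\<rho>1 (\<sigma>1 y) = y" if "y \<in> carrier A'" for y
    using sec1[OF that] by (simp add: \<rho>1_def \<sigma>1_def row_map_def)
  have e1: "(\<lambda>z. z \<ominus>\<^bsub>Z1\<^esub> \<sigma>1 (\<rho>1 z)) \<in> mod_hom R Z1 K1"
    "\<And>z. z \<in> carrier K1 \<Longrightarrow> z \<ominus>\<^bsub>Z1\<^esub> \<sigma>1 (\<rho>1 z) = z"
    unfolding K1_def by (rule split_surj_kernel_retraction[OF mZ1 A' \<rho>1 \<sigma>1 \<rho>\<sigma>1], assumption+)+
  \<comment> \<open>The projection of \<open>Z1\<close> onto K1 is a map into a projective module,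
    hence extends along \<open>I\<close>; restricted to K2 the extension is a retraction of K1 ->
    K2.\<close>
  obtain E where E: "E \<in> mod_hom R Z2 K1" and EI: "\<And>z. z \<in> carrier K1 \<Longrightarrow> E (I z) = z"
  proof -
    obtain E where E: "E \<in> mod_hom R Z2 K1"
      and EI: "\<And>z. z \<in> carrier Z1 \<Longrightarrow> E (I z) = z \<ominus>\<^bsub>Z1\<^esub> \<sigma>1 (\<rho>1 z)"
      by (rule extends_functionals_projective[OF extI mZ1 mZ2 K1 e1(1) I]) blast
    have "E (I z) = z" if "z \<in> carrier K1" for z
      using EI[of z] e1(2)[OF that] that by (simp add: K1_def)
    then show thesis by (rule that[OF E])
  qed
  have \<rho>I: "\<rho>2 (I z) = i' (\<rho>1 z)" if zZ: "z \<in> carrier Z1" for z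
  proof -
    obtain x y where z: "z = (x, y)" "x \<in> carrier A" "y \<in> carrier P1" using zZ by (auto simp: Z1_def)
    then show ?thesis by (simp add: \<rho>2_def \<rho>1_def I_def w_def row_map_def \<beta>i simps)
  qed
  have incl1: "id \<in> mod_hom R K1 Z1" and incl2: "id \<in> mod_hom R K2 Z2" and incl3: "id \<in> mod_hom R K3 Z3"
    unfolding K1_def K2_def K3_def by (rule mod_hom_kernel_module_incl)+
  have IE: "(\<lambda>k. I (id (E (id k)))) \<in> mod_hom R K2 Z2"
    by (intro mod_hom_compose[OF incl2 mod_hom_compose[OF E mod_hom_compose[OF incl1 I]]])
  \<comment> \<open>This is the projection of K2 with kernel \<open>I\<close> (K1), so it has the
    form required by \<open>projective_quotient_retract\<close> once K1 -> K2 -> K3 is shown to be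
    exact.\<close>
  define r where "r k = k \<ominus>\<^bsub>Z2\<^esub> I (E k)" for k
  have r: "r \<in> mod_hom R K2 K2"
    unfolding K2_def
  proof (rule mod_hom_kernel_moduleI, fold K2_def)
    show "r \<in> mod_hom R K2 Z2"
      using mod_hom_diff[OF mZ2 incl2 IE] by (simp add: r_def[abs_def] id_def)
    fix k assume k: "k \<in> carrier K2"
    then have k': "k \<in> carrier Z2" "\<rho>2 k = \<zero>\<^bsub>N\<^esub>" by (simp_all add: K2_def)
    have "E k \<in> carrier Z1" "\<rho>1 (E k) = \<zero>\<^bsub>A'\<^esub>" using mod_hom_closed[OF E k'(1)] by (simp_all add: K1_def)
    then have "\<rho>2 (I (E k)) = \<zero>\<^bsub>N\<^esub>" "I (E k) \<in> carrier Z2"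
      by (simp_all add: \<rho>I simps mod_hom_closed[OF I])
    then show "\<rho>2 (r k) = \<zero>\<^bsub>N\<^esub>"
      using k' by (simp add: r_def mod_hom_minus[OF mZ2 N \<rho>2] N.M.minus_zero_right)
  qed
  define \<pi> :: "'c \<times> 'a list set \<times> 'a list set \<Rightarrow> 'd \<times> 'a list set" where "\<pi> = (\<lambda>z. (c (fst z), snd (snd z)))"
  have \<pi>: "\<pi> \<in> mod_hom R Z2 Z3" unfolding \<pi>_def Z2_def Z3_def P12_def
    by (intro mod_hom_Pair mod_hom_compose[OF mod_hom_fst c] mod_hom_compose[OF mod_hom_snd mod_hom_snd])
  have \<rho>\<pi>: "\<rho>3 (\<pi> z) = p (\<rho>2 z)" if zZ: "z \<in> carrier Z2" for z
  proof -
    obtain m y x where z: "z = (m, (y, x))" "m \<in> carrier M" "y \<in> carrier P1" "x \<in> carrier P2"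
      using zZ by (auto simp: Z2_def P12_def)
    then show ?thesis
      by (simp add: \<rho>3_def \<rho>2_def \<pi>_def w_def row_map_def \<gamma>c simps pi)
  qed
  have \<pi>K: "\<pi> \<in> mod_hom R K2 K3" unfolding K3_def
  proof (rule mod_hom_kernel_moduleI)
    show "\<pi> \<in> mod_hom R K2 Z3" using mod_hom_compose[OF incl2 \<pi>] by simp
    show "\<rho>3 (\<pi> x) = \<zero>\<^bsub>C\<^esub>" if "x \<in> carrier K2" for x
      using that by (simp add: K2_def \<rho>\<pi> simps)
  qed
  have \<pi>I: "\<pi> (I z) = \<zero>\<^bsub>Z3\<^esub>" if "z \<in> carrier Z1" for z
    using that ci by (auto simp: Z1_def Z3_def \<pi>_def I_def)
  have "projective R K3"
  proof (rule projective_quotient_retract[OF K2 mK3 \<pi>K _ r])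
    show "\<pi> ` carrier K2 = carrier K3"
    proof
      show "carrier K3 \<subseteq> \<pi> ` carrier K2"
      proof
        fix k assume "k \<in> carrier K3"
        then obtain l z where k: "k = (l, z)" "l \<in> carrier L" "z \<in> carrier P2"
          and 0: "\<gamma> l \<oplus>\<^bsub>C\<^esub> p (w2 z) = \<zero>\<^bsub>C\<^esub>"
          by (auto simp: K3_def Z3_def \<rho>3_def row_map_def)
        have "l \<in> c ` carrier M" using k(2) by (simp add: csurj)
        then obtain m where m: "m \<in> carrier M" "c m = l" by blast
        have "p (\<beta> m) = \<gamma> l" using \<gamma>c[OF m(1)] m(2) by simp
        then have "p (\<beta> m \<oplus>\<^bsub>N\<^esub> w2 z) = \<zero>\<^bsub>C\<^esub>" using 0 m(1) k(3) by (simp add: simps)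
        then have "\<beta> m \<oplus>\<^bsub>N\<^esub> w2 z \<in> i' ` carrier A'"
          unfolding im' using m k by (simp add: a_kernel_def' simps)
        then obtain a where a: "a \<in> carrier A'" "\<beta> m \<oplus>\<^bsub>N\<^esub> w2 z = i' a" by blast
        let ?a = "\<alpha>' a" and ?y = "u1 a"
        have cl: "?a \<in> carrier A" "?y \<in> carrier P1" using a by (simp_all add: simps)
        \<comment> \<open>The naive lift (m, (0, z)) of k has \<open>\<rho>2\<close>-value
          \<open>i' a\<close>. Subtracting \<open>I (\<sigma>1 a)\<close> = (i
          (\<open>\<alpha>' a\<close>), (u1 a, 0)) removes it and does not change the image under
          \<open>\<pi>\<close>.\<close>
        let ?k = "(m \<ominus>\<^bsub>M\<^esub> i ?a, (\<ominus>\<^bsub>P1\<^esub> ?y, z))"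
        have kZ: "?k \<in> carrier Z2" using m cl k by (simp add: Z2_def P12_def simps)
        have n: "\<beta> m \<in> carrier N" "w2 z \<in> carrier N" "i' (\<alpha> ?a) \<in> carrier N" "i' (w1 ?y) \<in> carrier N"
          using m k cl by (simp_all add: simps)
        have "\<rho>2 ?k = (\<beta> m \<ominus>\<^bsub>N\<^esub> i' (\<alpha> ?a)) \<oplus>\<^bsub>N\<^esub> (\<ominus>\<^bsub>N\<^esub> i' (w1 ?y) \<oplus>\<^bsub>N\<^esub> w2 z)"
          using m k cl by (simp add: \<rho>2_def w_def row_map_def simps \<beta>i)
        also have "\<dots> = (\<beta> m \<oplus>\<^bsub>N\<^esub> w2 z) \<ominus>\<^bsub>N\<^esub> (i' (\<alpha> ?a) \<oplus>\<^bsub>N\<^esub> i' (w1 ?y))" using n by algebra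
        also have "i' (\<alpha> ?a) \<oplus>\<^bsub>N\<^esub> i' (w1 ?y) = i' (\<alpha> ?a \<oplus>\<^bsub>A'\<^esub> w1 ?y)" using cl by (simp add: simps)
        also have "\<dots> = i' a" by (simp add: sec1 a)
        also have "(\<beta> m \<oplus>\<^bsub>N\<^esub> w2 z) \<ominus>\<^bsub>N\<^esub> i' a = \<zero>\<^bsub>N\<^esub>" using a by (simp add: N.M.minus_eq_zero_iff simps)
        finally have "?k \<in> carrier K2" using kZ by (simp add: K2_def)
        moreover have "\<pi> ?k = k"
          using m k cl by (simp add: \<pi>_def simps ci L.M.minus_zero_right)
        ultimately show "k \<in> \<pi> ` carrier K2" by (metis image_eqI)
      qed
    qed (use mod_hom_closed[OF \<pi>K] in blast)
    show "\<pi> (r x) = \<pi> x" if x: "x \<in> carrier K2" for x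
    proof -
      have x': "x \<in> carrier Z2" using x by (simp add: K2_def)
      have e: "E x \<in> carrier Z1" using mod_hom_closed[OF E x'] by (simp add: K1_def)
      show ?thesis
        using x' e by (simp add: r_def mod_hom_simps[OF mZ2 mZ3 \<pi>] mod_hom_closed[OF I] \<pi>I Z3.M.minus_zero_right)
    qed
    \<comment> \<open>Exactness at K2: an element killed by \<open>\<pi>\<close> comes from
      \<open>Z1\<close> through \<open>I\<close>. Injectivity of \<open>i'\<close> puts its preimage
      into K1, where \<open>E\<close> undoes \<open>I\<close>, so \<open>r\<close> kills it.\<close>
    show "r x = \<zero>\<^bsub>K2\<^esub>" if x: "x \<in> carrier K2" and 0: "\<pi> x = \<zero>\<^bsub>K3\<^esub>" for x
    proof -
      obtain m y z where mz: "x = (m, (y, z))" "m \<in> carrier M" "y \<in> carrier P1" "z \<in> carrier P2"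
        and \<rho>x: "\<rho>2 x = \<zero>\<^bsub>N\<^esub>"
        using x by (auto simp: K2_def Z2_def P12_def)
      have cm: "c m = \<zero>\<^bsub>L\<^esub>" and z: "z = \<zero>\<^bsub>P2\<^esub>" using 0 mz by (simp_all add: \<pi>_def K3_def Z3_def)
      have "m \<in> i ` carrier A" unfolding im using cm mz by (simp add: a_kernel_def')
      then obtain a where a: "a \<in> carrier A" "m = i a" by blast
      have xI: "x = I (a, y)" and ay: "(a, y) \<in> carrier Z1"
        using mz z a by (simp_all add: I_def Z1_def)
      have "i' (\<rho>1 (a, y)) = i' \<zero>\<^bsub>A'\<^esub>" using \<rho>x \<rho>I[OF ay] by (simp add: xI simps)
      then have "\<rho>1 (a, y) = \<zero>\<^bsub>A'\<^esub>"
        using se' mod_hom_closed[OF \<rho>1 ay] unfolding short_exact_def by (metis inj_onD A'.M.zero_closed)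
      then have "(a, y) \<in> carrier K1" using ay by (simp add: K1_def)
      then show ?thesis
        using mod_hom_closed[OF I ay] by (simp add: r_def xI EI K2_def Z2.M.minus_eq_zero_iff)
    qed
  qed
  then obtain Q' :: "'a umod" and h k where Q': "projective R Q'" and h: "h \<in> mod_hom R K3 Q'"
    and k: "k \<in> mod_hom R Q' K3"
    and kh: "\<And>x. x \<in> carrier K3 \<Longrightarrow> k (h x) = x" and hk: "\<And>y. y \<in> carrier Q' \<Longrightarrow> h (k y) = y"
    by (rule projective_umodE) blast
  \<comment> \<open>The added projective is P2, mapped to \<open>C\<close> by
    \<open>p \<circ> w2\<close>; the kernel is K3, replaced by its copy \<open>Q'\<close>.\<close>
  have "short_exact R Q' k (dsum L P2) (row_map C \<gamma> (\<lambda>z. p (w2 z))) C"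
    unfolding short_exact_def Z3_def[symmetric] \<rho>3_def[symmetric]
  proof (intro conjI projective_module[OF Q'] mZ3 C \<rho>3)
    show "k \<in> mod_hom R Q' Z3" using mod_hom_compose[OF k incl3] by simp
    show "inj_on k (carrier Q')" by (rule inj_on_inverseI[of _ h]) (rule hk)
    have "k ` carrier Q' = carrier K3"
    proof
      show "carrier K3 \<subseteq> k ` carrier Q'" using kh mod_hom_closed[OF h] by (metis image_eqI subsetI)
    qed (use mod_hom_closed[OF k] in blast)
    then show "k ` carrier Q' = a_kernel Z3 C \<rho>3" by (simp add: K3_def a_kernel_def')
    show "\<rho>3 ` carrier Z3 = carrier C"
    proof
      show "carrier C \<subseteq> \<rho>3 ` carrier Z3"
      proof
        fix x assume "x \<in> carrier C"
        then obtain n where n: "n \<in> carrier N" "x = p n" unfolding psurj[symmetric] by blast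
        have "p (\<beta> (\<beta>' n) \<oplus>\<^bsub>N\<^esub> w2 (u2 n)) = \<rho>3 (c (\<beta>' n), u2 n)"
          using n by (simp add: \<rho>3_def row_map_def \<gamma>c simps)
        then show "x \<in> \<rho>3 ` carrier Z3"
          using n by (intro image_eqI[of _ _ "(c (\<beta>' n), u2 n)"]) (simp_all add: sec2 Z3_def simps)
      qed
    qed (use mod_hom_closed[OF \<rho>3] in blast)
  qed
  then show thesis by (rule that[OF P2 Q' mod_hom_compose[OF w2 p]])
qed


section \<open>Representation by monomorphisms and the mapping cone\<close>

lemma inj_on_mod_hom:
  assumes M: "module R M" and N: "module R N" and h: "h \<in> mod_hom R M N"
    and 0: "\<And>x. x \<in> carrier M \<Longrightarrow> h x = \<zero>\<^bsub>N\<^esub> \<Longrightarrow> x = \<zero>\<^bsub>M\<^esub>"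
  shows "inj_on h (carrier M)"
proof (rule inj_onI)
  interpret M: module R M by fact
  interpret N: module R N by fact
  fix x y assume xy: "x \<in> carrier M" "y \<in> carrier M" "h x = h y"
  then have "h (x \<ominus>\<^bsub>M\<^esub> y) = \<zero>\<^bsub>N\<^esub>" by (simp add: mod_hom_simps[OF M N h] N.M.minus_eq_zero_iff)
  then show "x = y" using 0[of "x \<ominus>\<^bsub>M\<^esub> y"] xy by (simp add: M.M.minus_eq_zero_iff)
qed

text \<open>Stably equal homomorphisms agree on these elements, so they detect whether a morphism of the
  stable category is represented by monomorphisms.\<close>

definition projectively_null :: "('a, 'm) ring_scheme \<Rightarrow> ('a, 'b) module \<Rightarrow> 'b set" where
  "projectively_null R A = {x \<in> carrier A.
     \<forall>(P :: 'a umod) u. projective R P \<longrightarrow> u \<in> mod_hom R A P \<longrightarrow> u x = \<zero>\<^bsub>P\<^esub>}"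

lemma projectively_null_carrier: "x \<in> projectively_null R A \<Longrightarrow> x \<in> carrier A"
  by (simp add: projectively_null_def)

text \<open>The definition ranges over projectives of the universe type; injecting \<open>P\<close>
  into a copy there covers every element type.\<close>

lemma projectively_null_zero:
  fixes R :: "('a, 'm) ring_scheme"
  assumes x: "x \<in> projectively_null R A" and P: "projective R P" and u: "u \<in> mod_hom R A P"
  shows "u x = \<zero>\<^bsub>P\<^esub>"
proof -
  obtain Q :: "'a umod" and h k where Q: "projective R Q" "h \<in> mod_hom R P Q" "k \<in> mod_hom R Q P"
    "\<And>x. x \<in> carrier P \<Longrightarrow> k (h x) = x"
    using projective_umodE[OF P] by metis
  have "h (u x) = \<zero>\<^bsub>Q\<^esub>"
    using x Q(1) mod_hom_compose[OF u Q(2)] unfolding projectively_null_def by simp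
  then have "k (h (u x)) = \<zero>\<^bsub>P\<^esub>"
    using mod_hom_zero[OF projective_module[OF Q(1)] projective_module[OF P] Q(3)] by simp
  then show ?thesis
    using Q(4) mod_hom_closed[OF u] projectively_null_carrier[OF x] by simp
qed

lemma projectively_null_hom:
  fixes R :: "('a, 'm) ring_scheme"
  assumes "x \<in> projectively_null R A" "h \<in> mod_hom R A B"
  shows "h x \<in> projectively_null R B"
proof -
  have "u (h x) = \<zero>\<^bsub>P\<^esub>" if P: "projective R P" and u: "u \<in> mod_hom R B P" for P :: "'a umod" and u
    by (rule projectively_null_zero[OF assms(1) P mod_hom_compose[OF assms(2) u]])
  then show ?thesis
    using mod_hom_closed[OF assms(2) projectively_null_carrier[OF assms(1)]]
    unfolding projectively_null_def by simp
qed

text \<open>The difference of the two maps is \<open>v \<circ> u\<close> with \<open>u\<close> into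
  a projective, and \<open>u\<close> kills \<open>x\<close>.\<close>

lemma stably_eq_projectively_null:
  fixes R :: "('a, 'm) ring_scheme"
  assumes B: "module R B" and f: "f \<in> mod_hom R A B" and g: "g \<in> mod_hom R A B"
    and eq: "stably_eq R A B f g" and x: "x \<in> projectively_null R A"
  shows "f x = g x"
proof -
  interpret B: module R B by fact
  note xA = projectively_null_carrier[OF x]
  obtain P :: "'a umod" and u v where P: "projective R P" "u \<in> mod_hom R A P" "v \<in> mod_hom R P B"
    "\<And>x. x \<in> carrier A \<Longrightarrow> f x \<ominus>\<^bsub>B\<^esub> g x = v (u x)" using eq unfolding stably_eq_def by blast
  have "f x \<ominus>\<^bsub>B\<^esub> g x = \<zero>\<^bsub>B\<^esub>"
    using P(4)[OF xA] projectively_null_zero[OF x P(1,2)] mod_hom_zero[OF projective_module[OF P(1)] B P(3)]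
    by simp
  then show ?thesis using xA mod_hom_closed[OF f] mod_hom_closed[OF g] by (simp add: B.M.minus_eq_zero_iff)
qed

lemma projectively_null_extends_functionals:
  fixes R :: "('a, 'm) ring_scheme"
  assumes A: "module R A" and F: "projective R F" and \<epsilon>: "\<epsilon> \<in> mod_hom R A F"
    and ext: "extends_functionals R A \<epsilon> F"
  shows "projectively_null R A = {x \<in> carrier A. \<epsilon> x = \<zero>\<^bsub>F\<^esub>}"
proof (intro equalityI subsetI)
  fix x assume x: "x \<in> projectively_null R A"
  show "x \<in> {x \<in> carrier A. \<epsilon> x = \<zero>\<^bsub>F\<^esub>}"
    using projectively_null_zero[OF x F \<epsilon>] projectively_null_carrier[OF x] by simp
next
  fix x assume x: "x \<in> {x \<in> carrier A. \<epsilon> x = \<zero>\<^bsub>F\<^esub>}"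
  have mF: "module R F" by (rule projective_module[OF F])
  have "u x = \<zero>\<^bsub>P\<^esub>" if P: "projective R P" and u: "u \<in> mod_hom R A P" for P :: "'a umod" and u
  proof -
    obtain w where "w \<in> mod_hom R F P" "\<And>x. x \<in> carrier A \<Longrightarrow> w (\<epsilon> x) = u x"
      by (rule extends_functionals_projective[OF ext A mF P u \<epsilon>]) blast
    then show ?thesis using x mod_hom_zero[OF mF projective_module[OF P]] by force
  qed
  then show "x \<in> projectively_null R A" using x unfolding projectively_null_def by simp
qed

text \<open>For null elements the representing square commutes strictly and \<open>\<alpha>\<close>
  has a strict left inverse, so injectivity of \<open>f'\<close> forces the condition. Conversely,
  the kernel of \<open>q\<close> consists of null elements, hence (f, q) from \<open>A\<close> to
  \<open>dsum B P\<close> is injective; it represents \<open>f\<close>, because \<open>B\<close> and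
  \<open>dsum B P\<close> are stably isomorphic.\<close>

lemma represented_by_monos_iff:
  fixes R :: "('a, 'm) ring_scheme"
  assumes fgA: "fg_module R A" and fgB: "fg_module R B" and f: "f \<in> mod_hom R A B"
    and P: "projective R P" and q: "q \<in> mod_hom R A P"
    and null: "\<And>x. x \<in> carrier A \<Longrightarrow> q x = \<zero>\<^bsub>P\<^esub> \<Longrightarrow> x \<in> projectively_null R A"
  shows "represented_by_monos R A B f \<longleftrightarrow>
    (\<forall>x\<in>projectively_null R A. f x = \<zero>\<^bsub>B\<^esub> \<longrightarrow> x = \<zero>\<^bsub>A\<^esub>)"
proof
  have A: "module R A" and B: "module R B" using fgA fgB by (simp_all add: fg_moduleD)
  interpret A: module R A by fact
  interpret B: module R B by fact
  assume "represented_by_monos R A B f"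
  then obtain A' :: "'a umod" and B' :: "'a umod" and f' \<alpha> \<beta> where
    fg': "fg_module R A'" "fg_module R B'" and f': "f' \<in> mod_hom R A' B'" "inj_on f' (carrier A')"
    and \<alpha>_iso: "stable_iso R A A' \<alpha>" and \<beta>_iso: "stable_iso R B B' \<beta>"
    and eq: "stably_eq R A B' (\<beta> \<circ> f) (f' \<circ> \<alpha>)"
    unfolding represented_by_monos_def by blast
  have A': "module R A'" and B': "module R B'" using fg' by (simp_all add: fg_moduleD)
  interpret A': module R A' by fact
  have \<alpha>: "\<alpha> \<in> mod_hom R A A'" and \<beta>: "\<beta> \<in> mod_hom R B B'"
    using \<alpha>_iso \<beta>_iso by (simp_all add: stable_iso_def)
  obtain g where g: "g \<in> mod_hom R A' A" "stably_eq R A A (g \<circ> \<alpha>) id"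
    using \<alpha>_iso unfolding stable_iso_def by blast
  show "\<forall>x\<in>projectively_null R A. f x = \<zero>\<^bsub>B\<^esub> \<longrightarrow> x = \<zero>\<^bsub>A\<^esub>"
  proof (intro ballI impI)
    fix x assume x: "x \<in> projectively_null R A" and fx: "f x = \<zero>\<^bsub>B\<^esub>"
    have "\<alpha> x \<in> carrier A'" by (rule mod_hom_closed[OF \<alpha> projectively_null_carrier[OF x]])
    moreover have "f' (\<alpha> x) = f' \<zero>\<^bsub>A'\<^esub>"
      using stably_eq_projectively_null[OF B' mod_hom_comp[OF \<beta> f] mod_hom_comp[OF f'(1) \<alpha>] eq x]
      by (simp add: fx mod_hom_zero[OF B B' \<beta>] mod_hom_zero[OF A' B' f'(1)])
    ultimately have "\<alpha> x = \<zero>\<^bsub>A'\<^esub>" using inj_onD[OF f'(2)] by blast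
    then show "x = \<zero>\<^bsub>A\<^esub>"
      using stably_eq_projectively_null[OF A mod_hom_comp[OF g(1) \<alpha>] mod_hom_id g(2) x]
      by (simp add: mod_hom_zero[OF A' A g(1)])
  qed
next
  have A: "module R A" and B: "module R B" using fgA fgB by (simp_all add: fg_moduleD)
  have mP: "module R P" by (rule projective_module[OF P])
  interpret A: module R A by fact
  interpret B: module R B by fact
  interpret P: module R P by fact
  let ?D = "dsum B P"
  note D = module_dsum[OF B mP]
  assume inj: "\<forall>x\<in>projectively_null R A. f x = \<zero>\<^bsub>B\<^esub> \<longrightarrow> x = \<zero>\<^bsub>A\<^esub>"
  obtain A' :: "'a umod" and hA kA where A': "fg_module R A'" and hA: "hA \<in> mod_hom R A A'"
    and kA: "kA \<in> mod_hom R A' A"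
    and khA: "\<And>x. x \<in> carrier A \<Longrightarrow> kA (hA x) = x" and hkA: "\<And>y. y \<in> carrier A' \<Longrightarrow> hA (kA y) = y"
    using fg_module_umodE[OF fgA] by metis
  obtain B' :: "'a umod" and hB kB where B': "fg_module R B'" and hB: "hB \<in> mod_hom R ?D B'"
    and kB: "kB \<in> mod_hom R B' ?D"
    and khB: "\<And>x. x \<in> carrier ?D \<Longrightarrow> kB (hB x) = x" and hkB: "\<And>y. y \<in> carrier B' \<Longrightarrow> hB (kB y) = y"
    using fg_module_umodE[OF fg_module_dsum[OF fgB projective_fg[OF P]]] by metis
  have mA': "module R A'" and mB': "module R B'" using A' B' by (simp_all add: fg_moduleD)
  interpret B': module R B' by fact
  let ?f' = "\<lambda>x. hB (col_map f q (kA x))"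
  let ?\<beta> = "\<lambda>b. hB (b, \<zero>\<^bsub>P\<^esub>)"
  \<comment> \<open>The difference (f x, 0) - (f x, q x) is (0, -q x), which explains the sign; the
    same map corrects both the stable inverse of \<open>?\<beta>\<close> and the square.\<close>
  let ?v = "\<lambda>z. hB (\<zero>\<^bsub>B\<^esub>, \<ominus>\<^bsub>P\<^esub> z)"
  note fq = mod_hom_col_map[OF f q]
  note f' = mod_hom_compose[OF kA mod_hom_compose[OF fq hB]]
  note \<beta> = mod_hom_compose[OF mod_hom_Pair_zero[OF mP] hB]
  note v = mod_hom_compose[OF mod_hom_uminus[OF mP mod_hom_id[unfolded id_def]]
      mod_hom_compose[OF mod_hom_zero_Pair[OF B] hB]]
  have shift: "hB (b, \<zero>\<^bsub>P\<^esub>) = hB (b, z) \<oplus>\<^bsub>B'\<^esub> ?v z" if "b \<in> carrier B" "z \<in> carrier P" for b z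
    using that mod_hom_add[OF hB, of "(b, z)" "(\<zero>\<^bsub>B\<^esub>, \<ominus>\<^bsub>P\<^esub> z)"] by (simp add: P.M.r_neg)
  have "inj_on ?f' (carrier A')"
  proof (rule inj_on_mod_hom[OF mA' mB' f'])
    fix x assume x: "x \<in> carrier A'" and 0: "?f' x = \<zero>\<^bsub>B'\<^esub>"
    have kx: "kA x \<in> carrier A" by (rule mod_hom_closed[OF kA x])
    have "kB (?f' x) = \<zero>\<^bsub>?D\<^esub>" unfolding 0 by (rule mod_hom_zero[OF mB' D kB])
    then have "f (kA x) = \<zero>\<^bsub>B\<^esub>" "q (kA x) = \<zero>\<^bsub>P\<^esub>"
      using khB[OF mod_hom_closed[OF fq kx]] by (simp_all add: col_map_def)
    then have "kA x = \<zero>\<^bsub>A\<^esub>" using inj null kx by blast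
    then show "x = \<zero>\<^bsub>A'\<^esub>" using hkA[OF x] mod_hom_zero[OF A mA' hA] by simp
  qed
  moreover have "stable_iso R A A' hA"
    by (intro stable_iso_of_mod_iso[OF A mA'] mod_isoI[OF hA kA khA hkA])
  moreover have "stable_iso R B B' ?\<beta>"
  proof (rule stable_isoI[OF B mB' \<beta> mod_hom_compose[OF kB mod_hom_fst]
      projective_zero_umod mod_hom_zero_map[OF module_zero_umod] mod_hom_zero_map[OF B]
      P mod_hom_compose[OF kB mod_hom_snd] v])
    show "cring R" "cring R" by (rule A.R.is_cring)+
    show "fst (kB (hB (b, \<zero>\<^bsub>P\<^esub>))) = b \<oplus>\<^bsub>B\<^esub> \<zero>\<^bsub>B\<^esub>" if "b \<in> carrier B" for b
      using that by (simp add: khB)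
    show "hB (fst (kB y), \<zero>\<^bsub>P\<^esub>) = y \<oplus>\<^bsub>B'\<^esub> hB (\<zero>\<^bsub>B\<^esub>, \<ominus>\<^bsub>P\<^esub> snd (kB y))" if "y \<in> carrier B'" for y
      using mod_hom_closed[OF kB that] hkB[OF that] shift[of "fst (kB y)" "snd (kB y)"] by auto
  qed
  moreover have "stably_eq R A B' (?\<beta> \<circ> f) (?f' \<circ> hA)"
  proof (rule stably_eqI[OF P q v])
    fix x assume x: "x \<in> carrier A"
    have c: "f x \<in> carrier B" "q x \<in> carrier P" using mod_hom_closed[OF f x] mod_hom_closed[OF q x] by simp_all
    have c': "hB (f x, q x) \<in> carrier B'" "?v (q x) \<in> carrier B'"
      using c by (auto intro!: mod_hom_closed[OF hB])
    have "hB (f x, \<zero>\<^bsub>P\<^esub>) \<ominus>\<^bsub>B'\<^esub> hB (f x, q x) = ?v (q x)"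
      unfolding shift[OF c] using c' by algebra
    then show "(?\<beta> \<circ> f) x \<ominus>\<^bsub>B'\<^esub> (?f' \<circ> hA) x = ?v (q x)" by (simp add: khA[OF x] col_map_def)
  qed
  ultimately show "represented_by_monos R A B f"
    unfolding represented_by_monos_def using A' B' f' by blast
qed

text \<open>On null elements every stable identity is an identity: \<open>\<phi>\<close> and
  \<open>g\<close> become mutually inverse bijections, \<open>\<psi>\<close> acquires the left
  inverse \<open>k\<close>, and the square commutes. The two conditions are then the same
  one.\<close>

lemma projectively_null_injective_stable_iso:
  fixes R :: "('a, 'm) ring_scheme"
  assumes A: "module R A" and A1: "module R A1" and B: "module R B" and B1: "module R B1"
    and f: "f \<in> mod_hom R A B" and f1: "f1 \<in> mod_hom R A1 B1"
    and \<phi>_iso: "stable_iso R A1 A \<phi>" and \<psi>_iso: "stable_iso R B1 B \<psi>"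
    and eq: "stably_eq R A1 B (\<psi> \<circ> f1) (f \<circ> \<phi>)"
  shows "(\<forall>x\<in>projectively_null R A. f x = \<zero>\<^bsub>B\<^esub> \<longrightarrow> x = \<zero>\<^bsub>A\<^esub>) \<longleftrightarrow>
    (\<forall>x\<in>projectively_null R A1. f1 x = \<zero>\<^bsub>B1\<^esub> \<longrightarrow> x = \<zero>\<^bsub>A1\<^esub>)"
proof -
  obtain g where \<phi>: "\<phi> \<in> mod_hom R A1 A" and g: "g \<in> mod_hom R A A1"
    and g\<phi>: "stably_eq R A1 A1 (g \<circ> \<phi>) id" and \<phi>g: "stably_eq R A A (\<phi> \<circ> g) id"
    using \<phi>_iso unfolding stable_iso_def by blast
  obtain k where \<psi>: "\<psi> \<in> mod_hom R B1 B" and k: "k \<in> mod_hom R B B1"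
    and k\<psi>: "stably_eq R B1 B1 (k \<circ> \<psi>) id"
    using \<psi>_iso unfolding stable_iso_def by blast
  have sq: "\<psi> (f1 x) = f (\<phi> x)" if "x \<in> projectively_null R A1" for x
    using stably_eq_projectively_null[OF B mod_hom_comp[OF \<psi> f1] mod_hom_comp[OF f \<phi>] eq that] by simp
  have g\<phi>': "g (\<phi> x) = x" if "x \<in> projectively_null R A1" for x
    using stably_eq_projectively_null[OF A1 mod_hom_comp[OF g \<phi>] mod_hom_id g\<phi> that] by simp
  have \<phi>g': "\<phi> (g x) = x" if "x \<in> projectively_null R A" for x
    using stably_eq_projectively_null[OF A mod_hom_comp[OF \<phi> g] mod_hom_id \<phi>g that] by simp
  have k\<psi>': "k (\<psi> x) = x" if "x \<in> projectively_null R B1" for x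
    using stably_eq_projectively_null[OF B1 mod_hom_comp[OF k \<psi>] mod_hom_id k\<psi> that] by simp
  show ?thesis
  proof (intro iffI ballI impI)
    fix x assume inj: "\<forall>x\<in>projectively_null R A. f x = \<zero>\<^bsub>B\<^esub> \<longrightarrow> x = \<zero>\<^bsub>A\<^esub>"
      and x: "x \<in> projectively_null R A1" and 0: "f1 x = \<zero>\<^bsub>B1\<^esub>"
    have "f (\<phi> x) = \<zero>\<^bsub>B\<^esub>" using sq[OF x] mod_hom_zero[OF B1 B \<psi>] by (simp add: 0)
    then have "\<phi> x = \<zero>\<^bsub>A\<^esub>" using inj projectively_null_hom[OF x \<phi>] by blast
    then show "x = \<zero>\<^bsub>A1\<^esub>" using g\<phi>'[OF x] mod_hom_zero[OF A A1 g] by simp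
  next
    fix x assume inj: "\<forall>x\<in>projectively_null R A1. f1 x = \<zero>\<^bsub>B1\<^esub> \<longrightarrow> x = \<zero>\<^bsub>A1\<^esub>"
      and x: "x \<in> projectively_null R A" and 0: "f x = \<zero>\<^bsub>B\<^esub>"
    note gx = projectively_null_hom[OF x g]
    have "\<psi> (f1 (g x)) = \<zero>\<^bsub>B\<^esub>" using sq[OF gx] by (simp add: \<phi>g'[OF x] 0)
    then have "f1 (g x) = \<zero>\<^bsub>B1\<^esub>"
      using k\<psi>'[OF projectively_null_hom[OF gx f1]] mod_hom_zero[OF B B1 k] by simp
    then have "g x = \<zero>\<^bsub>A1\<^esub>" using inj gx by blast
    then show "x = \<zero>\<^bsub>A\<^esub>" using \<phi>g'[OF x] mod_hom_zero[OF A1 A \<phi>] by simp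
  qed
qed

section \<open>Cokernels of resolutions and the mapping cone\<close>

lemma is_complexD:
  assumes "is_complex R F d"
  shows "module R (F n)" "d n \<in> mod_hom R (F n) (F (n + 1))"
    "x \<in> carrier (F n) \<Longrightarrow> d (n + 1) (d n x) = \<zero>\<^bsub>F (n + 2)\<^esub>"
  using assms unfolding is_complex_def by blast+

lemma coker_at_minus_one: "coker_at F d (-1) = coker (F (-1)) (d (-1)) (F 0)"
  by (simp add: coker_at_def)

text \<open>Vanishing of the dual cohomology in degree \<open>0\<close> says that functionals on \<open>Coker d\<^sup>-\<^sup>1\<close> extend to
  \<open>F\<^sup>1\<close>.\<close>

lemma augmentation_extends_functionals:
  assumes cx: "is_complex R F d" and dual0: "zero_module (dual_cohomology R F d 0)"
  obtains \<epsilon> where "\<epsilon> \<in> mod_hom R (coker_at F d (-1)) (F 1)"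
    "\<And>x. x \<in> carrier (F 0) \<Longrightarrow> \<epsilon> (coker_proj (F (-1)) (d (-1)) (F 0) x) = d 0 x"
    "extends_functionals R (coker_at F d (-1)) \<epsilon> (F 1)"
proof -
  have F: "module R (F n)" for n by (rule is_complexD[OF cx])
  have d: "d (-1) \<in> mod_hom R (F (-1)) (F 0)" "d 0 \<in> mod_hom R (F 0) (F 1)"
    using is_complexD(2)[OF cx, of "-1"] is_complexD(2)[OF cx, of 0] by simp_all
  have dd: "d 0 (d (-1) x) = \<zero>\<^bsub>F 1\<^esub>" if "x \<in> carrier (F (-1))" for x
    using is_complexD(3)[OF cx that] by simp
  let ?C = "coker (F (-1)) (d (-1)) (F 0)" and ?\<pi> = "coker_proj (F (-1)) (d (-1)) (F 0)"
  note C = module_coker[OF F F d(1)] and \<pi> = mod_hom_coker_proj[OF F F d(1)]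
  have \<pi>0: "?\<pi> x = \<zero>\<^bsub>?C\<^esub> \<longleftrightarrow> x \<in> d (-1) ` carrier (F (-1))" if "x \<in> carrier (F 0)" for x
    by (rule coker_proj_eq_zero_iff[OF F F d(1) that])
  have "d 0 x = \<zero>\<^bsub>F 1\<^esub>" if "x \<in> carrier (F 0)" "?\<pi> x = \<zero>\<^bsub>?C\<^esub>" for x
    using that \<pi>0 dd by auto
  then obtain \<epsilon> where \<epsilon>: "\<epsilon> \<in> mod_hom R ?C (F 1)" "\<And>x. x \<in> carrier (F 0) \<Longrightarrow> \<epsilon> (?\<pi> x) = d 0 x"
    using mod_hom_factor_surj[OF F C F \<pi> coker_proj_surj d(2)] by metis
  interpret F0: module R "F 0" by (rule F)
  note selfR = module_self_module[OF F0.R.is_cring]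
  have "extends_functionals R ?C \<epsilon> (F 1)"
    unfolding extends_functionals_def
  proof
    fix u assume u: "u \<in> mod_hom R ?C (self_module R)"
    \<comment> \<open>Functionals on the cokernel are functionals on \<open>F 0\<close> vanishing on
      the image of \<open>d (-1)\<close>, that is, elements of the kernel of the dual of
      \<open>d (-1)\<close>. Such a \<open>U\<close> is then of the form
      \<open>w \<circ> d 0\<close>, and surjectivity of the projection gives
      \<open>w \<circ> \<epsilon>\<close> = \<open>u\<close>.\<close>
    define U where "U = (\<lambda>x\<in>carrier (F 0). u (?\<pi> x))"
    have U: "U \<in> carrier (dual R (F 0))"
      unfolding U_def by (rule restrict_mem_dual[OF F mod_hom_compose[OF \<pi> u]])
    have "u (?\<pi> (d (-1) x)) = \<zero>\<^bsub>R\<^esub>" if x: "x \<in> carrier (F (-1))" for x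
    proof -
      have "?\<pi> (d (-1) x) = \<zero>\<^bsub>?C\<^esub>" using x \<pi>0[OF mod_hom_closed[OF d(1) x]] by blast
      then show ?thesis using mod_hom_zero[OF C selfR u] by simp
    qed
    then have "dual_map (F (-1)) (d (-1)) U = \<zero>\<^bsub>dual R (F (-1))\<^esub>"
      by (auto simp: dual_map_def dual_def U_def fun_eq_iff mod_hom_closed[OF d(1)])
    moreover have "zero_module (homology (dual R (F 1)) (dual_map (F 0) (d 0)) (dual R (F 0))
        (dual_map (F (-1)) (d (-1))) (dual R (F (-1))))"
      using dual0 by (simp add: dual_cohomology_def)
    ultimately have "U \<in> dual_map (F 0) (d 0) ` carrier (dual R (F 1))"
      using U zero_module_homology_iff[OF module_dual[OF F] module_dual[OF F] module_dual[OF F]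
          mod_hom_dual_map[OF F F d(2)] mod_hom_dual_map[OF F F d(1)]] by blast
    then obtain w where w: "w \<in> carrier (dual R (F 1))" "U = dual_map (F 0) (d 0) w" by blast
    have "w (\<epsilon> a) = u a" if "a \<in> carrier ?C" for a
    proof -
      have "a \<in> ?\<pi> ` carrier (F 0)" using that by (simp only: coker_proj_surj)
      then obtain x where "x \<in> carrier (F 0)" "a = ?\<pi> x" by blast
      then show ?thesis using fun_cong[OF w(2), of x] by (simp add: \<epsilon>(2) U_def dual_map_def)
    qed
    then show "\<exists>w\<in>mod_hom R (F 1) (self_module R). \<forall>x\<in>carrier ?C. w (\<epsilon> x) = u x"
      using w(1) by (auto simp: carrier_dual)
  qed
  then show thesis using \<epsilon> by (intro that) (simp_all add: coker_at_minus_one)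
qed

lemma chain_mapD:
  assumes "chain_map R F d G e h"
  shows "h n \<in> mod_hom R (F n) (G n)" "x \<in> carrier (F n) \<Longrightarrow> e n (h n x) = h (n + 1) (d n x)"
  using assms unfolding chain_map_def by blast+

lemma mod_hom_coker_map_chain_map:
  assumes F: "is_complex R F d" and G: "is_complex R G e" and h: "chain_map R F d G e h"
  shows "coker_map (G (-1)) (e (-1)) (G 0) (h 0) \<in> mod_hom R (coker_at F d (-1)) (coker_at G e (-1))"
    and "\<And>x. x \<in> carrier (F 0) \<Longrightarrow> coker_map (G (-1)) (e (-1)) (G 0) (h 0)
      (coker_proj (F (-1)) (d (-1)) (F 0) x) = coker_proj (G (-1)) (e (-1)) (G 0) (h 0 x)"
proof -
  have mF: "module R (F n)" and mG: "module R (G n)" for n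
    using is_complexD(1)[OF F] is_complexD(1)[OF G] by blast+
  have d: "d (-1) \<in> mod_hom R (F (-1)) (F 0)" and e: "e (-1) \<in> mod_hom R (G (-1)) (G 0)"
    using is_complexD(2)[OF F, of "-1"] is_complexD(2)[OF G, of "-1"] by simp_all
  let ?C = "coker (F (-1)) (d (-1)) (F 0)" and ?C' = "coker (G (-1)) (e (-1)) (G 0)"
  let ?\<pi> = "coker_proj (F (-1)) (d (-1)) (F 0)" and ?\<pi>' = "coker_proj (G (-1)) (e (-1)) (G 0)"
  let ?c = "coker_map (G (-1)) (e (-1)) (G 0) (h 0)"
  note C = module_coker[OF mF mF d] and C' = module_coker[OF mG mG e]
  note \<pi> = mod_hom_coker_proj[OF mF mF d] and \<pi>' = mod_hom_coker_proj[OF mG mG e]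
  have comm: "h 0 (d (-1) x) \<in> e (-1) ` carrier (G (-1))" if "x \<in> carrier (F (-1))" for x
    using chain_mapD(2)[OF h that] mod_hom_closed[OF chain_mapD(1)[OF h] that] by force
  show eq: "?c (?\<pi> x) = ?\<pi>' (h 0 x)" if "x \<in> carrier (F 0)" for x
    by (rule coker_map_coker_proj[OF mF mF d mG mG e chain_mapD(1)[OF h] comm that])
  have "?\<pi>' (h 0 x) = \<zero>\<^bsub>?C'\<^esub>" if x: "x \<in> carrier (F 0)" and 0: "?\<pi> x = \<zero>\<^bsub>?C\<^esub>" for x
  proof -
    have "x \<in> d (-1) ` carrier (F (-1))" using 0 coker_proj_eq_zero_iff[OF mF mF d x] by blast
    then have "h 0 x \<in> e (-1) ` carrier (G (-1))" using comm by blast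
    then show ?thesis using coker_proj_eq_zero_iff[OF mG mG e mod_hom_closed[OF chain_mapD(1)[OF h] x]] by blast
  qed
  \<comment> \<open>\<open>coker_map\<close> is a union over a coset, so its linearity is read off
    from the factorisation \<open>\<gamma>\<close>, with which it agrees on the carrier.\<close>
  then obtain \<gamma> where \<gamma>: "\<gamma> \<in> mod_hom R ?C ?C'" "\<And>x. x \<in> carrier (F 0) \<Longrightarrow> \<gamma> (?\<pi> x) = ?\<pi>' (h 0 x)"
    using mod_hom_factor_surj[OF mF C C' \<pi> coker_proj_surj mod_hom_compose[OF chain_mapD(1)[OF h] \<pi>']] by metis
  show "?c \<in> mod_hom R (coker_at F d (-1)) (coker_at G e (-1))" unfolding coker_at_minus_one
  proof (rule mod_hom_cong[OF \<gamma>(1) C])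
    fix a assume "a \<in> carrier ?C"
    then have "a \<in> ?\<pi> ` carrier (F 0)" by (simp only: coker_proj_surj)
    then show "?c a = \<gamma> a" using eq \<gamma>(2) by auto
  qed
qed

text \<open>A pair (x, y) is a cocycle of the cone iff \<open>d 0 x\<close> = 0 and
  \<open>h 0 x\<close> = \<open>- e (-1) y\<close>; so the class of x is killed by
  \<open>\<epsilon>\<close> and by the induced map, and every class killed by both arises in this
  way. The pair is a boundary iff this class is zero: once x is a boundary, vanishing of the
  cohomology of \<open>G\<close> in degree -1 corrects y.\<close>

lemma zero_module_cohomology_cone_iff:
  assumes F: "is_complex R F d" and G: "is_complex R G e" and h: "chain_map R F d G e h"
    and G1: "zero_module (cohomology G e (-1))"
    and \<epsilon>: "\<epsilon> \<in> mod_hom R (coker_at F d (-1)) (F 1)"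
      "\<And>x. x \<in> carrier (F 0) \<Longrightarrow> \<epsilon> (coker_proj (F (-1)) (d (-1)) (F 0) x) = d 0 x"
  shows "zero_module (cohomology (cone F G) (cone_diff F d G e h) (-1)) \<longleftrightarrow>
    (\<forall>a\<in>carrier (coker_at F d (-1)). \<epsilon> a = \<zero>\<^bsub>F 1\<^esub> \<longrightarrow>
      coker_map (G (-1)) (e (-1)) (G 0) (h 0) a = \<zero>\<^bsub>coker_at G e (-1)\<^esub> \<longrightarrow> a = \<zero>\<^bsub>coker_at F d (-1)\<^esub>)"
proof -
  have mF: "module R (F n)" and mG: "module R (G n)" for n
    using is_complexD(1)[OF F] is_complexD(1)[OF G] by blast+
  have d: "d (-1) \<in> mod_hom R (F (-1)) (F 0)" "d 0 \<in> mod_hom R (F 0) (F 1)"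
    and e: "e (-2) \<in> mod_hom R (G (-2)) (G (-1))" "e (-1) \<in> mod_hom R (G (-1)) (G 0)"
    using is_complexD(2)[OF F, of "-1"] is_complexD(2)[OF F, of 0]
      is_complexD(2)[OF G, of "-2"] is_complexD(2)[OF G, of "-1"] by simp_all
  have hh: "h n \<in> mod_hom R (F n) (G n)" for n by (rule chain_mapD(1)[OF h])
  have comm: "e (-1) (h (-1) x) = h 0 (d (-1) x)" if "x \<in> carrier (F (-1))" for x
    using chain_mapD(2)[OF h that] by simp
  let ?C = "coker (F (-1)) (d (-1)) (F 0)" and ?C' = "coker (G (-1)) (e (-1)) (G 0)"
  let ?\<pi> = "coker_proj (F (-1)) (d (-1)) (F 0)" and ?\<pi>' = "coker_proj (G (-1)) (e (-1)) (G 0)"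
  let ?c = "coker_map (G (-1)) (e (-1)) (G 0) (h 0)"
  note c = mod_hom_coker_map_chain_map[OF F G h]
  have \<pi>0: "?\<pi> x = \<zero>\<^bsub>?C\<^esub> \<longleftrightarrow> x \<in> d (-1) ` carrier (F (-1))" if "x \<in> carrier (F 0)" for x
    by (rule coker_proj_eq_zero_iff[OF mF mF d(1) that])
  have \<pi>'0: "?\<pi>' x = \<zero>\<^bsub>?C'\<^esub> \<longleftrightarrow> x \<in> e (-1) ` carrier (G (-1))" if "x \<in> carrier (G 0)" for x
    by (rule coker_proj_eq_zero_iff[OF mG mG e(2) that])
  interpret F0: module R "F 0" by (rule mF)
  interpret F1: module R "F 1" by (rule mF)
  interpret Fm: module R "F (-1)" by (rule mF)
  interpret G0: module R "G 0" by (rule mG)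
  interpret Gm: module R "G (-1)" by (rule mG)
  interpret Gmm: module R "G (-2)" by (rule mG)
  let ?X2 = "dsum (F (-1)) (G (-2))" and ?X1 = "dsum (F 0) (G (-1))" and ?X0 = "dsum (F 1) (G 0)"
  \<comment> \<open>The shift in the cone places the components of \<open>F\<close> one degree
    higher, so its differentials in degrees -2 and -1 involve \<open>d (-1)\<close> and
    \<open>d 0\<close>.\<close>
  let ?D2 = "\<lambda>(x, y). (\<ominus>\<^bsub>F 0\<^esub> d (-1) x, h (-1) x \<oplus>\<^bsub>G (-1)\<^esub> e (-2) y)"
  let ?D1 = "\<lambda>(x, y). (\<ominus>\<^bsub>F 1\<^esub> d 0 x, h 0 x \<oplus>\<^bsub>G 0\<^esub> e (-1) y)"
  note simps = mod_hom_simps[OF mF mF d(1)] mod_hom_simps[OF mF mF d(2)] mod_hom_simps[OF mG mG e(1)]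
    mod_hom_simps[OF mG mG e(2)] mod_hom_simps[OF mF mG hh]
  have D2: "?D2 \<in> mod_hom R ?X2 ?X1"
  proof -
    have "(\<lambda>z. (\<ominus>\<^bsub>F 0\<^esub> d (-1) (fst z), h (-1) (fst z) \<oplus>\<^bsub>G (-1)\<^esub> e (-2) (snd z))) \<in> mod_hom R ?X2 ?X1"
      by (intro mod_hom_Pair mod_hom_uminus mod_hom_plus mF mG mod_hom_compose[OF mod_hom_fst d(1)]
          mod_hom_compose[OF mod_hom_fst hh] mod_hom_compose[OF mod_hom_snd e(1)])
    then show ?thesis by (simp add: case_prod_beta')
  qed
  have D1: "?D1 \<in> mod_hom R ?X1 ?X0"
  proof -
    have "(\<lambda>z. (\<ominus>\<^bsub>F 1\<^esub> d 0 (fst z), h 0 (fst z) \<oplus>\<^bsub>G 0\<^esub> e (-1) (snd z))) \<in> mod_hom R ?X1 ?X0"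
      by (intro mod_hom_Pair mod_hom_uminus mod_hom_plus mF mG mod_hom_compose[OF mod_hom_fst d(2)]
          mod_hom_compose[OF mod_hom_fst hh] mod_hom_compose[OF mod_hom_snd e(2)])
    then show ?thesis by (simp add: case_prod_beta')
  qed
  have "cohomology (cone F G) (cone_diff F d G e h) (-1) = homology ?X2 ?D2 ?X1 ?D1 ?X0"
    by (simp add: cohomology_def cone_def cone_diff_def)
  then have lhs: "zero_module (cohomology (cone F G) (cone_diff F d G e h) (-1)) \<longleftrightarrow>
    (\<forall>z\<in>carrier ?X1. ?D1 z = \<zero>\<^bsub>?X0\<^esub> \<longrightarrow> z \<in> ?D2 ` carrier ?X2)"
    using zero_module_homology_iff[OF module_dsum[OF mF mG] module_dsum[OF mF mG] module_dsum[OF mF mG] D2 D1]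
    by simp
  have exG: "y \<in> e (-2) ` carrier (G (-2))" if "y \<in> carrier (G (-1))" "e (-1) y = \<zero>\<^bsub>G 0\<^esub>" for y
  proof -
    have "cohomology G e (-1) = homology (G (-2)) (e (-2)) (G (-1)) (e (-1)) (G 0)"
      by (simp add: cohomology_def)
    then show ?thesis using G1 that zero_module_homology_iff[OF mG mG mG e(1,2)] by simp
  qed
  show ?thesis unfolding lhs coker_at_minus_one
  proof (intro iffI ballI impI)
    fix a assume ex: "\<forall>z\<in>carrier ?X1. ?D1 z = \<zero>\<^bsub>?X0\<^esub> \<longrightarrow> z \<in> ?D2 ` carrier ?X2"
      and a: "a \<in> carrier ?C" and \<epsilon>a: "\<epsilon> a = \<zero>\<^bsub>F 1\<^esub>" and ca: "?c a = \<zero>\<^bsub>?C'\<^esub>"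
    have "a \<in> ?\<pi> ` carrier (F 0)" using a by (simp only: coker_proj_surj)
    then obtain x where x: "x \<in> carrier (F 0)" "a = ?\<pi> x" by blast
    have dx: "d 0 x = \<zero>\<^bsub>F 1\<^esub>" using \<epsilon>a \<epsilon>(2)[OF x(1)] by (simp add: x(2))
    have "h 0 x \<in> e (-1) ` carrier (G (-1))" using ca c(2)[OF x(1)] \<pi>'0 x by (simp add: simps)
    then obtain y where y: "y \<in> carrier (G (-1))" "h 0 x = e (-1) y" by blast
    \<comment> \<open>The second entry is negated so that \<open>h 0 x + e (-1) (-y)\<close>
      vanishes.\<close>
    have "(x, \<ominus>\<^bsub>G (-1)\<^esub> y) \<in> ?D2 ` carrier ?X2"
      using bspec[OF ex, of "(x, \<ominus>\<^bsub>G (-1)\<^esub> y)"] x y dx by (simp add: simps F1.M.a_inv_zero G0.M.r_neg)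
    then obtain x' where x': "x' \<in> carrier (F (-1))" "x = \<ominus>\<^bsub>F 0\<^esub> d (-1) x'" by auto
    then have "x = d (-1) (\<ominus>\<^bsub>F (-1)\<^esub> x')" by (simp add: simps)
    then show "a = \<zero>\<^bsub>?C\<^esub>" unfolding x(2) using \<pi>0[OF x(1)] x'(1) by blast
  next
    fix z assume inj: "\<forall>a\<in>carrier ?C. \<epsilon> a = \<zero>\<^bsub>F 1\<^esub> \<longrightarrow> ?c a = \<zero>\<^bsub>?C'\<^esub> \<longrightarrow> a = \<zero>\<^bsub>?C\<^esub>"
      and z: "z \<in> carrier ?X1" and 0: "?D1 z = \<zero>\<^bsub>?X0\<^esub>"
    obtain x y where xy: "z = (x, y)" "x \<in> carrier (F 0)" "y \<in> carrier (G (-1))" using z by auto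
    have neg: "\<ominus>\<^bsub>F 1\<^esub> d 0 x = \<zero>\<^bsub>F 1\<^esub>" and hxy: "h 0 x \<oplus>\<^bsub>G 0\<^esub> e (-1) y = \<zero>\<^bsub>G 0\<^esub>" using 0 xy by simp_all
    have dx: "d 0 x = \<zero>\<^bsub>F 1\<^esub>"
      using arg_cong[OF neg, of "a_inv (F 1)"] xy by (simp add: simps F1.M.a_inv_zero)
    have hx: "h 0 x = e (-1) (\<ominus>\<^bsub>G (-1)\<^esub> y)"
      using G0.M.minus_equality[OF hxy] xy by (simp add: simps)
    have "h 0 x \<in> e (-1) ` carrier (G (-1))" unfolding hx using xy by blast
    then have "?c (?\<pi> x) = \<zero>\<^bsub>?C'\<^esub>" using c(2)[OF xy(2)] \<pi>'0 xy by (simp add: simps)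
    moreover have "?\<pi> x \<in> carrier ?C" 
      by (rule mod_hom_closed[OF mod_hom_coker_proj[OF mF mF d(1)] xy(2)])
    moreover have "\<epsilon> (?\<pi> x) = \<zero>\<^bsub>F 1\<^esub>" using \<epsilon>(2) xy dx by simp
    ultimately have "?\<pi> x = \<zero>\<^bsub>?C\<^esub>" using inj by blast
    then have "x \<in> d (-1) ` carrier (F (-1))" using \<pi>0[OF xy(2)] by blast
    then obtain x0 where x0: "x0 \<in> carrier (F (-1))" "x = d (-1) x0" by blast
    \<comment> \<open>The first component of \<open>?D2\<close> carries a minus sign, so the
      preimage of x is \<open>-x0\<close>. The remainder y - \<open>h (-1) ?x\<close> is then a
      cocycle of \<open>G\<close> and is absorbed by \<open>exG\<close>.\<close>
    let ?x = "\<ominus>\<^bsub>F (-1)\<^esub> x0"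
    have hx0: "h (-1) x0 \<in> carrier (G (-1))" using x0 by (simp add: simps)
    have "e (-1) (y \<ominus>\<^bsub>G (-1)\<^esub> h (-1) ?x) = e (-1) y \<oplus>\<^bsub>G 0\<^esub> h 0 x"
      using x0 xy hx0 by (simp add: simps comm a_minus_def)
    also have "\<dots> = \<zero>\<^bsub>G 0\<^esub>" using hxy xy G0.M.a_comm by (simp add: simps)
    finally have "y \<ominus>\<^bsub>G (-1)\<^esub> h (-1) ?x \<in> e (-2) ` carrier (G (-2))"
      using xy x0 by (intro exG) (simp_all add: simps)
    then obtain y' where y': "y' \<in> carrier (G (-2))" "y \<ominus>\<^bsub>G (-1)\<^esub> h (-1) ?x = e (-2) y'" by blast
    have "y = h (-1) ?x \<oplus>\<^bsub>G (-1)\<^esub> e (-2) y'"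
      using xy x0 by (intro Gm.M.minus_eq_imp_eq_plus y') (simp_all add: simps)
    moreover have "x = \<ominus>\<^bsub>F 0\<^esub> d (-1) ?x" using x0 by (simp add: simps)
    ultimately show "z \<in> ?D2 ` carrier ?X2"
      using x0 y' xy by (intro image_eqI[of _ _ "(?x, y')"]) simp_all
  qed
qed


section \<open>The two presentations of the pseudo-cokernel\<close>

lemma map_fst_surj:
  assumes "g ` carrier M = carrier M'"
  shows "(\<lambda>z. (g (fst z), snd z)) ` carrier (dsum M N) = carrier (dsum M' N)"
  unfolding carrier_dsum assms[symmetric] by force

text \<open>A stable isomorphism \<open>B1 \<rightarrow> B\<close> completes to an isomorphism \<open>B1 \<oplus> P \<rightarrow> B \<oplus> K\<close>; correcting it by maps
  out of \<open>F\<close> makes it carry the image of \<open>A1\<close> onto the image of \<open>A\<close>.\<close>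

lemma stably_isomorphic_cokernels:
  fixes R :: "('a, 'm) ring_scheme"
    and B :: "('a, 'c) module" and B1 :: "('a, 'd) module" and F :: "('a, 'e) module"
  assumes A: "module R A" and A1: "module R A1" and B: "module R B" and B1: "module R B1"
    and F: "projective R F" and C1: "module R C1"
    and f: "f \<in> mod_hom R A B" and f1: "f1 \<in> mod_hom R A1 B1"
    and \<phi>: "\<phi> \<in> mod_hom R A1 A" "\<phi> ` carrier A1 = carrier A"
    and \<psi>_iso: "stable_iso R B1 B \<psi>"
    and eq: "stably_eq R A1 B (\<psi> \<circ> f1) (f \<circ> \<phi>)"
    and \<epsilon>: "\<epsilon> \<in> mod_hom R A F" and \<epsilon>1: "\<epsilon>1 \<in> mod_hom R A1 F"
    and \<epsilon>\<phi>: "\<And>a. a \<in> carrier A1 \<Longrightarrow> \<epsilon> (\<phi> a) = \<epsilon>1 a"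
    and ext: "extends_functionals R A1 \<epsilon>1 F"
    and c1: "c1 \<in> mod_hom R (dsum F B1) C1" "c1 ` carrier (dsum F B1) = carrier C1"
    and c1_ker: "\<And>z. z \<in> carrier (dsum F B1) \<Longrightarrow>
      c1 z = \<zero>\<^bsub>C1\<^esub> \<longleftrightarrow> z \<in> (\<lambda>a. (\<ominus>\<^bsub>F\<^esub> \<epsilon>1 a, f1 a)) ` carrier A1"
  shows "stably_isomorphic R (coker A (col_map f \<epsilon>) (dsum B F)) C1"
proof -
  have mF: "module R F" by (rule projective_module[OF F])
  interpret A: module R A by fact
  interpret A1: module R A1 by fact
  interpret B: module R B by fact
  interpret B1: module R B1 by fact
  interpret F: module R F by fact
  interpret C1: module R C1 by fact
  let ?M = "dsum B F" and ?i = "col_map f \<epsilon>"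
  let ?Cok = "coker A ?i ?M" and ?c = "coker_proj A ?i ?M"
  note M = module_dsum[OF B mF] and M1 = module_dsum[OF mF B1]
  note i = mod_hom_col_map[OF f \<epsilon>]
  note Cok = module_coker[OF A M i] and c = mod_hom_coker_proj[OF A M i]
  have \<psi>: "\<psi> \<in> mod_hom R B1 B" using \<psi>_iso by (simp add: stable_iso_def)
  obtain P0 :: "'a umod" and u0 v0 where P0: "projective R P0" and u0: "u0 \<in> mod_hom R A1 P0"
    and v0: "v0 \<in> mod_hom R P0 B"
    and vu0: "\<And>a. a \<in> carrier A1 \<Longrightarrow> \<psi> (f1 a) \<ominus>\<^bsub>B\<^esub> f (\<phi> a) = v0 (u0 a)"
    using eq unfolding stably_eq_def comp_def by blast
  \<comment> \<open>The defect of the square factors through P0; extending \<open>u0\<close> along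
    \<open>\<epsilon>1\<close> writes it as \<open>v \<circ> \<epsilon>1\<close>, so it can be
    compensated by the summand \<open>F\<close>.\<close>
  obtain u1 where u1: "u1 \<in> mod_hom R F P0" and u1\<epsilon>: "\<And>a. a \<in> carrier A1 \<Longrightarrow> u1 (\<epsilon>1 a) = u0 a"
    by (rule extends_functionals_projective[OF ext A1 mF P0 u0 \<epsilon>1]) blast
  define v where "v y = v0 (u1 y)" for y
  have v: "v \<in> mod_hom R F B" unfolding v_def[abs_def] by (rule mod_hom_compose[OF u1 v0])
  obtain P K :: "'a umod" and \<Phi> where P: "projective R P" and K: "projective R K"
    and \<Phi>_iso: "\<Phi> \<in> mod_iso R (dsum B1 P) (dsum B K)"
    and \<Phi>\<psi>: "\<And>b. b \<in> carrier B1 \<Longrightarrow> fst (\<Phi> (b, \<zero>\<^bsub>P\<^esub>)) = \<psi> b"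
    by (rule stable_iso_completion[OF \<psi>_iso B1 B]) blast
  have mP: "module R P" and mK: "module R K" using P K by (simp_all add: projective_module)
  interpret P: module R P by fact
  interpret K: module R K by fact
  note BP = module_dsum[OF B1 mP] and BK = module_dsum[OF B mK]
  obtain \<Phi>' where \<Phi>: "\<Phi> \<in> mod_hom R (dsum B1 P) (dsum B K)" and \<Phi>': "\<Phi>' \<in> mod_hom R (dsum B K) (dsum B1 P)"
    and \<Phi>'\<Phi>: "\<And>x. x \<in> carrier (dsum B1 P) \<Longrightarrow> \<Phi>' (\<Phi> x) = x"
    and \<Phi>\<Phi>': "\<And>y. y \<in> carrier (dsum B K) \<Longrightarrow> \<Phi> (\<Phi>' y) = y"
    by (rule mod_isoE[OF \<Phi>_iso BP BK]) blast
  \<comment> \<open>The second obstacle is the K-component that \<open>\<Phi>\<close> gives to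
    \<open>f1 a\<close>; it too is a map from \<open>A1\<close> into a projective, hence of the form
    \<open>\<kappa> \<circ> \<epsilon>1\<close>.\<close>
  have k0: "(\<lambda>a. snd (\<Phi> (f1 a, \<zero>\<^bsub>P\<^esub>))) \<in> mod_hom R A1 K"
    by (intro mod_hom_compose[OF f1] mod_hom_compose[OF mod_hom_Pair_zero[OF mP]] mod_hom_compose[OF \<Phi> mod_hom_snd])
  obtain \<kappa> where \<kappa>: "\<kappa> \<in> mod_hom R F K"
    and \<kappa>\<epsilon>: "\<And>a. a \<in> carrier A1 \<Longrightarrow> \<kappa> (\<epsilon>1 a) = snd (\<Phi> (f1 a, \<zero>\<^bsub>P\<^esub>))"
    by (rule extends_functionals_projective[OF ext A1 mF K k0 \<epsilon>1]) blast
  note simps = mod_hom_simps[OF mF B v] mod_hom_simps[OF mF mK \<kappa>] mod_hom_simps[OF A1 mF \<epsilon>1]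
    mod_hom_simps[OF A1 B1 f1] mod_hom_simps[OF A B f] mod_hom_simps[OF A mF \<epsilon>] mod_hom_simps[OF A1 A \<phi>(1)]
    mod_hom_simps[OF B1 B \<psi>]
  \<comment> \<open>At (\<open>- \<epsilon>1 a\<close>, \<open>f1 a\<close>, 0) the terms
    \<open>v\<close> and \<open>\<kappa>\<close> cancel the defect and the K-component, leaving
    (\<open>f (\<phi> a)\<close>, \<open>\<epsilon> (\<phi> a)\<close>, 0). The sign on
    \<open>F\<close> converts the sign convention of the cone into that of
    \<open>col_map f \<epsilon>\<close>.\<close>
  define T :: "('e \<times> 'd) \<times> 'a list set \<Rightarrow> ('c \<times> 'e) \<times> 'a list set" where
    "T z = ((fst (\<Phi> (snd (fst z), snd z)) \<oplus>\<^bsub>B\<^esub> v (fst (fst z)), \<ominus>\<^bsub>F\<^esub> fst (fst z)),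
      snd (\<Phi> (snd (fst z), snd z)) \<oplus>\<^bsub>K\<^esub> \<kappa> (fst (fst z)))" for z
  define T' :: "('c \<times> 'e) \<times> 'a list set \<Rightarrow> ('e \<times> 'd) \<times> 'a list set" where
    "T' z = ((\<ominus>\<^bsub>F\<^esub> snd (fst z), fst (\<Phi>' (fst (fst z) \<oplus>\<^bsub>B\<^esub> v (snd (fst z)), snd z \<oplus>\<^bsub>K\<^esub> \<kappa> (snd (fst z))))),
      snd (\<Phi>' (fst (fst z) \<oplus>\<^bsub>B\<^esub> v (snd (fst z)), snd z \<oplus>\<^bsub>K\<^esub> \<kappa> (snd (fst z)))))" for z
  note MK = module_dsum[OF M mK] and M1P = module_dsum[OF M1 mP]
  note ff = mod_hom_compose[OF mod_hom_fst mod_hom_fst] and sf = mod_hom_compose[OF mod_hom_fst mod_hom_snd]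
  have T: "T \<in> mod_hom R (dsum (dsum F B1) P) (dsum ?M K)"
    unfolding T_def[abs_def]
    by (intro mod_hom_Pair mod_hom_plus B mK mod_hom_uminus mF ff mod_hom_compose[OF ff v] mod_hom_compose[OF ff \<kappa>]
        mod_hom_compose[OF mod_hom_Pair[OF sf mod_hom_snd] mod_hom_compose[OF \<Phi> mod_hom_fst]]
        mod_hom_compose[OF mod_hom_Pair[OF sf mod_hom_snd] mod_hom_compose[OF \<Phi> mod_hom_snd]])
  have g: "(\<lambda>z. (fst (fst z) \<oplus>\<^bsub>B\<^esub> v (snd (fst z)), snd z \<oplus>\<^bsub>K\<^esub> \<kappa> (snd (fst z))))
    \<in> mod_hom R (dsum ?M K) (dsum B K)"
    by (intro mod_hom_Pair mod_hom_plus B mK ff mod_hom_compose[OF sf v] mod_hom_snd mod_hom_compose[OF sf \<kappa>])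
  have T': "T' \<in> mod_hom R (dsum ?M K) (dsum (dsum F B1) P)"
    unfolding T'_def[abs_def]
    by (intro mod_hom_Pair mod_hom_uminus mF sf mod_hom_compose[OF g mod_hom_compose[OF \<Phi>' mod_hom_fst]]
        mod_hom_compose[OF g mod_hom_compose[OF \<Phi>' mod_hom_snd]])
  have T'T: "T' (T z) = z" if zM: "z \<in> carrier (dsum (dsum F B1) P)" for z
  proof -
    obtain x b y where z: "z = ((x, b), y)" "x \<in> carrier F" "b \<in> carrier B1" "y \<in> carrier P" using zM by auto
    obtain b' k where bk: "\<Phi> (b, y) = (b', k)" by (cases "\<Phi> (b, y)")
    have cl: "b' \<in> carrier B" "k \<in> carrier K" using mod_hom_closed[OF \<Phi>, of "(b, y)"] z bk by auto
    have vx: "v x \<in> carrier B" "\<kappa> x \<in> carrier K" using z by (simp_all add: simps)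
    have "b' \<oplus>\<^bsub>B\<^esub> v x \<oplus>\<^bsub>B\<^esub> \<ominus>\<^bsub>B\<^esub> v x = b'" using cl vx by algebra
    moreover have "k \<oplus>\<^bsub>K\<^esub> \<kappa> x \<oplus>\<^bsub>K\<^esub> \<ominus>\<^bsub>K\<^esub> \<kappa> x = k" using cl vx by algebra
    ultimately show ?thesis
      using z \<Phi>'\<Phi>[of "(b, y)"] by (simp add: T_def T'_def bk simps)
  qed
  have TT': "T (T' z) = z" if zM: "z \<in> carrier (dsum ?M K)" for z
  proof -
    obtain b y k where z: "z = ((b, y), k)" "b \<in> carrier B" "y \<in> carrier F" "k \<in> carrier K" using zM by auto
    have vy: "v y \<in> carrier B" "\<kappa> y \<in> carrier K" using z by (simp_all add: simps)
    have "b \<oplus>\<^bsub>B\<^esub> v y \<oplus>\<^bsub>B\<^esub> \<ominus>\<^bsub>B\<^esub> v y = b" using z(2) vy by algebra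
    moreover have "k \<oplus>\<^bsub>K\<^esub> \<kappa> y \<oplus>\<^bsub>K\<^esub> \<ominus>\<^bsub>K\<^esub> \<kappa> y = k" using z(4) vy by algebra
    ultimately show ?thesis
      using z vy \<Phi>\<Phi>'[of "(b \<oplus>\<^bsub>B\<^esub> v y, k \<oplus>\<^bsub>K\<^esub> \<kappa> y)"] by (simp add: T_def T'_def simps)
  qed
  let ?S1 = "(\<lambda>a. ((\<ominus>\<^bsub>F\<^esub> \<epsilon>1 a, f1 a), \<zero>\<^bsub>P\<^esub>)) ` carrier A1" and ?S = "(\<lambda>a. (?i a, \<zero>\<^bsub>K\<^esub>)) ` carrier A"
  have Ti: "T ((\<ominus>\<^bsub>F\<^esub> \<epsilon>1 a, f1 a), \<zero>\<^bsub>P\<^esub>) = (?i (\<phi> a), \<zero>\<^bsub>K\<^esub>)" if a: "a \<in> carrier A1" for a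
  proof -
    have fa: "f1 a \<in> carrier B1" and ea: "\<epsilon>1 a \<in> carrier F" using a by (simp_all add: simps)
    have cl: "\<psi> (f1 a) \<in> carrier B" "f (\<phi> a) \<in> carrier B" "\<kappa> (\<epsilon>1 a) \<in> carrier K" using a by (simp_all add: simps)
    have "v (\<epsilon>1 a) = \<psi> (f1 a) \<ominus>\<^bsub>B\<^esub> f (\<phi> a)" by (simp add: v_def u1\<epsilon>[OF a] vu0[OF a])
    then have "\<psi> (f1 a) \<oplus>\<^bsub>B\<^esub> \<ominus>\<^bsub>B\<^esub> v (\<epsilon>1 a) = f (\<phi> a)" using cl by simp algebra
    then show ?thesis
      using ea cl by (simp add: T_def \<Phi>\<psi>[OF fa] simps col_map_def \<epsilon>\<phi>[OF a] K.M.r_neg flip: \<kappa>\<epsilon>[OF a])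
  qed
  have S: "T ` ?S1 = ?S"
  proof -
    have "T ` ?S1 = (\<lambda>a. (?i (\<phi> a), \<zero>\<^bsub>K\<^esub>)) ` carrier A1" by (simp add: image_image Ti cong: image_cong_simp)
    also have "\<dots> = ?S" unfolding \<phi>(2)[symmetric] by (simp add: image_image)
    finally show ?thesis .
  qed
  have S1: "?S1 \<subseteq> carrier (dsum (dsum F B1) P)" by (auto simp: simps)
  let ?p = "\<lambda>z. (?c (fst z), snd z)" and ?p1 = "\<lambda>z. (c1 (fst z), snd z)"
  have p: "?p \<in> mod_hom R (dsum ?M K) (dsum ?Cok K)"
    by (intro mod_hom_Pair mod_hom_compose[OF mod_hom_fst c] mod_hom_snd)
  have p1: "?p1 \<in> mod_hom R (dsum (dsum F B1) P) (dsum C1 P)"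
    by (intro mod_hom_Pair mod_hom_compose[OF mod_hom_fst c1(1)] mod_hom_snd)
  note p_surj = map_fst_surj[OF coker_proj_surj, of A ?i ?M K] and p1_surj = map_fst_surj[OF c1(2), of P]
  have ker: "?p z = \<zero>\<^bsub>dsum ?Cok K\<^esub> \<longleftrightarrow> ?p1 (T' z) = \<zero>\<^bsub>dsum C1 P\<^esub>" if z: "z \<in> carrier (dsum ?M K)" for z
  proof -
    have "fst z \<in> carrier ?M" using z by auto
    then have "?p z = \<zero>\<^bsub>dsum ?Cok K\<^esub> \<longleftrightarrow> fst z \<in> ?i ` carrier A \<and> snd z = \<zero>\<^bsub>K\<^esub>"
      by (simp add: coker_proj_eq_zero_iff[OF A M i])
    also have "\<dots> \<longleftrightarrow> z \<in> ?S" by (cases z) auto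
    also have "\<dots> \<longleftrightarrow> T' z \<in> ?S1"
    proof
      assume "z \<in> ?S"
      then obtain s where s: "s \<in> ?S1" "z = T s" unfolding S[symmetric] by blast
      then show "T' z \<in> ?S1" using T'T S1 by auto
    next
      assume "T' z \<in> ?S1"
      then have "T (T' z) \<in> ?S" unfolding S[symmetric] by (rule imageI)
      then show "z \<in> ?S" by (simp only: TT'[OF z])
    qed
    also have "\<dots> \<longleftrightarrow> fst (T' z) \<in> (\<lambda>a. (\<ominus>\<^bsub>F\<^esub> \<epsilon>1 a, f1 a)) ` carrier A1 \<and> snd (T' z) = \<zero>\<^bsub>P\<^esub>"
      by (cases "T' z") auto
    also have "\<dots> \<longleftrightarrow> ?p1 (T' z) = \<zero>\<^bsub>dsum C1 P\<^esub>"
    proof -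
      have "fst (T' z) \<in> carrier (dsum F B1)"
        using mod_hom_closed[OF T' z] by (auto simp del: carrier_dsum simp: carrier_dsum[of "dsum F B1"])
      then show ?thesis by (simp add: c1_ker)
    qed
    finally show ?thesis .
  qed
  obtain \<gamma> where "\<gamma> \<in> mod_iso R (dsum ?Cok K) (dsum C1 P)"
    by (rule mod_iso_on_quotients[OF MK M1P module_dsum[OF Cok mK] module_dsum[OF C1 mP]
        p p_surj p1 p1_surj T' T TT' T'T ker]) blast+
  then show ?thesis by (rule stably_isomorphic_of_dsum_iso[OF Cok C1 K P])
qed

text \<open>The cokernel of the cone is formed in two stages. Dividing F^1 + G^0 by the image of
  G^-1 leaves F^1 plus the cokernel of \<open>e (-1)\<close>; the relations from F^0 then depend
  only on classes modulo the image of \<open>d (-1)\<close> and read (\<open>- \<epsilon> a\<close>,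
  \<open>f1 a\<close>).\<close>

lemma coker_at_cone_presentation:
  assumes F: "is_complex R F d" and G: "is_complex R G e" and h: "chain_map R F d G e h"
    and \<epsilon>: "\<epsilon> \<in> mod_hom R (coker_at F d (-1)) (F 1)"
      "\<And>x. x \<in> carrier (F 0) \<Longrightarrow> \<epsilon> (coker_proj (F (-1)) (d (-1)) (F 0) x) = d 0 x"
  defines "f1 \<equiv> coker_map (G (-1)) (e (-1)) (G 0) (h 0)"
    and "C1 \<equiv> coker_at (cone F G) (cone_diff F d G e h) (-1)"
  obtains c1 where "module R C1" "c1 \<in> mod_hom R (dsum (F 1) (coker_at G e (-1))) C1"
    "c1 ` carrier (dsum (F 1) (coker_at G e (-1))) = carrier C1"
    "\<And>z. z \<in> carrier (dsum (F 1) (coker_at G e (-1))) \<Longrightarrow>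
      c1 z = \<zero>\<^bsub>C1\<^esub> \<longleftrightarrow> z \<in> (\<lambda>a. (\<ominus>\<^bsub>F 1\<^esub> \<epsilon> a, f1 a)) ` carrier (coker_at F d (-1))"
proof -
  have mF: "module R (F n)" and mG: "module R (G n)" for n
    using is_complexD(1)[OF F] is_complexD(1)[OF G] by blast+
  have d: "d (-1) \<in> mod_hom R (F (-1)) (F 0)" "d 0 \<in> mod_hom R (F 0) (F 1)"
    and e: "e (-1) \<in> mod_hom R (G (-1)) (G 0)"
    using is_complexD(2)[OF F, of "-1"] is_complexD(2)[OF F, of 0] is_complexD(2)[OF G, of "-1"] by simp_all
  have h0: "h 0 \<in> mod_hom R (F 0) (G 0)" by (rule chain_mapD(1)[OF h])
  let ?C = "coker (F (-1)) (d (-1)) (F 0)" and ?C' = "coker (G (-1)) (e (-1)) (G 0)"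
  let ?\<pi> = "coker_proj (F (-1)) (d (-1)) (F 0)" and ?\<pi>' = "coker_proj (G (-1)) (e (-1)) (G 0)"
  note C' = module_coker[OF mG mG e] and \<pi>' = mod_hom_coker_proj[OF mG mG e]
  have f1\<pi>: "f1 (?\<pi> x) = ?\<pi>' (h 0 x)" if "x \<in> carrier (F 0)" for x
    unfolding f1_def by (rule mod_hom_coker_map_chain_map(2)[OF F G h that])
  interpret F0: module R "F 0" by (rule mF)
  interpret F1: module R "F 1" by (rule mF)
  interpret G0: module R "G 0" by (rule mG)
  let ?X1 = "dsum (F 0) (G (-1))" and ?X0 = "dsum (F 1) (G 0)" and ?Y = "dsum (F 1) ?C'"
  let ?D = "\<lambda>(x, y). (\<ominus>\<^bsub>F 1\<^esub> d 0 x, h 0 x \<oplus>\<^bsub>G 0\<^esub> e (-1) y)"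
  note X1 = module_dsum[OF mF mG, of 0 "-1"] and X0 = module_dsum[OF mF mG, of 1 0] and Y = module_dsum[OF mF C', of 1]
  note simps = mod_hom_simps[OF mF mF d(2)] mod_hom_simps[OF mG mG e] mod_hom_simps[OF mF mG h0]
  have D: "?D \<in> mod_hom R ?X1 ?X0"
  proof -
    have "(\<lambda>z. (\<ominus>\<^bsub>F 1\<^esub> d 0 (fst z), h 0 (fst z) \<oplus>\<^bsub>G 0\<^esub> e (-1) (snd z))) \<in> mod_hom R ?X1 ?X0"
      by (intro mod_hom_Pair mod_hom_uminus mod_hom_plus mF mG mod_hom_compose[OF mod_hom_fst d(2)]
          mod_hom_compose[OF mod_hom_fst h0] mod_hom_compose[OF mod_hom_snd e])
    then show ?thesis by (simp add: case_prod_beta')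
  qed
  let ?q = "coker_proj ?X1 ?D ?X0"
  have C1_eq: "C1 = coker ?X1 ?D ?X0" by (simp add: C1_def coker_at_def cone_def cone_diff_def)
  have C1: "module R C1" unfolding C1_eq by (rule module_coker[OF X1 X0 D])
  have q: "?q \<in> mod_hom R ?X0 C1" unfolding C1_eq by (rule mod_hom_coker_proj[OF X1 X0 D])
  have q_surj: "?q ` carrier ?X0 = carrier C1" unfolding C1_eq by (rule coker_proj_surj)
  have q0: "?q z = \<zero>\<^bsub>C1\<^esub> \<longleftrightarrow> z \<in> ?D ` carrier ?X1" if "z \<in> carrier ?X0" for z
    unfolding C1_eq by (rule coker_proj_eq_zero_iff[OF X1 X0 D that])
  let ?s = "\<lambda>z. (fst z, ?\<pi>' (snd z))"
  have s: "?s \<in> mod_hom R ?X0 ?Y" by (intro mod_hom_Pair mod_hom_fst mod_hom_compose[OF mod_hom_snd \<pi>'])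
  have s_surj: "?s ` carrier ?X0 = carrier ?Y" unfolding carrier_dsum coker_proj_surj[symmetric] by force
  have "?q z = \<zero>\<^bsub>C1\<^esub>" if z: "z \<in> carrier ?X0" and 0: "?s z = \<zero>\<^bsub>?Y\<^esub>" for z
  proof -
    have "fst z = \<zero>\<^bsub>F 1\<^esub>" "snd z \<in> e (-1) ` carrier (G (-1))"
      using z 0 coker_proj_eq_zero_iff[OF mG mG e, of "snd z"] by auto
    then obtain y where y: "y \<in> carrier (G (-1))" "z = (\<zero>\<^bsub>F 1\<^esub>, e (-1) y)" by (cases z) auto
    \<comment> \<open>What the first stage divides out is the restriction of the cone differential
      to pairs with zero first entry.\<close>
    then have "z = ?D (\<zero>\<^bsub>F 0\<^esub>, y)" by (simp add: simps F1.M.a_inv_zero)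
    then show ?thesis using q0[OF z] y(1) by (metis (no_types, lifting) F0.M.zero_closed SigmaI carrier_dsum image_eqI)
  qed
  then obtain c1 where c1: "c1 \<in> mod_hom R ?Y C1" "\<And>z. z \<in> carrier ?X0 \<Longrightarrow> c1 (?s z) = ?q z"
    by (rule mod_hom_factor_surj[OF X0 Y C1 s s_surj q]) blast+
  have c1_surj: "c1 ` carrier ?Y = carrier C1"
  proof -
    have "c1 ` carrier ?Y = (\<lambda>z. c1 (?s z)) ` carrier ?X0" unfolding s_surj[symmetric] by (simp only: image_image)
    also have "\<dots> = ?q ` carrier ?X0" by (rule image_cong[OF refl]) (rule c1(2))
    finally show ?thesis using q_surj by simp
  qed
  have ker: "c1 z = \<zero>\<^bsub>C1\<^esub> \<longleftrightarrow> z \<in> (\<lambda>a. (\<ominus>\<^bsub>F 1\<^esub> \<epsilon> a, f1 a)) ` carrier ?C" if zY: "z \<in> carrier ?Y" for z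
  proof -
    have "z \<in> ?s ` carrier ?X0" unfolding s_surj by (rule zY)
    then obtain x y where xy: "x \<in> carrier (F 1)" "y \<in> carrier (G 0)" "z = (x, ?\<pi>' y)" by auto
    have "c1 z = \<zero>\<^bsub>C1\<^esub> \<longleftrightarrow> (x, y) \<in> ?D ` carrier ?X1" using c1(2)[of "(x, y)"] q0[of "(x, y)"] xy by simp
    also have "\<dots> \<longleftrightarrow> z \<in> (\<lambda>a. (\<ominus>\<^bsub>F 1\<^esub> \<epsilon> a, f1 a)) ` ?\<pi> ` carrier (F 0)"
    proof
      assume "(x, y) \<in> ?D ` carrier ?X1"
      then obtain x0 y0 where xy0: "x0 \<in> carrier (F 0)" "y0 \<in> carrier (G (-1))"
        "x = \<ominus>\<^bsub>F 1\<^esub> d 0 x0" "y = h 0 x0 \<oplus>\<^bsub>G 0\<^esub> e (-1) y0" by auto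
      have cl: "h 0 x0 \<in> carrier (G 0)" "e (-1) y0 \<in> carrier (G 0)" using xy0 by (simp_all add: simps)
      have "y \<ominus>\<^bsub>G 0\<^esub> h 0 x0 = e (-1) y0" unfolding xy0(4) using cl by algebra
      then have "?\<pi>' y = ?\<pi>' (h 0 x0)"
        using coker_proj_eq_iff[OF mG mG e xy(2) cl(1)] xy0(2) by blast
      then have "z = (\<ominus>\<^bsub>F 1\<^esub> \<epsilon> (?\<pi> x0), f1 (?\<pi> x0))" using xy0 by (simp add: xy(3) \<epsilon>(2) f1\<pi>)
      then show "z \<in> (\<lambda>a. (\<ominus>\<^bsub>F 1\<^esub> \<epsilon> a, f1 a)) ` ?\<pi> ` carrier (F 0)" using xy0(1) by blast
    next
      assume "z \<in> (\<lambda>a. (\<ominus>\<^bsub>F 1\<^esub> \<epsilon> a, f1 a)) ` ?\<pi> ` carrier (F 0)"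
      then obtain x0 where x0: "x0 \<in> carrier (F 0)" "z = (\<ominus>\<^bsub>F 1\<^esub> \<epsilon> (?\<pi> x0), f1 (?\<pi> x0))" by blast
      then have x: "x = \<ominus>\<^bsub>F 1\<^esub> d 0 x0" and "?\<pi>' y = ?\<pi>' (h 0 x0)" using xy(3) by (simp_all add: \<epsilon>(2) f1\<pi>)
      have cl: "h 0 x0 \<in> carrier (G 0)" using x0 by (simp add: simps)
      have "y \<ominus>\<^bsub>G 0\<^esub> h 0 x0 \<in> e (-1) ` carrier (G (-1))"
        using \<open>?\<pi>' y = ?\<pi>' (h 0 x0)\<close> coker_proj_eq_iff[OF mG mG e xy(2) cl] by blast
      then obtain y0 where y0: "y0 \<in> carrier (G (-1))" "y \<ominus>\<^bsub>G 0\<^esub> h 0 x0 = e (-1) y0" by blast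
      have "y = h 0 x0 \<oplus>\<^bsub>G 0\<^esub> e (-1) y0" by (rule G0.M.minus_eq_imp_eq_plus[OF xy(2) cl y0(2)])
      then show "(x, y) \<in> ?D ` carrier ?X1" using x x0(1) y0(1) by (intro image_eqI[of _ _ "(x0, y0)"]) simp_all
    qed
    finally show ?thesis by (simp only: coker_proj_surj)
  qed
  show thesis by (rule that) (use C1 c1(1) c1_surj ker in \<open>simp_all only: coker_at_minus_one\<close>)
qed

section \<open>The criterion and the exact sequences for given resolutions of A and B\<close>

theorem theorem3p9:
  fixes R :: "('a, 'm) ring_scheme"
    and A :: "('a, 'b) module" and B :: "('a, 'c) module"
    and f :: "'b \<Rightarrow> 'c"
    and FA :: "int \<Rightarrow> ('a, 'u) module" and dA :: "int \<Rightarrow> 'u \<Rightarrow> 'u" and \<phi>A :: "'u set \<Rightarrow> 'b"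
    and FB :: "int \<Rightarrow> ('a, 'v) module" and dB :: "int \<Rightarrow> 'v \<Rightarrow> 'v" and \<phi>B :: "'v set \<Rightarrow> 'c"
    and fc :: "int \<Rightarrow> 'u \<Rightarrow> 'v"
  assumes "cring R" and "semiperfect R"
    and "fg_module R A" and "fg_module R B" and "f \<in> mod_hom R A B"
    and "standard_resolution R A FA dA \<phi>A" and "standard_resolution R B FB dB \<phi>B"
    and "induced_chain_map R A FA dA \<phi>A B FB dB \<phi>B f fc"
  shows
    "(represented_by_monos R A B f \<longleftrightarrow>
        zero_module (cohomology (cone FA FB) (cone_diff FA dA FB dB fc) (-1))) \<and>
     (represented_by_monos R A B f \<longrightarrow> \<phi>A \<in> mod_iso R (coker_at FA dA (-1)) A \<longrightarrow>
       (\<forall>\<epsilon>. induced_by_d0 R A FA dA \<phi>A \<epsilon> \<longrightarrow>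
         (let M = dsum B (FA 1);
              i = col_map f \<epsilon>;
              Cok = coker A i M;
              c\<pi> = coker_proj A i M
          in
          \<comment> \<open>(1)\<close>
          stably_isomorphic R Cok (coker_at (cone FA FB) (cone_diff FA dA FB dB fc) (-1)) \<and>
          perfect_exact R A i M c\<pi> Cok \<and>
          (\<forall>(P' :: ('a, 'p) module) (C :: ('a, 'q) module) q g p.
             projective R P' \<longrightarrow> fg_module R C \<longrightarrow>
             q \<in> mod_hom R A P' \<longrightarrow> g \<in> mod_hom R B C \<longrightarrow> p \<in> mod_hom R P' C \<longrightarrow>
             short_exact R A (col_map f q) (dsum B P') (row_map C g p) C \<longrightarrow>
             \<comment> \<open>(2)\<close>
             (\<exists>\<alpha> \<beta> \<gamma>.
                sequence_hom R A i M c\<pi> Cok A (col_map f q) (dsum B P') (row_map C g p) C \<alpha> \<beta> \<gamma> \<and>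
                stable_iso R A A \<alpha> \<and> stable_iso R M (dsum B P') \<beta>) \<and>
             \<comment> \<open>(3)\<close>
             (\<forall>\<alpha> \<beta> \<gamma>.
                sequence_hom R A i M c\<pi> Cok A (col_map f q) (dsum B P') (row_map C g p) C \<alpha> \<beta> \<gamma> \<and>
                stable_iso R A A \<alpha> \<and> stable_iso R M (dsum B P') \<beta> \<longrightarrow>
                (\<exists>(Q :: 'a umod) (Q' :: 'a umod) s j.
                   projective R Q \<and> projective R Q' \<and> s \<in> mod_hom R Q C \<and>
                   short_exact R Q' j (dsum Cok Q) (row_map C \<gamma> s) C)) \<and>
             \<comment> \<open>(4)\<close>
             (perfect_exact R A (col_map f q) (dsum B P') (row_map C g p) C \<longrightarrow>
                isomorphic_upto_trivial R A (col_map f q) (dsum B P') (row_map C g p) C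
                  A i M c\<pi> Cok)))))"
proof -
  have A: "module R A" and B: "module R B" using assms(3,4) by (simp_all add: fg_moduleD)
  note f = \<open>f \<in> mod_hom R A B\<close>
  have cA: "is_complex R FA dA" and pA: "\<And>n. projective R (FA n)"
    and dualA: "zero_module (dual_cohomology R FA dA 0)" and \<phi>A_iso: "stable_iso R (coker_at FA dA (-1)) A \<phi>A"
    using assms(6) by (simp_all add: standard_resolution_def)
  have cB: "is_complex R FB dB" and hB: "zero_module (cohomology FB dB (-1))"
    and \<phi>B_iso: "stable_iso R (coker_at FB dB (-1)) B \<phi>B"
    using assms(7) by (simp_all add: standard_resolution_def)
  define f1 where "f1 = coker_map (FB (-1)) (dB (-1)) (FB 0) (fc 0)"
  have fc: "chain_map R FA dA FB dB fc"
    and eq: "stably_eq R (coker_at FA dA (-1)) B (\<phi>B \<circ> f1) (f \<circ> \<phi>A)"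
    using assms(8) by (simp_all add: induced_chain_map_def f1_def)
  define A1 where "A1 = coker_at FA dA (-1)"
  define B1 where "B1 = coker_at FB dB (-1)"
  let ?\<pi> = "coker_proj (FA (-1)) (dA (-1)) (FA 0)"
  note folds = A1_def B1_def f1_def
  have mF: "module R (FA n)" for n by (rule is_complexD(1)[OF cA])
  have A1: "module R A1"
    using module_coker[OF mF mF is_complexD(2)[OF cA, of "-1"]] by (simp add: A1_def coker_at_def)
  have B1: "module R B1"
    using module_coker[OF is_complexD(1)[OF cB] is_complexD(1)[OF cB] is_complexD(2)[OF cB, of "-1"]]
    by (simp add: B1_def coker_at_def)
  have \<pi>_surj: "?\<pi> ` carrier (FA 0) = carrier A1" by (simp add: A1_def coker_at_def coker_proj_surj)
  note f1 = mod_hom_coker_map_chain_map(1)[OF cA cB fc, folded folds]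
  note \<phi>A_iso' = \<phi>A_iso[folded folds] and \<phi>B_iso' = \<phi>B_iso[folded folds] and eq' = eq[folded folds]
  obtain \<epsilon>1 where \<epsilon>1: "\<epsilon>1 \<in> mod_hom R A1 (FA 1)"
    and \<epsilon>1\<pi>: "\<And>x. x \<in> carrier (FA 0) \<Longrightarrow> \<epsilon>1 (?\<pi> x) = dA 0 x"
    and ext1: "extends_functionals R A1 \<epsilon>1 (FA 1)"
    using augmentation_extends_functionals[OF cA dualA] unfolding A1_def by blast
  have null1: "projectively_null R A1 = {x \<in> carrier A1. \<epsilon>1 x = \<zero>\<^bsub>FA 1\<^esub>}"
    by (rule projectively_null_extends_functionals[OF A1 pA \<epsilon>1 ext1])
  interpret A: module R A by fact
  interpret B: module R B by fact

  have mono_iff: "represented_by_monos R A B f \<longleftrightarrow>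
    (\<forall>x\<in>projectively_null R A. f x = \<zero>\<^bsub>B\<^esub> \<longrightarrow> x = \<zero>\<^bsub>A\<^esub>)"
  proof -
    obtain g and P :: "'a umod" and u v where \<phi>A: "\<phi>A \<in> mod_hom R A1 A" and g: "g \<in> mod_hom R A A1"
      and P: "projective R P" and u: "u \<in> mod_hom R A P" and v: "v \<in> mod_hom R P A"
      and vu: "\<And>y. y \<in> carrier A \<Longrightarrow> \<phi>A (g y) = y \<oplus>\<^bsub>A\<^esub> v (u y)"
      by (rule stable_isoE[OF \<phi>A_iso' A1 A]) blast
    \<comment> \<open>Since \<open>\<phi>A\<close> is only a stable isomorphism,
      \<open>\<epsilon>1 \<circ> g\<close> alone does not detect null elements. The component
      \<open>u\<close> of the error term is added: where it vanishes, x =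
      \<open>\<phi>A (g x)\<close>, and null elements are preserved by
      \<open>\<phi>A\<close>.\<close>
    let ?q = "\<lambda>x. (\<epsilon>1 (g x), u x)"
    have q: "?q \<in> mod_hom R A (dsum (FA 1) P)" by (intro mod_hom_Pair mod_hom_compose[OF g \<epsilon>1] u)
    show ?thesis
    proof (rule represented_by_monos_iff[OF assms(3,4) f projective_dsum[OF pA P] q])
      fix x assume x: "x \<in> carrier A" and 0: "?q x = \<zero>\<^bsub>dsum (FA 1) P\<^esub>"
      have "g x \<in> projectively_null R A1" unfolding null1 using 0 mod_hom_closed[OF g x] by simp
      then have "\<phi>A (g x) \<in> projectively_null R A" by (rule projectively_null_hom[OF _ \<phi>A])
      moreover have "\<phi>A (g x) = x"
        using vu[OF x] 0 x by (simp add: mod_hom_zero[OF projective_module[OF P] A v])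
      ultimately show "x \<in> projectively_null R A" by simp
    qed
  qed
  have cone_iff: "zero_module (cohomology (cone FA FB) (cone_diff FA dA FB dB fc) (-1)) \<longleftrightarrow>
    (\<forall>x\<in>projectively_null R A1. f1 x = \<zero>\<^bsub>B1\<^esub> \<longrightarrow> x = \<zero>\<^bsub>A1\<^esub>)"
  proof -
    have "zero_module (cohomology (cone FA FB) (cone_diff FA dA FB dB fc) (-1)) \<longleftrightarrow>
      (\<forall>x\<in>carrier A1. \<epsilon>1 x = \<zero>\<^bsub>FA 1\<^esub> \<longrightarrow> f1 x = \<zero>\<^bsub>B1\<^esub> \<longrightarrow> x = \<zero>\<^bsub>A1\<^esub>)"
      by (rule zero_module_cohomology_cone_iff[OF cA cB fc hB, folded folds, OF \<epsilon>1 \<epsilon>1\<pi>])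
    then show ?thesis unfolding null1 by auto
  qed
  \<comment> \<open>Both sides are one condition on null elements, read on A and on the cokernel
    \<open>A1\<close>; the stable isomorphisms \<open>\<phi>A\<close> and \<open>\<phi>B\<close>
    carry it across.\<close>
  have part0: "represented_by_monos R A B f \<longleftrightarrow>
    zero_module (cohomology (cone FA FB) (cone_diff FA dA FB dB fc) (-1))"
    unfolding mono_iff cone_iff
    by (rule projectively_null_injective_stable_iso[OF A A1 B B1 f f1 \<phi>A_iso' \<phi>B_iso' eq'])

  show ?thesis
  proof (intro conjI impI allI part0, unfold Let_def, intro conjI impI allI)
    assume mono: "represented_by_monos R A B f" and \<phi>A_mod_iso: "\<phi>A \<in> mod_iso R (coker_at FA dA (-1)) A"
    fix \<epsilon> assume ind: "induced_by_d0 R A FA dA \<phi>A \<epsilon>"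
    let ?M = "dsum B (FA 1)" and ?i = "col_map f \<epsilon>"
    let ?Cok = "coker A ?i ?M" and ?c = "coker_proj A ?i ?M"
    have \<epsilon>: "\<epsilon> \<in> mod_hom R A (FA 1)" and \<epsilon>d: "\<And>x. x \<in> carrier (FA 0) \<Longrightarrow> \<epsilon> (\<phi>A (?\<pi> x)) = dA 0 x"
      using ind by (simp_all add: induced_by_d0_def)
    obtain k where \<phi>A: "\<phi>A \<in> mod_hom R A1 A" and k: "k \<in> mod_hom R A A1"
      and k\<phi>: "\<And>x. x \<in> carrier A1 \<Longrightarrow> k (\<phi>A x) = x" and \<phi>k: "\<And>y. y \<in> carrier A \<Longrightarrow> \<phi>A (k y) = y"
      by (rule mod_isoE[OF \<phi>A_mod_iso[folded A1_def] A1 A]) blast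
    have \<phi>A_surj: "\<phi>A ` carrier A1 = carrier A"
      using \<phi>A_mod_iso by (simp add: A1_def mod_iso_def bij_betw_def)
    have \<epsilon>\<phi>: "\<epsilon> (\<phi>A a) = \<epsilon>1 a" if "a \<in> carrier A1" for a
    proof -
      have "a \<in> ?\<pi> ` carrier (FA 0)" unfolding \<pi>_surj by (rule that)
      then show ?thesis using \<epsilon>d \<epsilon>1\<pi> by auto
    qed
    \<comment> \<open>The normalisation enters here: through the honest inverse \<open>k\<close> of
      \<open>\<phi>A\<close>, the extension property moves from \<open>A1\<close> to A.\<close>
    have ext\<epsilon>: "extends_functionals R A \<epsilon> (FA 1)"
      unfolding extends_functionals_def
    proof
      fix u assume u: "u \<in> mod_hom R A (self_module R)"
      obtain w where w: "w \<in> mod_hom R (FA 1) (self_module R)" "\<And>x. x \<in> carrier A1 \<Longrightarrow> w (\<epsilon>1 x) = u (\<phi>A x)"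
        using bspec[OF ext1[unfolded extends_functionals_def] mod_hom_compose[OF \<phi>A u]] by blast
      have "w (\<epsilon> x) = u x" if "x \<in> carrier A" for x
        using \<epsilon>\<phi>[OF mod_hom_closed[OF k that]] w(2)[OF mod_hom_closed[OF k that]] \<phi>k[OF that] by simp
      then show "\<exists>w\<in>mod_hom R (FA 1) (self_module R). \<forall>x\<in>carrier A. w (\<epsilon> x) = u x" using w(1) by blast
    qed
    note M = module_dsum[OF B mF, of 1] and i = mod_hom_col_map[OF f \<epsilon>]
    note Cok = module_coker[OF A M i] and c = mod_hom_coker_proj[OF A M i]
    have c0: "?c x = \<zero>\<^bsub>?Cok\<^esub> \<longleftrightarrow> x \<in> ?i ` carrier A" if "x \<in> carrier ?M" for x
      by (rule coker_proj_eq_zero_iff[OF A M i that])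
    have ext: "extends_functionals R A ?i ?M"
      unfolding extends_functionals_def
    proof
      fix u assume u: "u \<in> mod_hom R A (self_module R)"
      obtain w where w: "w \<in> mod_hom R (FA 1) (self_module R)" "\<And>x. x \<in> carrier A \<Longrightarrow> w (\<epsilon> x) = u x"
        using bspec[OF ext\<epsilon>[unfolded extends_functionals_def] u] by blast
      show "\<exists>w\<in>mod_hom R ?M (self_module R). \<forall>x\<in>carrier A. w (?i x) = u x"
        by (intro bexI[OF _ mod_hom_compose[OF mod_hom_snd w(1)]]) (simp add: col_map_def w(2))
    qed
    \<comment> \<open>An element killed by \<open>f\<close> and \<open>\<epsilon>\<close> is a null
      element in the kernel of \<open>f\<close>, which \<open>mono_iff\<close> rules out unless it
      is zero.\<close>
    have inj: "inj_on ?i (carrier A)"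
    proof (rule inj_on_mod_hom[OF A M i])
      fix x assume x: "x \<in> carrier A" and "?i x = \<zero>\<^bsub>?M\<^esub>"
      then have fx: "f x = \<zero>\<^bsub>B\<^esub>" and "\<epsilon> x = \<zero>\<^bsub>FA 1\<^esub>" by (simp_all add: col_map_def)
      then have "x \<in> projectively_null R A"
        unfolding projectively_null_extends_functionals[OF A pA \<epsilon> ext\<epsilon>] using x by simp
      then show "x = \<zero>\<^bsub>A\<^esub>" using mono fx unfolding mono_iff by blast
    qed
    have ker: "?i ` carrier A = a_kernel ?M ?Cok ?c"
      using c0 mod_hom_closed[OF i] unfolding a_kernel_def' by blast
    have \<theta>: "short_exact R A ?i ?M ?c ?Cok"
      unfolding short_exact_def by (intro conjI A M Cok i c inj ker coker_proj_surj)
    show "perfect_exact R A ?i ?M ?c ?Cok" by (rule perfect_exactI[OF \<theta> ext])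
    show "stably_isomorphic R ?Cok (coker_at (cone FA FB) (cone_diff FA dA FB dB fc) (-1))"
    proof (rule coker_at_cone_presentation[OF cA cB fc \<epsilon>1[unfolded A1_def] \<epsilon>1\<pi>, folded folds])
      fix c1
      let ?C1 = "coker_at (cone FA FB) (cone_diff FA dA FB dB fc) (-1)"
      assume c1: "module R ?C1" "c1 \<in> mod_hom R (dsum (FA 1) B1) ?C1"
        "c1 ` carrier (dsum (FA 1) B1) = carrier ?C1"
        "\<And>z. z \<in> carrier (dsum (FA 1) B1) \<Longrightarrow>
          c1 z = \<zero>\<^bsub>?C1\<^esub> \<longleftrightarrow> z \<in> (\<lambda>a. (\<ominus>\<^bsub>FA 1\<^esub> \<epsilon>1 a, f1 a)) ` carrier A1"
      show ?thesis
        by (rule stably_isomorphic_cokernels[OF A A1 B B1 pA c1(1) f f1 \<phi>A \<phi>A_surj \<phi>B_iso' eq' \<epsilon> \<epsilon>1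
            \<epsilon>\<phi> ext1 c1(2,3,4)])
    qed
    fix P' :: "('a, 'p) module" and C :: "('a, 'q) module" and q g p
    assume P': "projective R P'" and "fg_module R C" and q: "q \<in> mod_hom R A P'"
      and g: "g \<in> mod_hom R B C" and p: "p \<in> mod_hom R P' C"
      and \<sigma>: "short_exact R A (col_map f q) (dsum B P') (row_map C g p) C"
    have mP': "module R P'" and C: "module R C"
      using P' \<open>fg_module R C\<close> by (simp_all add: projective_module fg_moduleD)
    interpret P': module R P' by fact
    interpret F1: module R "FA 1" by (rule mF)
    note N = module_dsum[OF B mP'] and row = mod_hom_row_map[OF C g p]
    show "\<exists>\<alpha> \<beta> \<gamma>.
      sequence_hom R A ?i ?M ?c ?Cok A (col_map f q) (dsum B P') (row_map C g p) C \<alpha> \<beta> \<gamma> \<and>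
      stable_iso R A A \<alpha> \<and> stable_iso R ?M (dsum B P') \<beta>"
    proof -
      obtain t where t: "t \<in> mod_hom R (FA 1) P'" and t\<epsilon>: "\<And>x. x \<in> carrier A \<Longrightarrow> t (\<epsilon> x) = q x"
        by (rule extends_functionals_projective[OF ext\<epsilon> A mF P' q \<epsilon>]) blast
      \<comment> \<open>The stable inverse discards the projective component. Both composites send
        (b, y) to (b, 0) = (b, y) + (0, -y), an error through \<open>FA 1\<close> or
        \<open>P'\<close>.\<close>
      let ?\<beta> = "\<lambda>z. (fst z, t (snd z))" and ?\<beta>' = "\<lambda>z. (fst z, \<zero>\<^bsub>FA 1\<^esub>)"
      have \<beta>: "?\<beta> \<in> mod_hom R ?M (dsum B P')" by (intro mod_hom_Pair mod_hom_fst mod_hom_compose[OF mod_hom_snd t])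
      have \<beta>': "?\<beta>' \<in> mod_hom R (dsum B P') ?M" by (intro mod_hom_Pair mod_hom_fst mod_hom_zero_map mF)
      have \<beta>i: "?\<beta> (?i x) = col_map f q x" if "x \<in> carrier A" for x using that by (simp add: col_map_def t\<epsilon>)
      note neg = mod_hom_compose[OF mod_hom_uminus[OF _ mod_hom_id[unfolded id_def]] mod_hom_zero_Pair[OF B]]
      have \<beta>_iso: "stable_iso R ?M (dsum B P') ?\<beta>"
        by (rule stable_isoI[OF M N \<beta> \<beta>' pA mod_hom_snd neg[OF mF] P' mod_hom_snd neg[OF mP']])
          (auto simp: F1.M.r_neg P'.M.r_neg mod_hom_zero[OF mF mP' t])
      have "row_map C g p (?\<beta> x) = \<zero>\<^bsub>C\<^esub>" if x: "x \<in> carrier ?M" and 0: "?c x = \<zero>\<^bsub>?Cok\<^esub>" for x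
      proof -
        obtain a where a: "a \<in> carrier A" "x = ?i a" using c0[OF x] 0 by blast
        then have "?\<beta> x \<in> a_kernel (dsum B P') C (row_map C g p)"
          using \<sigma> \<beta>i[OF a(1)] unfolding short_exact_def by blast
        then show ?thesis by (simp add: a_kernel_def')
      qed
      then obtain \<gamma> where \<gamma>: "\<gamma> \<in> mod_hom R ?Cok C" "\<And>x. x \<in> carrier ?M \<Longrightarrow> \<gamma> (?c x) = row_map C g p (?\<beta> x)"
        by (rule mod_hom_factor_surj[OF M Cok C c coker_proj_surj mod_hom_compose[OF \<beta> row]]) blast+
      have "sequence_hom R A ?i ?M ?c ?Cok A (col_map f q) (dsum B P') (row_map C g p) C id ?\<beta> \<gamma>"
        unfolding sequence_hom_def using mod_hom_id \<beta> \<gamma> \<beta>i by simp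
      then show ?thesis using stable_iso_id[OF assms(1) A] \<beta>_iso by blast
    qed
    \<comment> \<open>Perfectness of \<open>\<sigma>\<close> supplies extensions along
      \<open>col_map f q\<close>; those along \<open>?i\<close> are \<open>ext\<close>.\<close>
    show "isomorphic_upto_trivial R A (col_map f q) (dsum B P') (row_map C g p) C A ?i ?M ?c ?Cok"
      if perf: "perfect_exact R A (col_map f q) (dsum B P') (row_map C g p) C"
      by (rule isomorphic_upto_trivial_of_extends[OF P' pA B \<sigma> \<theta> q \<epsilon>
          perfect_exact_extends_functionals[OF perf] ext])
    fix \<alpha> \<beta> \<gamma>
    assume hom: "sequence_hom R A ?i ?M ?c ?Cok A (col_map f q) (dsum B P') (row_map C g p) C \<alpha> \<beta> \<gamma> \<and>
      stable_iso R A A \<alpha> \<and> stable_iso R ?M (dsum B P') \<beta>"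
    show "\<exists>(Q :: 'a umod) (Q' :: 'a umod) s j. projective R Q \<and> projective R Q' \<and> s \<in> mod_hom R Q C \<and>
      short_exact R Q' j (dsum ?Cok Q) (row_map C \<gamma> s) C"
      by (rule projective_kernel_of_sequence_hom[OF \<theta> \<sigma> ext]) (use hom in blast)+
  qed
qed

end
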